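(* Assume the following. (a) For some choice of $\alpha,\beta$ with $\{\alpha,\beta\}=\{1,2\}$, the function $v_\alpha$ is $2\bar{\pi}$ periodic and $\int_{\mathbb{T}^3}v_\beta(s)g(s)\,ds=0$ for every $2\bar{\pi}$ periodic function $g\in L_2(\mathbb{T}^3)$. (b) $w_2(p+2\bar{\pi},q)=w_2(p,q+2\bar{\pi})=w_2(p,q)$ for all $p,q\in\mathbb{T}^3$; the function $w_2$ has a unique non-degenerate minimum at a point $(p_0,p_0)\in(\mathbb{T}^3)^2$; and all third order partial derivatives of $w_1$ and $w_2$ are continuous on $\mathbb{T}^3$ and $(\mathbb{T}^3)^2$, respectively. (c) For each $\alpha\in\{1,2\}$ at least one of the following three conditions holds (possibly different ones for $\alpha=1$ and $\alpha=2$): ($\alpha$.1) $\min_{p\in\mathbb{T}^3}\Delta_\alpha(p;m)>0$; ($\alpha$.2) $\min_{p\in\mathbb{T}^3}\Delta_\alpha(p;m)<0$, $\max_{p\in\mathbb{T}^3}\Delta_\alpha(p;m)\ge0$, and: the set $\{p\in\mathbb{T}^3:\Delta_\alpha(p;E_{\rm min}^{(\alpha)})=0\}$ is a finite nonempty set $\{p_{\alpha1},\dots,p_{\alpha n_\alpha}\}$, there exist positive numbers $C,\delta$ and $\beta_{\alpha i}\in(0,2]$, $i=1,\dots,n_\alpha$, such that $|\Delta_\alpha(p;E_{\rm min}^{(\alpha)})|\ge C|p-p_{\alpha i}|^{\beta_{\alpha i}}$ for all $p\in U_\delta(p_{\alpha i})$, $i=1,\dots,n_\alpha$, and $\Delta_\alpha(p;E_{\rm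 min}^{(\alpha)})>0$ for all $p\in\mathbb{T}^3\setminus\{p_{\alpha1},\dots,p_{\alpha n_\alpha}\}$; ($\alpha$.3) $\max_{p\in\mathbb{T}^3}\Delta_\alpha(p;m)<0$, and: the set $\{p\in\mathbb{T}^3:\Delta_\alpha(p;E_{\rm min}^{(\alpha)})=0\}$ is a finite nonempty set $\{p_{\alpha1},\dots,p_{\alpha n_\alpha}\}$, there exist positive numbers $C,\delta$ and $\beta_{\alpha i}\in(0,2]$ such that $|\Delta_\alpha(p;E_{\rm min}^{(\alpha)})|\ge C|p-p_{\alpha i}|^{\beta_{\alpha i}}$ for all $p\in U_\delta(p_{\alpha i})$, $i=1,\dots,n_\alpha$, and $\Delta_\alpha(p;E_{\rm min}^{(\alpha)})>0$ for all $p\in\mathbb{T}^3\setminus\{p_{\alpha1},\dots,p_{\alpha n_\alpha}\}$; and moreover the set $\{p\in\mathbb{T}^3:\Delta_\alpha(p;E_{\rm max}^{(\alpha)})=0\}$ is a finite nonempty set $\{q_{\alpha1},\dots,q_{\alpha k_\alpha}\}$, there exist positive numbers $K,\rho$ and $\gamma_{\alpha j}\in(0,2]$, $j=1,\dots,k_\alpha$, such that $|\Delta_\alpha(p;E_{\rm max}^{(\alpha)})|\ge K|p-q_{\alpha j}|^{\gamma_{\alpha j}}$ for all $p\in U_\rho(q_{\alpha j})$, $j=1,\dots,k_\alpha$, and $\Delta_\alpha(p;E_{\rm max}^{(\alpha)})<0$ for all $p\in\mathbb{T}^3\setminus\{q_{\alpha1},\dots,q_{\alpha k_\alpha}\}$.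 Then the operator matrix $H$ has a finite number of discrete eigenvalues lying on the left of $m$ (that is, in $(-\infty,m)$).
   Context: $\mathbb{T}^3$ is the three-dimensional torus: the cube $(-\pi,\pi]^3$ with appropriately identified sides, with its Haar measure, regarded as a group under addition modulo $(2\pi\mathbb{Z})^3$; $|p-q|$ is the Euclidean norm of the representative of $p-q$ in $(-\pi,\pi]^3$, and $U_\delta(p_0)=\{p\in\mathbb{T}^3:|p-p_0|<\delta\}$. $\bar{\pi}:=(\pi,\pi,\pi)$, and a function $f$ is $2\bar{\pi}$ periodic if $f(p+2\bar{\pi})=f(p)$ for all $p$. A minimum is non-degenerate if the Hessian there is non-degenerate (hence positive definite). Let $\mathcal{H}_0=\mathbb{C}$, $\mathcal{H}_1=L_2(\mathbb{T}^3)$, $\mathcal{H}_2=L_2^{\rm s}((\mathbb{T}^3)^2)$ (square integrable complex symmetric functions on $(\mathbb{T}^3)^2$), and $\mathcal{H}=\mathcal{H}_0\oplus\mathcal{H}_1\oplus\mathcal{H}_2$. Let $w_0\in\mathbb{R}$, let $w_1,v_0,v_1,v_2$ be real-valued continuous functions on $\mathbb{T}^3$, and let $w_2$ be a real-valued continuous symmetric function on $(\mathbb{T}^3)^2$. The bounded self-adjoint operator $H$ in $\mathcal{H}$ is $$H=\begin{pmatrix}H_{00}&H_{01}&0\\ H_{01}^*&H_{11}&H_{12}\\ 0&H_{12}^*&H_{22}\end{pmatrix},$$ where $H_{00}f_0=w_0f_0$, $H_{01}f_1=\int_{\mathbb{T}^3}v_0(s)f_1(s)\,ds$, $(H_{11}f_1)(p)=w_1(p)f_1(p)$,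 $(H_{12}f_2)(p)=\int_{\mathbb{T}^3}v_1(s)f_2(p,s)\,ds$, $H_{22}=H_{22}^0-V$, $(H_{22}^0f_2)(p,q)=w_2(p,q)f_2(p,q)$, $$(Vf_2)(p,q)=v_2(q)\int_{\mathbb{T}^3}v_2(s)f_2(p,s)\,ds+v_2(p)\int_{\mathbb{T}^3}v_2(s)f_2(s,q)\,ds,$$ and $(H_{01}^*f_0)(p)=v_0(p)f_0$, $(H_{12}^*f_1)(p,q)=\frac12\big(v_1(p)f_1(q)+v_1(q)f_1(p)\big)$. A discrete eigenvalue is an element of the discrete spectrum $\sigma_{\rm disc}$ (isolated eigenvalue of finite multiplicity). Put $m:=\min_{p,q\in\mathbb{T}^3}w_2(p,q)$, $m(p):=\min_{q}w_2(p,q)$, $M(p):=\max_{q}w_2(p,q)$. For $p\in\mathbb{T}^3$ and $z\in\mathbb{C}\setminus[m(p);M(p)]$ define $$\Delta_1(p;z):=w_1(p)-z-\frac12\int_{\mathbb{T}^3}\frac{v_1^2(s)\,ds}{w_2(p,s)-z},\qquad \Delta_2(p;z):=1-\int_{\mathbb{T}^3}\frac{v_2^2(s)\,ds}{w_2(p,s)-z};$$ $\Delta_\alpha(p;m)$ is defined for all $p$ by the same formulas with $z=m$ (under the assumption that $w_2$ has a unique non-degenerate minimum at $(p_0,p_0)$ the integrals are finite and $\Delta_\alpha(\cdot;m)$ is continuous). For $p\in\mathbb{T}^3$ let $h_1(p)$ act in $\mathcal{H}_0\oplus\mathcal{H}_1$ by $$h_1(p)(f_0,f_1)=\Big(w_1(p)f_0+\tfrac{1}{\sqrt2}\int_{\mathbb{T}^3}v_1(s)f_1(s)\,ds,\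 \tfrac{1}{\sqrt2}v_1(\cdot)f_0+w_2(p,\cdot)f_1(\cdot)\Big),$$ and let $h_2(p)$ act in $L_2(\mathbb{T}^3)$ by $(h_2(p)f_1)(q)=w_2(p,q)f_1(q)-v_2(q)\int_{\mathbb{T}^3}v_2(s)f_1(s)\,ds$. Set $\sigma_\alpha:=\bigcup_{p\in\mathbb{T}^3}\sigma_{\rm disc}(h_\alpha(p))$. If $\min_{p}\Delta_\alpha(p;m)<0$, then $\sigma_\alpha\cap(-\infty;m]\ne\emptyset$ and one sets $$E_{\rm min}^{(\alpha)}:=\min\{\sigma_\alpha\cap(-\infty;m]\},\qquad E_{\rm max}^{(\alpha)}:=\max\{\sigma_\alpha\cap(-\infty;m]\}.$$ *)

theory Defs
  imports "HOL-Analysis.Analysis" "HOL-Library.Function_Algebras"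
begin

section \<open>The torus\<close>

type_synonym R3 = "real ^ 3"

text \<open>
  A function on the torus is represented by a function on \<open>real ^ 3\<close> that is \<open>2 * pi\<close> periodic in
  each coordinate, so that addition modulo the lattice becomes addition in \<open>real ^ 3\<close>. Every point
  of the torus has exactly one representative in \<open>torus_cell\<close>, and sets of points of the torus are
  subsets of \<open>torus_cell\<close>.
\<close>

definition torus_cell :: "R3 set" where
  "torus_cell = {p. \<forall>i. - pi < p $ i \<and> p $ i \<le> pi}"

definition torus_fun :: "(R3 \<Rightarrow> 'b) \<Rightarrow> bool" where
  "torus_fun f \<longleftrightarrow> (\<forall>p i. f (p + axis i (2 * pi)) = f p)"

definition torus_fun2 :: "(R3 \<times> R3 \<Rightarrow> 'b) \<Rightarrow> bool" where
  "torus_fun2 f \<longleftrightarrow> (\<forall>q. torus_fun (\<lambda>p. f (p, q))) \<and> (\<forall>p. torus_fun (\<lambda>q. f (p, q)))"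

definition sym_fun :: "('a \<times> 'a \<Rightarrow> 'b) \<Rightarrow> bool" where
  "sym_fun f \<longleftrightarrow> (\<forall>p q. f (p, q) = f (q, p))"

definition torus_rep :: "R3 \<Rightarrow> R3" where
  "torus_rep p = (\<chi> i. p $ i - 2 * pi * of_int \<lceil>(p $ i - pi) / (2 * pi)\<rceil>)"

lemma torus_rep_in_cell: "torus_rep p \<in> torus_cell"
proof -
  have "- pi < x - 2 * pi * of_int \<lceil>(x - pi) / (2 * pi)\<rceil> \<and>
        x - 2 * pi * of_int \<lceil>(x - pi) / (2 * pi)\<rceil> \<le> pi" for x :: real
  proof -
    define k :: real where "k = of_int \<lceil>(x - pi) / (2 * pi)\<rceil>"
    have "k - 1 < (x - pi) / (2 * pi)" "(x - pi) / (2 * pi) \<le> k"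
      using ceiling_correct[of "(x - pi) / (2 * pi)"] by (auto simp: k_def)
    then have "(k - 1) * (2 * pi) < x - pi" "x - pi \<le> k * (2 * pi)"
      using pi_gt_zero by (simp_all add: pos_less_divide_eq pos_divide_le_eq)
    then show ?thesis unfolding k_def[symmetric] by (simp add: algebra_simps)
  qed
  then show ?thesis by (simp add: torus_rep_def torus_cell_def)
qed

definition torus_dist :: "R3 \<Rightarrow> R3 \<Rightarrow> real" where
  "torus_dist p q = norm (torus_rep (p - q))"

definition torus_nbhd :: "real \<Rightarrow> R3 \<Rightarrow> R3 set" where
  "torus_nbhd \<delta> p0 = {p \<in> torus_cell. torus_dist p p0 < \<delta>}"

definition torus_measure :: "R3 measure" where
  "torus_measure = restrict_space lborel torus_cell"

definition pi_bar :: "R3" where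
  "pi_bar = (\<chi> i. pi)"

text \<open>
  Since addition on the torus is modulo \<open>2 * pi\<close> in each coordinate, this property is implied by
  \<open>torus_fun\<close>; it is nevertheless kept as the notion occurring in the hypotheses.
\<close>

definition two_pi_bar_periodic :: "(R3 \<Rightarrow> 'b) \<Rightarrow> bool" where
  "two_pi_bar_periodic f \<longleftrightarrow> (\<forall>p. f (p + 2 *\<^sub>R pi_bar) = f p)"

definition minimum :: "real set \<Rightarrow> real" where
  "minimum S = (LEAST x. x \<in> S)"

definition maximum :: "real set \<Rightarrow> real" where
  "maximum S = (GREATEST x. x \<in> S)"


section \<open>Partial derivatives\<close>

definition partial_deriv :: "'a \<Rightarrow> ('a::euclidean_space \<Rightarrow> real) \<Rightarrow> 'a \<Rightarrow> real" where
  "partial_deriv b f x = deriv (\<lambda>t. f (x + t *\<^sub>R b)) 0"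

definition has_partial :: "'a \<Rightarrow> ('a::euclidean_space \<Rightarrow> real) \<Rightarrow> bool" where
  "has_partial b f \<longleftrightarrow> (\<forall>x. (\<lambda>t. f (x + t *\<^sub>R b)) field_differentiable (at 0))"

definition continuous_third_partials :: "('a::euclidean_space \<Rightarrow> real) \<Rightarrow> bool" where
  "continuous_third_partials f \<longleftrightarrow>
     (\<forall>b\<in>Basis. \<forall>c\<in>Basis. \<forall>d\<in>Basis.
        has_partial b f \<and> has_partial c (partial_deriv b f) \<and>
        has_partial d (partial_deriv c (partial_deriv b f)) \<and>
        continuous_on UNIV (partial_deriv d (partial_deriv c (partial_deriv b f))))"

definition hessian :: "('a::euclidean_space \<Rightarrow> real) \<Rightarrow> 'a \<Rightarrow> 'a \<Rightarrow> 'a" where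
  "hessian f x h = (\<Sum>b\<in>Basis. (\<Sum>c\<in>Basis. partial_deriv b (partial_deriv c f) x * (h \<bullet> c)) *\<^sub>R b)"

definition unique_nondegenerate_min ::
  "(R3 \<times> R3 \<Rightarrow> real) \<Rightarrow> R3 \<times> R3 \<Rightarrow> bool" where
  "unique_nondegenerate_min w x0 \<longleftrightarrow>
     x0 \<in> torus_cell \<times> torus_cell \<and>
     (\<forall>x \<in> torus_cell \<times> torus_cell. x \<noteq> x0 \<longrightarrow> w x0 < w x) \<and>
     bij (hessian w x0)"


section \<open>Spectra of operators on spaces of square integrable functions\<close>

text \<open>
  A Hilbert space of classes of functions modulo null functions is represented by its space of
  functions \<open>vectors X\<close> with scalar multiplication and seminorm; two functions represent the same
  vector iff their difference has seminorm 0. An operator is a map on functions.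
\<close>

record 'v function_space =
  vectors :: "'v set"
  cscale :: "complex \<Rightarrow> 'v \<Rightarrow> 'v"
  seminorm :: "'v \<Rightarrow> real"

text \<open>
  \<open>R\<close> is a bounded two-sided inverse of \<open>A - z\<close>. Linearity of \<open>R\<close> and its compatibility with
  equality modulo null functions follow when \<open>A\<close> is linear.
\<close>

definition resolvent_set ::
  "('v::ab_group_add) function_space \<Rightarrow> ('v \<Rightarrow> 'v) \<Rightarrow> complex set" where
  "resolvent_set X A = {z. \<exists>R K.
     (\<forall>g \<in> vectors X. R g \<in> vectors X \<and> seminorm X (R g) \<le> K * seminorm X g \<and>
        seminorm X (A (R g) - cscale X z (R g) - g) = 0) \<and>
     (\<forall>f \<in> vectors X. seminorm X (R (A f - cscale X z f) - f) = 0)}"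

definition spectrum ::
  "('v::ab_group_add) function_space \<Rightarrow> ('v \<Rightarrow> 'v) \<Rightarrow> complex set" where
  "spectrum X A = - resolvent_set X A"

definition eigenspace ::
  "('v::ab_group_add) function_space \<Rightarrow> ('v \<Rightarrow> 'v) \<Rightarrow> complex \<Rightarrow> 'v set" where
  "eigenspace X A z = {f \<in> vectors X. seminorm X (A f - cscale X z f) = 0}"

definition finite_dim :: "('v::ab_group_add) function_space \<Rightarrow> 'v set \<Rightarrow> bool" where
  "finite_dim X S \<longleftrightarrow> (\<exists>(n::nat) b. (\<forall>i<n. b i \<in> S) \<and>
     (\<forall>f \<in> S. \<exists>c :: nat \<Rightarrow> complex. seminorm X (f - (\<Sum>i<n. cscale X (c i) (b i))) = 0))"

definition discrete_spectrum ::
  "('v::ab_group_add) function_space \<Rightarrow> ('v \<Rightarrow> 'v) \<Rightarrow> complex set" where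
  "discrete_spectrum X A = {z.
     z isolated_in spectrum X A \<and>
     (\<exists>f \<in> eigenspace X A z. seminorm X f \<noteq> 0) \<and>
     finite_dim X (eigenspace X A z)}"


section \<open>The Hilbert spaces\<close>

definition L2_torus :: "(R3 \<Rightarrow> complex) set" where
  "L2_torus = {f. torus_fun f \<and> f \<in> borel_measurable borel \<and>
     integrable torus_measure (\<lambda>p. (cmod (f p))\<^sup>2)}"

definition L2_sym :: "(R3 \<times> R3 \<Rightarrow> complex) set" where
  "L2_sym = {f. torus_fun2 f \<and> sym_fun f \<and> f \<in> borel_measurable borel \<and>
     integrable (torus_measure \<Otimes>\<^sub>M torus_measure) (\<lambda>x. (cmod (f x))\<^sup>2)}"

definition L2_torus_space :: "(R3 \<Rightarrow> complex) function_space" where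
  "L2_torus_space = \<lparr>
     vectors = L2_torus,
     cscale = (\<lambda>c f p. c * f p),
     seminorm = (\<lambda>f. sqrt (\<integral>p. (cmod (f p))\<^sup>2 \<partial>torus_measure)) \<rparr>"

definition C_L2_space :: "(complex \<times> (R3 \<Rightarrow> complex)) function_space" where
  "C_L2_space = \<lparr>
     vectors = UNIV \<times> L2_torus,
     cscale = (\<lambda>c (f0, f1). (c * f0, \<lambda>p. c * f1 p)),
     seminorm = (\<lambda>(f0, f1). sqrt ((cmod f0)\<^sup>2 + (\<integral>p. (cmod (f1 p))\<^sup>2 \<partial>torus_measure))) \<rparr>"

type_synonym fock = "complex \<times> (R3 \<Rightarrow> complex) \<times> (R3 \<times> R3 \<Rightarrow> complex)"

definition fock_space :: "fock function_space" where
  "fock_space = \<lparr>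
     vectors = UNIV \<times> L2_torus \<times> L2_sym,
     cscale = (\<lambda>c (f0, f1, f2). (c * f0, \<lambda>p. c * f1 p, \<lambda>x. c * f2 x)),
     seminorm = (\<lambda>(f0, f1, f2). sqrt ((cmod f0)\<^sup>2 + (\<integral>p. (cmod (f1 p))\<^sup>2 \<partial>torus_measure)
        + (\<integral>x. (cmod (f2 x))\<^sup>2 \<partial>(torus_measure \<Otimes>\<^sub>M torus_measure)))) \<rparr>"


section \<open>The operator matrix\<close>

definition H00 :: "real \<Rightarrow> complex \<Rightarrow> complex" where
  "H00 w0 f0 = of_real w0 * f0"

definition H01 :: "(R3 \<Rightarrow> real) \<Rightarrow> (R3 \<Rightarrow> complex) \<Rightarrow> complex" where
  "H01 v0 f1 = (\<integral>s. of_real (v0 s) * f1 s \<partial>torus_measure)"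

definition H01_adj :: "(R3 \<Rightarrow> real) \<Rightarrow> complex \<Rightarrow> R3 \<Rightarrow> complex" where
  "H01_adj v0 f0 = (\<lambda>p. of_real (v0 p) * f0)"

definition H11 :: "(R3 \<Rightarrow> real) \<Rightarrow> (R3 \<Rightarrow> complex) \<Rightarrow> R3 \<Rightarrow> complex" where
  "H11 w1 f1 = (\<lambda>p. of_real (w1 p) * f1 p)"

definition H12 ::
  "(R3 \<Rightarrow> real) \<Rightarrow> (R3 \<times> R3 \<Rightarrow> complex) \<Rightarrow> R3 \<Rightarrow> complex" where
  "H12 v1 f2 = (\<lambda>p. \<integral>s. of_real (v1 s) * f2 (p, s) \<partial>torus_measure)"

definition H12_adj ::
  "(R3 \<Rightarrow> real) \<Rightarrow> (R3 \<Rightarrow> complex) \<Rightarrow> R3 \<times> R3 \<Rightarrow> complex" where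
  "H12_adj v1 f1 = (\<lambda>(p, q). (of_real (v1 p) * f1 q + of_real (v1 q) * f1 p) / 2)"

definition H22_0 ::
  "(R3 \<times> R3 \<Rightarrow> real) \<Rightarrow> (R3 \<times> R3 \<Rightarrow> complex)
    \<Rightarrow> R3 \<times> R3 \<Rightarrow> complex" where
  "H22_0 w2 f2 = (\<lambda>(p, q). of_real (w2 (p, q)) * f2 (p, q))"

definition V_op ::
  "(R3 \<Rightarrow> real) \<Rightarrow> (R3 \<times> R3 \<Rightarrow> complex)
    \<Rightarrow> R3 \<times> R3 \<Rightarrow> complex" where
  "V_op v2 f2 = (\<lambda>(p, q).
     of_real (v2 q) * (\<integral>s. of_real (v2 s) * f2 (p, s) \<partial>torus_measure)
   + of_real (v2 p) * (\<integral>s. of_real (v2 s) * f2 (s, q) \<partial>torus_measure))"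

definition H22 ::
  "(R3 \<times> R3 \<Rightarrow> real) \<Rightarrow> (R3 \<Rightarrow> real)
    \<Rightarrow> (R3 \<times> R3 \<Rightarrow> complex) \<Rightarrow> R3 \<times> R3 \<Rightarrow> complex" where
  "H22 w2 v2 f2 = H22_0 w2 f2 - V_op v2 f2"

definition H_op ::
  "real \<Rightarrow> (R3 \<Rightarrow> real) \<Rightarrow> (R3 \<times> R3 \<Rightarrow> real)
    \<Rightarrow> (R3 \<Rightarrow> real) \<Rightarrow> (R3 \<Rightarrow> real) \<Rightarrow> (R3 \<Rightarrow> real) \<Rightarrow> fock \<Rightarrow> fock" where
  "H_op w0 w1 w2 v0 v1 v2 = (\<lambda>(f0, f1, f2).
     (H00 w0 f0 + H01 v0 f1,
      H01_adj v0 f0 + H11 w1 f1 + H12 v1 f2,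
      H12_adj v1 f1 + H22 w2 v2 f2))"


section \<open>The families of generalized Friedrichs models\<close>

definition h1 ::
  "(R3 \<Rightarrow> real) \<Rightarrow> (R3 \<times> R3 \<Rightarrow> real) \<Rightarrow> (R3 \<Rightarrow> real) \<Rightarrow> R3
    \<Rightarrow> complex \<times> (R3 \<Rightarrow> complex) \<Rightarrow> complex \<times> (R3 \<Rightarrow> complex)" where
  "h1 w1 w2 v1 p = (\<lambda>(f0, f1).
     (of_real (w1 p) * f0
        + of_real (1 / sqrt 2) * (\<integral>s. of_real (v1 s) * f1 s \<partial>torus_measure),
      \<lambda>q. of_real (1 / sqrt 2) * of_real (v1 q) * f0 + of_real (w2 (p, q)) * f1 q))"

definition h2 ::
  "(R3 \<times> R3 \<Rightarrow> real) \<Rightarrow> (R3 \<Rightarrow> real) \<Rightarrow> R3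
    \<Rightarrow> (R3 \<Rightarrow> complex) \<Rightarrow> R3 \<Rightarrow> complex" where
  "h2 w2 v2 p f1 = (\<lambda>q. of_real (w2 (p, q)) * f1 q
     - of_real (v2 q) * (\<integral>s. of_real (v2 s) * f1 s \<partial>torus_measure))"

text \<open>The operators \<open>h1\<close>, \<open>h2\<close> are self-adjoint, so their discrete eigenvalues are real.\<close>

definition sigma1 ::
  "(R3 \<Rightarrow> real) \<Rightarrow> (R3 \<times> R3 \<Rightarrow> real) \<Rightarrow> (R3 \<Rightarrow> real) \<Rightarrow> real set" where
  "sigma1 w1 w2 v1 =
     (\<Union>p \<in> torus_cell. {E. complex_of_real E \<in> discrete_spectrum C_L2_space (h1 w1 w2 v1 p)})"

definition sigma2 ::
  "(R3 \<times> R3 \<Rightarrow> real) \<Rightarrow> (R3 \<Rightarrow> real) \<Rightarrow> real set" where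
  "sigma2 w2 v2 =
     (\<Union>p \<in> torus_cell. {E. complex_of_real E \<in> discrete_spectrum L2_torus_space (h2 w2 v2 p)})"

definition Delta1 ::
  "(R3 \<Rightarrow> real) \<Rightarrow> (R3 \<times> R3 \<Rightarrow> real) \<Rightarrow> (R3 \<Rightarrow> real)
    \<Rightarrow> R3 \<Rightarrow> real \<Rightarrow> real" where
  "Delta1 w1 w2 v1 p z =
     w1 p - z - 1 / 2 * (\<integral>s. (v1 s)\<^sup>2 / (w2 (p, s) - z) \<partial>torus_measure)"

definition Delta2 ::
  "(R3 \<times> R3 \<Rightarrow> real) \<Rightarrow> (R3 \<Rightarrow> real) \<Rightarrow> R3 \<Rightarrow> real \<Rightarrow> real" where
  "Delta2 w2 v2 p z = 1 - (\<integral>s. (v2 s)\<^sup>2 / (w2 (p, s) - z) \<partial>torus_measure)"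


section \<open>The threshold conditions\<close>

text \<open>
  In the following, \<open>D\<close> is one of the two functions \<open>Delta1\<close>, \<open>Delta2\<close>, \<open>S\<close> is the corresponding
  union of discrete spectra and \<open>m\<close> is the minimum of \<open>w2\<close>.
\<close>

definition E_min :: "real set \<Rightarrow> real \<Rightarrow> real" where
  "E_min S m = minimum (S \<inter> {..m})"

definition E_max :: "real set \<Rightarrow> real \<Rightarrow> real" where
  "E_max S m = maximum (S \<inter> {..m})"

definition torus_zeros :: "(R3 \<Rightarrow> real) \<Rightarrow> R3 set" where
  "torus_zeros F = {p \<in> torus_cell. F p = 0}"

definition power_zeros :: "(R3 \<Rightarrow> real) \<Rightarrow> bool" where
  "power_zeros F \<longleftrightarrow> finite (torus_zeros F) \<and> torus_zeros F \<noteq> {} \<and>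
     (\<exists>C \<delta> (\<beta> :: R3 \<Rightarrow> real). C > 0 \<and> \<delta> > 0 \<and>
        (\<forall>z \<in> torus_zeros F. 0 < \<beta> z \<and> \<beta> z \<le> 2 \<and>
           (\<forall>p \<in> torus_nbhd \<delta> z. \<bar>F p\<bar> \<ge> C * torus_dist p z powr \<beta> z)))"

definition condition1 :: "(R3 \<Rightarrow> real \<Rightarrow> real) \<Rightarrow> real \<Rightarrow> bool" where
  "condition1 D m \<longleftrightarrow> minimum ((\<lambda>p. D p m) ` torus_cell) > 0"

definition condition2 :: "(R3 \<Rightarrow> real \<Rightarrow> real) \<Rightarrow> real set \<Rightarrow> real \<Rightarrow> bool" where
  "condition2 D S m \<longleftrightarrow>
     minimum ((\<lambda>p. D p m) ` torus_cell) < 0 \<and>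
     maximum ((\<lambda>p. D p m) ` torus_cell) \<ge> 0 \<and>
     power_zeros (\<lambda>p. D p (E_min S m)) \<and>
     (\<forall>p \<in> torus_cell - torus_zeros (\<lambda>p. D p (E_min S m)). D p (E_min S m) > 0)"

definition condition3 :: "(R3 \<Rightarrow> real \<Rightarrow> real) \<Rightarrow> real set \<Rightarrow> real \<Rightarrow> bool" where
  "condition3 D S m \<longleftrightarrow>
     maximum ((\<lambda>p. D p m) ` torus_cell) < 0 \<and>
     power_zeros (\<lambda>p. D p (E_min S m)) \<and>
     (\<forall>p \<in> torus_cell - torus_zeros (\<lambda>p. D p (E_min S m)). D p (E_min S m) > 0) \<and>
     power_zeros (\<lambda>p. D p (E_max S m)) \<and>
     (\<forall>p \<in> torus_cell - torus_zeros (\<lambda>p. D p (E_max S m)). D p (E_max S m) < 0)"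

definition threshold_condition :: "(R3 \<Rightarrow> real \<Rightarrow> real) \<Rightarrow> real set \<Rightarrow> real \<Rightarrow> bool" where
  "threshold_condition D S m \<longleftrightarrow> condition1 D m \<or> condition2 D S m \<or> condition3 D S m"

definition annihilates_periodic :: "(R3 \<Rightarrow> real) \<Rightarrow> bool" where
  "annihilates_periodic v \<longleftrightarrow> (\<forall>g \<in> L2_torus. two_pi_bar_periodic g \<longrightarrow>
     (\<integral>s. of_real (v s) * g s \<partial>torus_measure) = 0)"

end

theory Submission
  imports Defs
begin

text \<open>
  A function on the torus has period \<open>2 * pi\<close> in every coordinate, hence also \<open>2 * pi_bar\<close>. The one
  of \<open>v1\<close>, \<open>v2\<close> that is orthogonal to all periodic functions is therefore orthogonal to itself and
  vanishes (\<open>annihilates_periodic_imp_zero\<close>). Once \<open>v1\<close> or \<open>v2\<close> is zero, the eigenvalue equation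
      below
  \<open>m\<close> can be solved for the two-particle component,
      and what remains is a homogeneous equation in one
  momentum variable (\<open>kernel_pair_one\<close>, \<open>kernel_pair_two\<close>). Its quadratic form is
  \<open>B e = \<integral>p. D p e * (f p)\<^sup>2 - \<kappa> * \<integral>\<integral> v p * v s * f p * f s / (w2 (p, s) - e)\<close> plus terms in a scalar
  component, where \<open>D\<close> is \<open>Delta1\<close> or \<open>Delta2\<close>; the locale \<open>pencil\<close> treats both cases at once.

  Eigenvalues \<open>E\<close> correspond to kernel vectors of \<open>B E\<close>,
      and \<open>B e\<close> decreases in \<open>e\<close>. Consequently \<open>n\<close>
  eigenvalues below \<open>e\<close> produce a space of dimension \<open>n\<close> on which \<open>B e\<close> is negative, and \<open>n\<close>
  eigenvalues above \<open>e\<close> one on which it is positive (\<open>pencil_negative\<close>, \<open>pencil_positive\<close>). If \<open>D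
      e\<close> has
  the opposite sign there, then the integral part has to overcome it on \<open>n - 1\<close> functions that are
  orthonormal with respect to the weight \<open>\<bar>D e\<bar>\<close>. Bessel's inequality for the kernel divided by
  \<open>sqrt \<bar>D e\<bar>\<close> in each variable then bounds \<open>n\<close> by its Hilbert-Schmidt norm
      (\<open>test_functions_bound\<close>).

  This norm is finite because singularities of inverse square type are integrable in dimension
  three (\<open>integrable_inverse_square\<close>). For \<open>e = m\<close> and \<open>D m > 0\<close> the singularity is that of the
  kernel, which comes from the quadratic growth of \<open>w2\<close> at its non-degenerate minimum
  (\<open>quadratic_growth\<close>, \<open>symbol_minimum_bound\<close>). For \<open>e < m\<close> the kernel is bounded, and the
  singularities are the zeros of \<open>D e\<close>, of order at most two.

  The three threshold conditions say at which \<open>e\<close> this applies: at \<open>m\<close>; at \<open>E_min\<close>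
      for the eigenvalues
  below it; at \<open>E_max\<close> for the eigenvalues above it. That \<open>E_min\<close>
      and \<open>E_max\<close> are the extreme energies
  at which \<open>D\<close> has a zero follows from the explicit resolvents of the Friedrichs models
  (\<open>h1_eigenvalue\<close>, \<open>h2_eigenvalue\<close>, \<open>h1_eigenvalue_zero\<close>, \<open>h2_eigenvalue_zero\<close>). Apart from
      \<open>E_min\<close> and
  \<open>E_max\<close> themselves, the remaining energies \<open>E\<close> lie strictly between \<open>E_min\<close>
      and \<open>E_max\<close> or \<open>m\<close>. There
  \<open>D E\<close> is nonpositive at one point and nonnegative at another one, hence has a zero;
      by \<open>spectrum_one\<close>
  and \<open>spectrum_two\<close> these energies fill an interval of the spectrum of the operator matrix, so none
  of them is a discrete eigenvalue.
\<close>

section \<open>Functions on the torus\<close>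

lemma torus_fun_shift_int:
  assumes "torus_fun f"
  shows "f (p + axis i (2 * pi * of_int k)) = f p"
proof -
  have ax: "axis i (2 * pi * of_int (k + 1)) = axis i (2 * pi * of_int k) + axis i (2 * pi)"
    for k :: int and i :: 3
    by (simp add: vec_eq_iff axis_def algebra_simps)
  show ?thesis
  proof (induction k arbitrary: p rule: int_induct[where k = 0])
    case base
    have "axis i 0 = (0 :: R3)" by (simp add: vec_eq_iff axis_def)
    then show ?case by (metis add.right_neutral mult_zero_right of_int_0)
  next
    case (step1 k)
    then show ?case
      using assms unfolding torus_fun_def ax add.assoc[symmetric] by metis
  next
    case (step2 k)
    have "f (p + axis i (2 * pi * of_int (k - 1))) =
        f (p + axis i (2 * pi * of_int (k - 1)) + axis i (2 * pi))"
      using assms unfolding torus_fun_def by simp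
    also have "\<dots> = f p"
      using step2(2)[of p] ax[of i "k - 1"] by (simp add: add.assoc)
    finally show ?case .
  qed
qed

lemma torus_fun_shift_lattice:
  assumes "torus_fun f"
  shows "f (p + (\<chi> i. 2 * pi * of_int (k i))) = f p"
proof -
  have "f (p + (\<Sum>i\<in>S. axis i (2 * pi * of_int (k i)))) = f p" if "finite S" for S
    using that
  proof (induction S)
    case (insert i S)
    have "f (p + (\<Sum>i\<in>S. axis i (2 * pi * of_int (k i))) + axis i (2 * pi * of_int (k i))) = f p"
      using torus_fun_shift_int[OF assms] insert by metis
    then show ?case using insert by (simp add: ac_simps)
  qed simp
  moreover have "(\<Sum>i\<in>UNIV. axis i (2 * pi * of_int (k i))) = (\<chi> i. 2 * pi * of_int (k i))"
    by (simp add: vec_eq_iff axis_def sum.delta')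
  ultimately show ?thesis by (metis finite)
qed

lemma torus_fun_rep:
  assumes "torus_fun f"
  shows "f (torus_rep p) = f p"
proof -
  have "torus_rep p = p + (\<chi> i. 2 * pi * of_int (- \<lceil>(p $ i - pi) / (2 * pi)\<rceil>))"
    by (simp add: vec_eq_iff torus_rep_def)
  then show ?thesis using torus_fun_shift_lattice[OF assms] by metis
qed

lemma torus_fun2_rep:
  assumes "torus_fun2 f"
  shows "f (torus_rep p, torus_rep q) = f (p, q)"
  using torus_fun_rep[of "\<lambda>p. f (p, torus_rep q)"] torus_fun_rep[of "\<lambda>q. f (p, q)"] assms
  by (simp add: torus_fun2_def)

lemma torus_fun_torus_rep: "torus_fun torus_rep"
proof -
  have "\<lceil>(x + 2 * pi - pi) / (2 * pi)\<rceil> = \<lceil>(x - pi) / (2 * pi)\<rceil> + 1" for x :: real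
  proof -
    have "(x + 2 * pi - pi) / (2 * pi) = (x - pi) / (2 * pi) + 1"
      by (simp add: field_simps)
    then show ?thesis by simp
  qed
  then have "x + 2 * pi - 2 * pi * of_int \<lceil>(x + 2 * pi - pi) / (2 * pi)\<rceil> =
      x - 2 * pi * of_int \<lceil>(x - pi) / (2 * pi)\<rceil>" for x :: real
    by (simp only: of_int_add of_int_1 ring_distribs)
  then show ?thesis
    by (simp add: torus_fun_def torus_rep_def vec_eq_iff axis_def)
qed

lemma torus_fun_comp_rep: "torus_fun (\<lambda>p. f (torus_rep p))"
  using torus_fun_torus_rep by (simp add: torus_fun_def)

lemma torus_rep_id:
  assumes "p \<in> torus_cell"
  shows "torus_rep p = p"
proof -
  have "\<lceil>(p $ i - pi) / (2 * pi)\<rceil> = 0" for i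
    using assms by (intro ceiling_unique) (auto simp: torus_cell_def field_simps)
  then show ?thesis by (simp add: torus_rep_def vec_eq_iff)
qed

lemma small_in_cell:
  assumes "norm x < pi"
  shows "x \<in> torus_cell"
proof -
  have "\<bar>x $ i\<bar> < pi" for i using component_le_norm_cart[of x i] assms by linarith
  then show ?thesis by (auto simp: torus_cell_def abs_less_iff) (smt (verit))+
qed

lemma torus_rep_diff: "torus_rep (torus_rep p - torus_rep q) = torus_rep (p - q)"
proof -
  have 1: "torus_fun (\<lambda>p. torus_rep (p - q))" for q
    using torus_fun_torus_rep unfolding torus_fun_def by (metis add_diff_eq diff_add_eq)
  have 2: "torus_fun (\<lambda>q. torus_rep (p - q))" for p
    unfolding torus_fun_def
  proof (intro allI)
    fix q i
    have "torus_rep (p - (q + axis i (2 * pi)) + axis i (2 * pi)) =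
        torus_rep (p - (q + axis i (2 * pi)))"
      using torus_fun_torus_rep unfolding torus_fun_def by blast
    then show "torus_rep (p - (q + axis i (2 * pi))) = torus_rep (p - q)" by simp
  qed
  show ?thesis using torus_fun_rep[OF 1] torus_fun_rep[OF 2] by metis
qed

lemma torus_dist_rep:
  assumes "norm (p - q) < pi"
  shows "torus_dist (torus_rep p) (torus_rep q) = norm (p - q)"
  by (simp add: torus_dist_def torus_rep_diff torus_rep_id[OF small_in_cell[OF assms]])

text \<open>
  The closed cube is compact, whereas the cell is only half closed; both meet every orbit of the
  lattice.
\<close>

definition torus_cube :: "R3 set" where
  "torus_cube = cbox (\<chi> i. - pi) (\<chi> i. pi)"

lemma cell_subset_cube: "torus_cell \<subseteq> torus_cube"
  by (auto simp: torus_cell_def torus_cube_def mem_box_cart less_imp_le)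

lemma compact_torus_cube: "compact torus_cube"
  by (simp add: torus_cube_def compact_cbox)

lemma zero_in_cell: "0 \<in> torus_cell"
  by (simp add: torus_cell_def)

lemma torus_fun_image_cell: "torus_fun f \<Longrightarrow> f ` torus_cell = range f"
proof safe
  fix x assume "torus_fun f"
  then show "f x \<in> f ` torus_cell" by (metis torus_fun_rep torus_rep_in_cell image_eqI)
qed auto

lemma torus_fun_image_cube: "torus_fun f \<Longrightarrow> f ` torus_cube = range f"
  using torus_fun_image_cell cell_subset_cube by blast

lemma torus_fun_bounded:
  fixes f :: "R3 \<Rightarrow> real"
  assumes "torus_fun f" "continuous_on UNIV f"
  obtains C where "C > 0" "\<And>p. \<bar>f p\<bar> \<le> C"
proof -
  have "compact (f ` torus_cube)"
    using compact_torus_cube assms(2) compact_continuous_image continuous_on_subset by blast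
  then have "bounded (range f)"
    using torus_fun_image_cube[OF assms(1)] compact_imp_bounded by metis
  then show ?thesis using that unfolding bounded_pos by auto
qed

lemma minimum_eqI: "x \<in> S \<Longrightarrow> (\<And>y. y \<in> S \<Longrightarrow> x \<le> y) \<Longrightarrow> minimum S = x"
  unfolding minimum_def by (rule Least_equality)

lemma maximum_eqI: "x \<in> S \<Longrightarrow> (\<And>y. y \<in> S \<Longrightarrow> y \<le> x) \<Longrightarrow> maximum S = x"
  unfolding maximum_def by (rule Greatest_equality)

text \<open>
  Continuous functions on the torus attain their extrema, so that \<open>minimum\<close> and \<open>maximum\<close>, which
  are defined as least and greatest elements, are values of the function.
\<close>

lemma torus_fun_attains_min:
  fixes f :: "R3 \<Rightarrow> real"
  assumes "torus_fun f" "continuous_on UNIV f"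
  obtains p where "minimum (f ` torus_cell) = f p" "\<And>q. f p \<le> f q"
proof -
  have "torus_cube \<noteq> {}" using zero_in_cell cell_subset_cube by blast
  then obtain p where p: "p \<in> torus_cube" "\<And>q. q \<in> torus_cube \<Longrightarrow> f p \<le> f q"
    using continuous_attains_inf[OF compact_torus_cube _ continuous_on_subset[OF assms(2)]] by blast
  have *: "f p \<le> f q" for q
    using p(2)[of "torus_rep q"] torus_rep_in_cell cell_subset_cube torus_fun_rep[OF assms(1)]
    by (metis subsetD)
  have "minimum (f ` torus_cell) = f p"
    unfolding torus_fun_image_cell[OF assms(1)] by (rule minimum_eqI) (use * in auto)
  then show ?thesis using that * by blast
qed

lemma torus_fun_attains_max:
  fixes f :: "R3 \<Rightarrow> real"
  assumes "torus_fun f" "continuous_on UNIV f"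
  obtains p where "maximum (f ` torus_cell) = f p" "\<And>q. f q \<le> f p"
proof -
  have *: "torus_fun (\<lambda>p. - f p)" "continuous_on UNIV (\<lambda>p. - f p)"
    using assms by (auto simp: torus_fun_def intro: continuous_intros)
  obtain p where p: "\<And>q. - f p \<le> - f q" using torus_fun_attains_min[OF *] by blast
  have "maximum (f ` torus_cell) = f p"
    unfolding torus_fun_image_cell[OF assms(1)] by (rule maximum_eqI) (use p in auto)
  then show ?thesis using that p by auto
qed

section \<open>Integration over the torus\<close>

abbreviation "\<mu> \<equiv> torus_measure"

lemma torus_cell_borel [measurable]: "torus_cell \<in> sets borel"
proof -
  have "torus_cell = (\<Inter>i. {p. - pi < p $ i} \<inter> {p. p $ i \<le> pi})"
    by (auto simp: torus_cell_def)
  also have "\<dots> \<in> sets borel"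
  proof (intro sets.finite_INT sets.Int)
    fix i :: 3
    show "{p :: R3. - pi < p $ i} \<in> sets borel"
      by (intro borel_open open_Collect_less continuous_intros)
    show "{p :: R3. p $ i \<le> pi} \<in> sets borel"
      by (intro borel_closed closed_Collect_le continuous_intros)
  qed auto
  finally show ?thesis .
qed

lemma space_torus_measure [simp]: "space \<mu> = torus_cell"
  by (simp add: torus_measure_def space_restrict_space)

lemma sets_torus_measure: "sets \<mu> = sets (restrict_space borel torus_cell)"
  by (simp add: torus_measure_def sets_restrict_space)

lemma measurable_torus [measurable (raw)]:
  "f \<in> borel_measurable borel \<Longrightarrow> f \<in> borel_measurable \<mu>"
  by (simp add: measurable_cong_sets[OF sets_torus_measure refl] measurable_restrict_space1)

lemma measurable_ident_torus [measurable]: "(\<lambda>x. x) \<in> measurable \<mu> borel"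
  by (simp add: measurable_cong_sets[OF sets_torus_measure refl] measurable_restrict_space1)

lemma measurable_ident_torus2 [measurable]: "(\<lambda>x. x) \<in> measurable (\<mu> \<Otimes>\<^sub>M \<mu>) borel"
proof -
  have "(\<lambda>x. (fst x, snd x)) \<in> measurable (\<mu> \<Otimes>\<^sub>M \<mu>) (borel \<Otimes>\<^sub>M borel)"
    by (intro measurable_Pair measurable_compose[OF measurable_fst measurable_ident_torus]
          measurable_compose[OF measurable_snd measurable_ident_torus])
  then show ?thesis by (simp add: borel_prod)
qed

lemma measurable_torus2 [measurable (raw)]:
  "f \<in> borel_measurable borel \<Longrightarrow> f \<in> borel_measurable (\<mu> \<Otimes>\<^sub>M \<mu>)"
  by (rule measurable_compose[OF measurable_ident_torus2])

lemma emeasure_torus: "A \<in> sets borel \<Longrightarrow> A \<subseteq> torus_cell \<Longrightarrow> emeasure \<mu> A = emeasure lborel A"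
  unfolding torus_measure_def by (rule emeasure_restrict_space) auto

interpretation torus: finite_measure \<mu>
proof
  have "emeasure lborel torus_cell \<le> emeasure lborel torus_cube"
    by (intro emeasure_mono cell_subset_cube) (simp add: torus_cube_def)
  also have "\<dots> < \<infinity>" unfolding torus_cube_def by (rule emeasure_lborel_cbox_finite)
  finally show "emeasure \<mu> (space \<mu>) \<noteq> \<infinity>"
    by (simp add: emeasure_torus)
qed

interpretation torus2: pair_sigma_finite \<mu> \<mu> ..

interpretation torus_sq: finite_measure "\<mu> \<Otimes>\<^sub>M \<mu>"
  by (intro finite_measure_pair_measure torus.finite_measure_axioms)

lemma torus_rep_measurable [measurable]: "torus_rep \<in> borel_measurable borel"
proof -
  have "(\<lambda>p. torus_rep p \<bullet> b) \<in> borel_measurable borel" if b: "b \<in> Basis" for b :: R3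
  proof -
    obtain i where i: "b = axis i 1" using b by (auto simp: Basis_vec_def)
    have [measurable]: "(\<lambda>p :: R3. p $ i) \<in> borel_measurable borel"
      by (intro borel_measurable_continuous_onI continuous_intros)
    show ?thesis unfolding i torus_rep_def by (simp add: inner_axis)
  qed
  then show ?thesis using borel_measurable_euclidean_space by blast
qed

lemma AE_torus_finite: "finite N \<Longrightarrow> AE p in \<mu>. p \<notin> N"
proof -
  assume "finite N"
  then have "AE p in lborel. p \<notin> N"
    by (intro AE_not_in) (simp add: finite_imp_null_set_lborel)
  then show ?thesis
    unfolding torus_measure_def by (subst AE_restrict_space_iff) auto
qed

section \<open>Quadratic growth at a non-degenerate minimum\<close>

text \<open>
  Continuous partial derivatives give the total derivative: the increment along a vector is
  telescoped over the coordinate directions, and each one-dimensional increment is controlled by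
  the mean value theorem.
\<close>

lemma has_derivative_of_continuous_partials:
  fixes F :: "'a::euclidean_space \<Rightarrow> real"
  assumes partial: "\<And>b. b \<in> Basis \<Longrightarrow> has_partial b F"
    and cont: "\<And>b. b \<in> Basis \<Longrightarrow> continuous_on UNIV (partial_deriv b F)"
  shows "(F has_derivative (\<lambda>h. \<Sum>b\<in>Basis. (h \<bullet> b) * partial_deriv b F x)) (at x)"
proof -
  have der: "((\<lambda>t. F (y + t *\<^sub>R b)) has_real_derivative partial_deriv b F (y + t *\<^sub>R b)) (at t)"
    if "b \<in> Basis" for y b t
  proof -
    have "((\<lambda>s. F ((y + t *\<^sub>R b) + s *\<^sub>R b)) has_real_derivative partial_deriv b F (y
        + t *\<^sub>R b)) (at 0)"
      unfolding partial_deriv_def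
      using partial[OF that] unfolding has_partial_def
      by (intro field_differentiable_derivI) blast
    then have "((\<lambda>s. F (y + (s + t) *\<^sub>R b)) has_real_derivative partial_deriv b F (y
        + t *\<^sub>R b)) (at 0)"
      by (simp add: scaleR_add_left ac_simps)
    then show ?thesis using DERIV_shift[of "\<lambda>t. F (y + t *\<^sub>R b)" _ 0 t] by simp
  qed
  have step: "\<exists>\<theta>. \<bar>\<theta>\<bar> \<le> \<bar>t\<bar> \<and> F (y + t *\<^sub>R b) - F y = t * partial_deriv b F (y + \<theta> *\<^sub>R b)"
    if b: "b \<in> Basis" for y b and t :: real
  proof (cases t "0 :: real" rule: linorder_cases)
    case less
    obtain z where z: "t < z" "z < 0" "F (y + 0 *\<^sub>R b) - F (y + t *\<^sub>R b)
        = (0 - t) * partial_deriv b F (y + z *\<^sub>R b)"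
      using MVT2[OF less der[OF b, of y]] by auto
    then show ?thesis by (intro exI[of _ z]) auto
  next
    case greater
    obtain z where z: "0 < z" "z < t" "F (y + t *\<^sub>R b) - F (y + 0 *\<^sub>R b)
        = (t - 0) * partial_deriv b F (y + z *\<^sub>R b)"
      using MVT2[OF greater der[OF b, of y]] by auto
    then show ?thesis by (intro exI[of _ z]) auto
  qed auto
  define P where "P B h = (\<Sum>b\<in>B. (h \<bullet> b) *\<^sub>R b)" for B and h :: 'a
  have norm_P: "norm (P B h) \<le> (\<Sum>b\<in>Basis. \<bar>h \<bullet> b\<bar>)" if "B \<subseteq> Basis" for B h
  proof -
    have "norm (P B h) \<le> (\<Sum>b\<in>B. norm ((h \<bullet> b) *\<^sub>R b))" unfolding P_def by (rule norm_sum)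
    also have "\<dots> = (\<Sum>b\<in>B. \<bar>h \<bullet> b\<bar>)" using that by (intro sum.cong) auto
    also have "\<dots> \<le> (\<Sum>b\<in>Basis. \<bar>h \<bullet> b\<bar>)" using that by (intro sum_mono2) auto
    finally show ?thesis .
  qed
  have est: "\<bar>F (x + P B h) - F x - (\<Sum>b\<in>B. (h \<bullet> b) * partial_deriv b F x)\<bar> \<le> (\<Sum>b\<in>B. \<bar>h \<bullet> b\<bar>) * e"
    if "finite B" "B \<subseteq> Basis" and d: "\<And>b y. b \<in> Basis \<Longrightarrow> norm (y - x) < d
        \<Longrightarrow> \<bar>partial_deriv b F y - partial_deriv b F x\<bar> \<le> e"
      and h: "2 * (\<Sum>b\<in>Basis. \<bar>h \<bullet> b\<bar>) < d" for B d e h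
    using that(1,2)
  proof (induction B)
    case empty
    then show ?case by (simp add: P_def)
  next
    case (insert b B)
    then have b: "b \<in> Basis" and B: "B \<subseteq> Basis" by auto
    obtain \<theta> where \<theta>: "\<bar>\<theta>\<bar> \<le> \<bar>h \<bullet> b\<bar>"
      "F (x + P B h + (h \<bullet> b) *\<^sub>R b) - F (x + P B h) = (h \<bullet> b) * partial_deriv b F (x + P B h
          + \<theta> *\<^sub>R b)"
      using step[OF b] by blast
    have "norm (x + P B h + \<theta> *\<^sub>R b - x) \<le> norm (P B h) + \<bar>\<theta>\<bar>"
      using norm_triangle_ineq[of "P B h" "\<theta> *\<^sub>R b"] b by simp
    also have "\<dots> \<le> (\<Sum>b\<in>Basis. \<bar>h \<bullet> b\<bar>) + \<bar>h \<bullet> b\<bar>" using norm_P[OF B] \<theta>(1) by (rule add_mono)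
    also have "\<bar>h \<bullet> b\<bar> \<le> (\<Sum>b\<in>Basis. \<bar>h \<bullet> b\<bar>)" using b by (intro member_le_sum) auto
    finally have *: "\<bar>partial_deriv b F (x + P B h + \<theta> *\<^sub>R b) - partial_deriv b F x\<bar> \<le> e"
      using d[OF b] h by force
    have "\<bar>(h \<bullet> b) * partial_deriv b F (x + P B h + \<theta> *\<^sub>R b) - (h \<bullet> b) * partial_deriv b F x\<bar>
        \<le> \<bar>h \<bullet> b\<bar> * e"
      unfolding right_diff_distrib[symmetric] abs_mult using * by (intro mult_left_mono) auto
    moreover have "P (insert b B) h = P B h + (h \<bullet> b) *\<^sub>R b"
      using insert by (simp add: P_def)
    ultimately show ?case using insert.IH[OF B] \<theta>(2) insert.hyps
      by (simp add: distrib_right add.assoc[symmetric])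
  qed
  show ?thesis
    unfolding has_derivative_at_alt
  proof (intro conjI allI impI)
    show "bounded_linear (\<lambda>h. \<Sum>b\<in>Basis. (h \<bullet> b) * partial_deriv b F x)"
      by (intro bounded_linear_sum bounded_linear_mult_left[THEN bounded_linear_compose]
          bounded_linear_inner_left)
    fix e :: real assume "0 < e"
    define e' where "e' = e / real DIM('a)"
    have e': "e' > 0" using \<open>0 < e\<close> by (simp add: e'_def)
    have "\<forall>b\<in>Basis. \<exists>d>0. \<forall>y. norm (y - x) < d \<longrightarrow> \<bar>partial_deriv b F y - partial_deriv b F x\<bar> < e'"
    proof
      fix b :: 'a assume "b \<in> Basis"
      then have "continuous (at x) (partial_deriv b F)"
        using cont continuous_on_eq_continuous_at by blast
      then show "\<exists>d>0. \<forall>y. norm (y - x) < d \<longrightarrow> \<bar>partial_deriv b F y - partial_deriv b F x\<bar> < e'"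
        using e' unfolding continuous_at_eps_delta by (simp add: dist_norm)
    qed
    then obtain d where d: "\<And>b. b \<in> Basis \<Longrightarrow> d b > 0"
      "\<And>b y. b \<in> Basis \<Longrightarrow> norm (y - x) < d b \<Longrightarrow> \<bar>partial_deriv b F y - partial_deriv b F x\<bar> < e'"
      by metis
    define \<delta> where "\<delta> = Min (d ` Basis)"
    have \<delta>: "\<delta> > 0" "\<And>b. b \<in> Basis \<Longrightarrow> \<delta> \<le> d b" using d(1) by (auto simp: \<delta>_def)
    show "\<exists>d>0. \<forall>y. norm (y - x) < d \<longrightarrow>
        norm (F y - F x - (\<Sum>b\<in>Basis. ((y - x) \<bullet> b) * partial_deriv b F x)) \<le> e * norm (y - x)"
    proof (intro exI[of _ "\<delta> / (2 * real DIM('a))"] conjI allI impI)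
      show "0 < \<delta> / (2 * real DIM('a))" using \<delta>(1) by simp
      fix y assume y: "norm (y - x) < \<delta> / (2 * real DIM('a))"
      have s: "(\<Sum>b\<in>Basis. \<bar>(y - x) \<bullet> b\<bar>) \<le> real DIM('a) * norm (y - x)"
        by (rule sum_bounded_above[of Basis, simplified of_nat_mult]) (simp add: Basis_le_norm)
      have "2 * (\<Sum>b\<in>Basis. \<bar>(y - x) \<bullet> b\<bar>) < \<delta>"
        using s y by (simp add: field_simps)
      then have "\<bar>F (x + P Basis (y - x)) - F x - (\<Sum>b\<in>Basis. ((y - x) \<bullet> b) * partial_deriv b F x)\<bar>
          \<le> (\<Sum>b\<in>Basis. \<bar>(y - x) \<bullet> b\<bar>) * e'"
        by (intro est[where d = \<delta>])
          (auto intro!: less_imp_le d(2) elim!: order_less_le_trans \<delta>(2))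
      also have "\<dots> \<le> (real DIM('a) * norm (y - x)) * e'" using s e' by (intro mult_right_mono) auto
      also have "\<dots> = e * norm (y - x)" by (simp add: e'_def)
      also have "P Basis (y - x) = y - x" by (simp add: P_def euclidean_representation)
      finally show "norm (F y - F x - (\<Sum>b\<in>Basis. ((y - x) \<bullet> b) * partial_deriv b F x))
          \<le> e * norm (y - x)"
        by simp
    qed
  qed
qed

context
  fixes F :: "'a::euclidean_space \<Rightarrow> real"
  assumes smooth: "continuous_third_partials F"
begin

lemma second_partial_continuous:
  assumes "b \<in> Basis" "c \<in> Basis"
  shows "continuous_on UNIV (partial_deriv c (partial_deriv b F))"
proof -
  have "(partial_deriv c (partial_deriv b F) has_derivative
      (\<lambda>h. \<Sum>d\<in>Basis. (h \<bullet> d) * partial_deriv d (partial_deriv c (partial_deriv b F)) x)) (at x)"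
          for x
    using smooth assms unfolding continuous_third_partials_def
    by (intro has_derivative_of_continuous_partials) auto
  then show ?thesis
    by (intro continuous_at_imp_continuous_on ballI has_derivative_continuous)
qed

lemma first_partial_derivative:
  assumes "b \<in> Basis"
  shows "(partial_deriv b F has_derivative
      (\<lambda>h. \<Sum>c\<in>Basis. (h \<bullet> c) * partial_deriv c (partial_deriv b F) x)) (at x)"
  using smooth assms second_partial_continuous unfolding continuous_third_partials_def
  by (intro has_derivative_of_continuous_partials) auto

lemma total_derivative:
  "(F has_derivative (\<lambda>h. \<Sum>b\<in>Basis. (h \<bullet> b) * partial_deriv b F x)) (at x)"
proof (rule has_derivative_of_continuous_partials)
  fix b :: 'a assume b: "b \<in> Basis"
  then show "has_partial b F" using smooth unfolding continuous_third_partials_def by blast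
  show "continuous_on UNIV (partial_deriv b F)"
    using first_partial_derivative[OF b]
    by (intro continuous_at_imp_continuous_on ballI has_derivative_continuous)
qed

lemma line_derivative:
  "((\<lambda>t. F (x + t *\<^sub>R h)) has_real_derivative (\<Sum>b\<in>Basis. (h \<bullet> b) * partial_deriv b F (x
      + t *\<^sub>R h))) (at t)"
proof -
  have "((\<lambda>t. F (x + t *\<^sub>R h)) has_derivative
      (\<lambda>s. \<Sum>b\<in>Basis. ((s *\<^sub>R h) \<bullet> b) * partial_deriv b F (x + t *\<^sub>R h))) (at t)"
    by (rule has_derivative_compose[where g = F and f = "\<lambda>t. x + t *\<^sub>R h", OF _ total_derivative])
      (auto intro!: derivative_eq_intros)
  then show ?thesis
    unfolding has_field_derivative_def
    by (rule has_derivative_eq_rhs) (simp add: fun_eq_iff sum_distrib_left sum_distrib_right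
        ac_simps)
qed

lemma line_derivative2:
  assumes "b \<in> Basis"
  shows "((\<lambda>t. partial_deriv b F (x + t *\<^sub>R h)) has_real_derivative
    (\<Sum>c\<in>Basis. (h \<bullet> c) * partial_deriv c (partial_deriv b F) (x + t *\<^sub>R h))) (at t)"
proof -
  have "((\<lambda>t. partial_deriv b F (x + t *\<^sub>R h)) has_derivative
      (\<lambda>s. \<Sum>c\<in>Basis. ((s *\<^sub>R h) \<bullet> c) * partial_deriv c (partial_deriv b F) (x + t *\<^sub>R h))) (at t)"
    by (rule has_derivative_compose[where g = "partial_deriv b F" and f = "\<lambda>t. x + t *\<^sub>R h",
          OF _ first_partial_derivative[OF assms]])
      (auto intro!: derivative_eq_intros)
  then show ?thesis
    unfolding has_field_derivative_def
    by (rule has_derivative_eq_rhs) (simp add: fun_eq_iff sum_distrib_left sum_distrib_right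
        ac_simps)
qed

lemma partial_line:
  assumes "b \<in> Basis"
  shows "((\<lambda>t. F (x + t *\<^sub>R b)) has_real_derivative partial_deriv b F (x + t *\<^sub>R b)) (at t)"
    and "c \<in> Basis \<Longrightarrow> ((\<lambda>t. partial_deriv c F (x + t *\<^sub>R b)) has_real_derivative
      partial_deriv b (partial_deriv c F) (x + t *\<^sub>R b)) (at t)"
proof -
  have *: "(\<Sum>c\<in>Basis. (b \<bullet> c) * G c) = G b" for G :: "'a \<Rightarrow> real"
    using assms by (simp add: inner_Basis if_distrib[of "\<lambda>x. x * _"] sum.delta cong: if_cong)
  show "((\<lambda>t. F (x + t *\<^sub>R b)) has_real_derivative partial_deriv b F (x + t *\<^sub>R b)) (at t)"
    using line_derivative[of x b t] unfolding * .
  show "c \<in> Basis \<Longrightarrow> ((\<lambda>t. partial_deriv c F (x + t *\<^sub>R b)) has_real_derivative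
      partial_deriv b (partial_deriv c F) (x + t *\<^sub>R b)) (at t)"
    using line_derivative2[of c x b t] unfolding * .
qed

text \<open>Both mixed derivatives are limits of the same second difference quotient.\<close>

lemma mixed_partials_near:
  assumes b: "b \<in> Basis" and c: "c \<in> Basis" and t: "t > 0"
  shows "\<exists>y. norm (y - x) \<le> 2 * t \<and>
    F (x + t *\<^sub>R b + t *\<^sub>R c) - F (x + t *\<^sub>R b) - F (x + t *\<^sub>R c) + F x =
      t * t * partial_deriv c (partial_deriv b F) y"
proof -
  let ?g = "\<lambda>s. F ((x + t *\<^sub>R c) + s *\<^sub>R b) - F (x + s *\<^sub>R b)"
  have "(?g has_real_derivative partial_deriv b F ((x + t *\<^sub>R c) + s *\<^sub>R b) - partial_deriv b F (x
      + s *\<^sub>R b)) (at s)" for s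
    by (intro DERIV_diff partial_line[OF b])
  from MVT2[OF t this] obtain s where s: "0 < s" "s < t"
    "?g t - ?g 0 = (t - 0) * (partial_deriv b F ((x + t *\<^sub>R c) + s *\<^sub>R b) - partial_deriv b F (x
        + s *\<^sub>R b))" by auto
  have "((\<lambda>u. partial_deriv b F ((x + s *\<^sub>R b) + u *\<^sub>R c)) has_real_derivative
      partial_deriv c (partial_deriv b F) ((x + s *\<^sub>R b) + u *\<^sub>R c)) (at u)" for u
    by (rule partial_line(2)[OF c b])
  from MVT2[OF t this] obtain u where u: "0 < u" "u < t"
    "partial_deriv b F ((x + s *\<^sub>R b) + t *\<^sub>R c) - partial_deriv b F ((x + s *\<^sub>R b) + 0 *\<^sub>R c) =
      (t - 0) * partial_deriv c (partial_deriv b F) ((x + s *\<^sub>R b) + u *\<^sub>R c)" by auto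
  have "norm (s *\<^sub>R b + u *\<^sub>R c) \<le> s + u"
    using norm_triangle_ineq[of "s *\<^sub>R b" "u *\<^sub>R c"] s u b c by simp
  then have "norm ((x + s *\<^sub>R b) + u *\<^sub>R c - x) \<le> 2 * t" using s u by (simp add: algebra_simps)
  moreover have "F (x + t *\<^sub>R b + t *\<^sub>R c) - F (x + t *\<^sub>R b) - F (x + t *\<^sub>R c) + F x =
      t * t * partial_deriv c (partial_deriv b F) ((x + s *\<^sub>R b) + u *\<^sub>R c)"
  proof -
    have comm: "x + k *\<^sub>R b + t *\<^sub>R c = (x + t *\<^sub>R c) + k *\<^sub>R b" for k
      by (simp add: ac_simps)
    have "F (x + t *\<^sub>R b + t *\<^sub>R c) - F (x + t *\<^sub>R b) - F (x + t *\<^sub>R c) + F x = ?g t - ?g 0"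
      unfolding comm by simp
    also have "\<dots> = t * (partial_deriv b F ((x + t *\<^sub>R c) + s *\<^sub>R b) - partial_deriv b F (x + s *\<^sub>R b))"
      using s(3) by simp
    also have "partial_deriv b F ((x + t *\<^sub>R c) + s *\<^sub>R b) - partial_deriv b F (x + s *\<^sub>R b) =
        t * partial_deriv c (partial_deriv b F) ((x + s *\<^sub>R b) + u *\<^sub>R c)"
      using u(3) unfolding comm[symmetric] by simp
    finally show ?thesis by (simp only: mult.assoc)
  qed
  ultimately show ?thesis by blast
qed

lemma mixed_partials_eq:
  assumes b: "b \<in> Basis" and c: "c \<in> Basis"
  shows "partial_deriv b (partial_deriv c F) x = partial_deriv c (partial_deriv b F) x"
proof -
  let ?t = "\<lambda>n. inverse (real (Suc n))"
  define Q where "Q t = (F (x + t *\<^sub>R b + t *\<^sub>R c) - F (x + t *\<^sub>R b) - F (x + t *\<^sub>R c)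
      + F x) / (t * t)" for t
  have lim: "(\<lambda>n. Q (?t n)) \<longlonglongrightarrow> G x"
    if G: "continuous_on UNIV G" and near: "\<And>t. t > 0 \<Longrightarrow> \<exists>y. norm (y - x) \<le> 2 * t \<and> Q t = G y" for G
  proof -
    have pos: "?t n > 0" for n by simp
    have "\<forall>n. \<exists>y. norm (y - x) \<le> 2 * ?t n \<and> Q (?t n) = G y"
      by (intro allI near pos)
    from choice[OF this] obtain y where
      y: "\<And>n. norm (y n - x) \<le> 2 * ?t n" "\<And>n. Q (?t n) = G (y n)" by blast
    have "(\<lambda>n. 2 * ?t n) \<longlonglongrightarrow> 2 * 0"
      by (intro tendsto_mult tendsto_const LIMSEQ_inverse_real_of_nat)
    then have "(\<lambda>n. 2 * ?t n) \<longlonglongrightarrow> 0" by (simp only: mult_zero_right)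
    then have "(\<lambda>n. y n - x) \<longlonglongrightarrow> 0"
      by (rule Lim_null_comparison[OF always_eventually[OF allI[OF y(1)]]])
    then have "y \<longlonglongrightarrow> x" by (simp add: LIM_zero_iff)
    then have "(\<lambda>n. G (y n)) \<longlonglongrightarrow> G x"
      using G continuous_on_tendsto_compose[of UNIV G y x] by simp
    then show ?thesis by (simp only: y(2))
  qed
  have "(\<lambda>n. Q (?t n)) \<longlonglongrightarrow> partial_deriv c (partial_deriv b F) x"
  proof (rule lim[OF second_partial_continuous[OF b c]])
    fix t :: real assume "t > 0"
    then obtain y where y: "norm (y - x) \<le> 2 * t"
      "F (x + t *\<^sub>R b + t *\<^sub>R c) - F (x + t *\<^sub>R b) - F (x + t *\<^sub>R c) + F x =
        t * t * partial_deriv c (partial_deriv b F) y"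
      using mixed_partials_near[OF b c] by blast
    have "Q t = partial_deriv c (partial_deriv b F) y" unfolding Q_def y(2) using \<open>t > 0\<close> by simp
    then show "\<exists>y. norm (y - x) \<le> 2 * t \<and> Q t = partial_deriv c (partial_deriv b F) y"
      using y(1) by blast
  qed
  moreover have "(\<lambda>n. Q (?t n)) \<longlonglongrightarrow> partial_deriv b (partial_deriv c F) x"
  proof (rule lim[OF second_partial_continuous[OF c b]])
    fix t :: real assume "t > 0"
    then obtain y where y: "norm (y - x) \<le> 2 * t"
      "F (x + t *\<^sub>R c + t *\<^sub>R b) - F (x + t *\<^sub>R c) - F (x + t *\<^sub>R b) + F x =
        t * t * partial_deriv b (partial_deriv c F) y"
      using mixed_partials_near[OF c b] by blast
    have comm: "x + t *\<^sub>R b + t *\<^sub>R c = x + t *\<^sub>R c + t *\<^sub>R b" by (simp add: ac_simps)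
    have *: "F (x + t *\<^sub>R b + t *\<^sub>R c) - F (x + t *\<^sub>R b) - F (x + t *\<^sub>R c) + F x =
        t * t * partial_deriv b (partial_deriv c F) y"
      unfolding comm using y(2) by linarith
    have "Q t = partial_deriv b (partial_deriv c F) y" unfolding Q_def * using \<open>t > 0\<close> by simp
    then show "\<exists>y. norm (y - x) \<le> 2 * t \<and> Q t = partial_deriv b (partial_deriv c F) y"
      using y(1) by blast
  qed
  ultimately show ?thesis using LIMSEQ_unique by blast
qed

lemma linear_hessian: "linear (hessian F x)"
  by (rule linearI)
    (simp_all add: hessian_def inner_add_left inner_scaleR_left algebra_simps sum.distrib
        sum_distrib_left scaleR_sum_right)

lemma hessian_inner:
  "hessian F x h \<bullet> k = (\<Sum>b\<in>Basis. \<Sum>c\<in>Basis. partial_deriv b (partial_deriv c F) x * (h \<bullet> c) * (k \<bullet>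
      b))"
  unfolding hessian_def by (simp add: inner_sum_left sum_distrib_right inner_commute[of k])

lemma hessian_symmetric: "hessian F x h \<bullet> k = h \<bullet> hessian F x k"
proof -
  have "hessian F x h \<bullet> k = (\<Sum>c\<in>Basis. \<Sum>b\<in>Basis. partial_deriv b (partial_deriv c F) x * (h \<bullet> c) *
      (k \<bullet> b))"
    unfolding hessian_inner by (rule sum.swap)
  also have "\<dots> = hessian F x k \<bullet> h"
    unfolding hessian_inner by (intro sum.cong) (simp_all add: mixed_partials_eq ac_simps)
  finally show ?thesis by (simp add: inner_commute)
qed

lemma taylor2:
  "\<exists>\<theta>. 0 < \<theta> \<and> \<theta> < 1 \<and> F (x + h) = F x + (\<Sum>b\<in>Basis. (h \<bullet> b) * partial_deriv b F x) + hessian F (x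
      + \<theta> *\<^sub>R h) h \<bullet> h / 2"
proof -
  define diff where "diff m t = (if m = 0 then F (x + t *\<^sub>R h) else if m
      = 1 then (\<Sum>b\<in>Basis. (h \<bullet> b) * partial_deriv b F (x + t *\<^sub>R h))
    else hessian F (x + t *\<^sub>R h) h \<bullet> h)" for m :: nat and t :: real
  have "\<exists>t. 0 < t \<and> t < 1 \<and> F (x + 1 *\<^sub>R h) = (\<Sum>m<2. (diff m 0 / fact m) * 1 ^ m)
      + (diff 2 t / fact 2) * 1 ^ 2"
  proof (rule Maclaurin[where diff = diff and f = "\<lambda>t. F (x + t *\<^sub>R h)" and h = 1 and n = 2])
    show "diff 0 = (\<lambda>t. F (x + t *\<^sub>R h))" by (auto simp: diff_def)
    show "\<forall>m t. m < 2 \<and> 0 \<le> t \<and> t \<le> 1 \<longrightarrow> DERIV (diff m) t :> diff (Suc m) t"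
    proof (intro allI impI)
      fix m :: nat and t :: real assume "m < 2 \<and> 0 \<le> t \<and> t \<le> 1"
      then consider "m = 0" | "m = 1" by linarith
      then show "DERIV (diff m) t :> diff (Suc m) t"
      proof cases
        case 1
        then show ?thesis using line_derivative[of x h t] by (simp add: diff_def[abs_def])
      next
        case 2
        have "((\<lambda>t. \<Sum>b\<in>Basis. (h \<bullet> b) * partial_deriv b F (x + t *\<^sub>R h)) has_real_derivative
           (\<Sum>b\<in>Basis. (h \<bullet> b) * (\<Sum>c\<in>Basis. (h \<bullet> c) * partial_deriv c (partial_deriv b F) (x
               + t *\<^sub>R h)))) (at t)"
          by (intro DERIV_sum DERIV_cmult line_derivative2)
        also have "(\<Sum>b\<in>Basis. (h \<bullet> b) * (\<Sum>c\<in>Basis. (h \<bullet> c) * partial_deriv c (partial_deriv b F)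
            (x + t *\<^sub>R h))) =
            h \<bullet> hessian F (x + t *\<^sub>R h) h"
          unfolding hessian_symmetric[symmetric] hessian_inner
          by (subst sum.swap) (simp add: sum_distrib_left ac_simps)
        finally show ?thesis using 2 by (simp add: diff_def[abs_def] inner_commute)
      qed
    qed
  qed auto
  then show ?thesis by (auto simp: diff_def numeral_2_eq_2)
qed

lemma hessian_close:
  assumes "e > 0"
  shows "\<exists>d>0. \<forall>y h. norm (y - x) < d \<longrightarrow> \<bar>hessian F y h \<bullet> h - hessian F x h \<bullet> h\<bar> \<le> e * (norm h)\<^sup>2"
proof -
  define D where "D = real DIM('a)"
  have D: "D > 0" by (simp add: D_def)
  have "\<forall>b\<in>Basis. \<forall>c\<in>Basis. \<exists>d>0. \<forall>y. norm (y - x) < d \<longrightarrow>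
      \<bar>partial_deriv b (partial_deriv c F) y - partial_deriv b (partial_deriv c F) x\<bar> < e / (D * D)"
  proof (intro ballI)
    fix b c :: 'a assume "b \<in> Basis" "c \<in> Basis"
    then have "continuous (at x) (partial_deriv b (partial_deriv c F))"
      using second_partial_continuous continuous_on_eq_continuous_at by blast
    moreover have "e / (D * D) > 0" using assms D by simp
    ultimately show "\<exists>d>0. \<forall>y. norm (y - x) < d \<longrightarrow>
        \<bar>partial_deriv b (partial_deriv c F) y - partial_deriv b (partial_deriv c F) x\<bar>
            < e / (D * D)"
      unfolding continuous_at_eps_delta by (simp add: dist_norm)
  qed
  then obtain d where d: "\<And>b c. b \<in> Basis \<Longrightarrow> c \<in> Basis \<Longrightarrow> d b c > 0"
    "\<And>b c y. b \<in> Basis \<Longrightarrow> c \<in> Basis \<Longrightarrow> norm (y - x) < d b c \<Longrightarrow>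
      \<bar>partial_deriv b (partial_deriv c F) y - partial_deriv b (partial_deriv c F) x\<bar> < e / (D * D)"
    by metis
  define \<delta> where "\<delta> = Min ((\<lambda>(b, c). d b c) ` (Basis \<times> Basis))"
  have \<delta>: "\<delta> > 0" "\<And>b c. b \<in> Basis \<Longrightarrow> c \<in> Basis \<Longrightarrow> \<delta> \<le> d b c"
    using d(1) by (auto simp: \<delta>_def Min_gr_iff intro!: Min_le)
  show ?thesis
  proof (intro exI[of _ \<delta>] conjI allI impI)
    fix y h assume y: "norm (y - x) < \<delta>"
    have "\<bar>hessian F y h \<bullet> h - hessian F x h \<bullet> h\<bar> =
      \<bar>\<Sum>b\<in>Basis. \<Sum>c\<in>Basis. (partial_deriv b (partial_deriv c F) y - partial_deriv b (partial_deriv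
          c F) x) * (h \<bullet> c) * (h \<bullet> b)\<bar>"
      unfolding hessian_inner by (simp add: sum_subtractf[symmetric] algebra_simps)
    also have "\<dots> \<le> (\<Sum>b\<in>Basis. \<Sum>c\<in>Basis. \<bar>(partial_deriv b (partial_deriv c F) y - partial_deriv b
        (partial_deriv c F) x) * (h \<bullet> c) * (h \<bullet> b)\<bar>)"
      by (intro order_trans[OF sum_abs] sum_mono sum_abs)
    also have "\<dots> \<le> (\<Sum>b\<in>(Basis :: 'a set). \<Sum>c\<in>(Basis :: 'a set). e / (D * D) * norm h * norm h)"
    proof (intro sum_mono)
      fix b c :: 'a assume bc: "b \<in> Basis" "c \<in> Basis"
      then have "\<bar>partial_deriv b (partial_deriv c F) y - partial_deriv b (partial_deriv c F) x\<bar>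
          \<le> e / (D * D)"
        using d(2)[of b c y] \<delta>(2)[of b c] y by force
      then show "\<bar>(partial_deriv b (partial_deriv c F) y - partial_deriv b (partial_deriv c F) x)
          * (h \<bullet> c) * (h \<bullet> b)\<bar>
          \<le> e / (D * D) * norm h * norm h"
        unfolding abs_mult using bc assms D by (intro mult_mono Basis_le_norm mult_nonneg_nonneg)
            auto
    qed
    also have "\<dots> = e * (norm h)\<^sup>2" using D by (simp add: D_def power2_eq_square)
    finally show "\<bar>hessian F y h \<bullet> h - hessian F x h \<bullet> h\<bar> \<le> e * (norm h)\<^sup>2" .
  qed (use \<delta> in auto)
qed

text \<open>
  At a minimum the Hessian is positive semidefinite; a symmetric semidefinite form vanishes only
  on the kernel of its matrix, so bijectivity makes it positive definite, and Taylor's formula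
  transfers this to the function.
\<close>

lemma quadratic_growth:
  assumes min: "\<And>y. F x \<le> F y" and bij: "bij (hessian F x)"
  shows "\<exists>c>0. \<exists>d>0. \<forall>h. norm h < d \<longrightarrow> F (x + h) - F x \<ge> c * (norm h)\<^sup>2"
proof -
  let ?Q = "\<lambda>h. hessian F x h \<bullet> h"
  have crit: "(\<Sum>b\<in>Basis. (h \<bullet> b) * partial_deriv b F x) = 0" for h
    using DERIV_local_min[OF line_derivative[of x h 0], of 1] min by simp
  have taylor: "\<exists>\<theta>. 0 < \<theta> \<and> \<theta> < 1 \<and> F (x + h) = F x + hessian F (x + \<theta> *\<^sub>R h) h \<bullet> h / 2" for h
    using taylor2[of x h] unfolding crit by simp
  have lin: "hessian F x (u + v) = hessian F x u + hessian F x v" "hessian F x (t *\<^sub>R u)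
      = t *\<^sub>R hessian F x u" for u v t
    using linear_hessian[of x] by (simp_all add: linear_add linear_cmul)
  have lin': "hessian F y (t *\<^sub>R u) = t *\<^sub>R hessian F y u" for y u t
    using linear_hessian[of y] by (simp add: linear_cmul)
  have psd: "?Q h \<ge> 0" for h
  proof (rule ccontr)
    assume "\<not> ?Q h \<ge> 0"
    then have neg: "?Q h < 0" by simp
    then have h0: "h \<noteq> 0" by auto
    then have "- ?Q h / (2 * (norm h)\<^sup>2) > 0" using neg by (simp add: divide_neg_pos)
    then obtain d where d: "d > 0" "\<And>y k. norm (y - x) < d \<Longrightarrow>
        \<bar>hessian F y k \<bullet> k - hessian F x k \<bullet> k\<bar> \<le> - ?Q h / (2 * (norm h)\<^sup>2) * (norm k)\<^sup>2"
      using hessian_close by blast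
    define t where "t = d / (2 * norm h)"
    have t: "t > 0" using d(1) h0 by (simp add: t_def)
    obtain \<theta> where \<theta>: "0 < \<theta>" "\<theta> < 1" "F (x + t *\<^sub>R h) = F x + hessian F (x
        + \<theta> *\<^sub>R (t *\<^sub>R h)) (t *\<^sub>R h) \<bullet> (t *\<^sub>R h) / 2"
      using taylor[of "t *\<^sub>R h"] by blast
    then have *: "hessian F (x + \<theta> *\<^sub>R (t *\<^sub>R h)) h \<bullet> h \<ge> 0"
      using min[of "x + t *\<^sub>R h"] t by (simp add: lin' zero_le_mult_iff)
    have "norm (x + \<theta> *\<^sub>R (t *\<^sub>R h) - x) \<le> t * norm h"
      using \<theta> t by (simp add: mult_left_le_one_le)
    also have "\<dots> < d" using d(1) h0 by (simp add: t_def)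
    finally have "\<bar>hessian F (x + \<theta> *\<^sub>R (t *\<^sub>R h)) h \<bullet> h - ?Q h\<bar> \<le> - ?Q h / 2"
      using d(2)[of "x + \<theta> *\<^sub>R (t *\<^sub>R h)" h] h0 by simp
    then show False using * neg by linarith
  qed
  have pd: "?Q h > 0" if "h \<noteq> 0" for h
  proof (rule ccontr)
    assume "\<not> ?Q h > 0"
    then have Q0: "?Q h = 0" using psd[of h] by simp
    have "hessian F x h \<bullet> u = 0" for u
    proof (rule ccontr)
      assume ne: "hessian F x h \<bullet> u \<noteq> 0"
      have *: "0 \<le> 2 * t * (hessian F x h \<bullet> u) + t\<^sup>2 * ?Q u" for t
      proof -
        have "?Q (h + t *\<^sub>R u) = 2 * t * (hessian F x h \<bullet> u) + t\<^sup>2 * ?Q u"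
          using Q0 hessian_symmetric[of x u h]
          by (simp add: lin inner_add_left inner_add_right power2_eq_square inner_commute
              algebra_simps)
        then show ?thesis using psd[of "h + t *\<^sub>R u"] by simp
      qed
      define B where "B = hessian F x h \<bullet> u"
      define t where "t = - B / (?Q u + 1)"
      have Qu: "?Q u + 1 > 0" using psd[of u] by linarith
      have "2 * t * B + t\<^sup>2 * ?Q u = - (B\<^sup>2) * (?Q u + 2) / (?Q u + 1)\<^sup>2"
      proof -
        have "2 * (- B / s) * B + (- B / s)\<^sup>2 * (s - 1) = - (B\<^sup>2) * (s + 1) / s\<^sup>2" if "s > 0" for s
          using that by (simp add: field_simps power2_eq_square)
        from this[OF Qu] show ?thesis by (simp add: t_def)
      qed
      also have "\<dots> < 0" using Qu ne psd[of u] by (simp add: B_def divide_neg_pos mult_pos_pos)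
      finally show False using *[of t] by (simp add: B_def)
    qed
    then have "hessian F x h = 0" using inner_eq_zero_iff by blast
    also have "0 = hessian F x 0" using linear_hessian[of x] by (simp add: linear_0)
    finally show False using bij that by (simp add: bij_def inj_eq)
  qed
  obtain l where l: "l > 0" "\<And>h. ?Q h \<ge> l * (norm h)\<^sup>2"
  proof -
    have "continuous_on (sphere 0 1) ?Q"
      using linear_hessian[of x] linear_continuous_on linear_conv_bounded_linear
      by (intro continuous_on_inner continuous_on_id) blast
    moreover have "sphere (0 :: 'a) 1 \<noteq> {}" by simp
    ultimately obtain h0 where h0: "h0 \<in> sphere 0 1" "\<And>h. h \<in> sphere 0 1 \<Longrightarrow> ?Q h0 \<le> ?Q h"
      using continuous_attains_inf[OF compact_sphere] by blast
    have "?Q h \<ge> ?Q h0 * (norm h)\<^sup>2" for h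
    proof (cases "h = 0")
      case False
      have "?Q h0 \<le> ?Q ((1 / norm h) *\<^sub>R h)" using False by (intro h0(2)) simp
      also have "\<dots> = ?Q h / (norm h)\<^sup>2" by (simp add: lin power2_eq_square)
      finally show ?thesis using False by (simp add: field_simps)
    qed auto
    moreover have "?Q h0 > 0" using h0(1) by (intro pd) auto
    ultimately show ?thesis using that by blast
  qed
  obtain d where d: "d > 0" "\<And>y h. norm (y - x) < d \<Longrightarrow> \<bar>hessian F y h \<bullet> h - ?Q h\<bar>
      \<le> l / 2 * (norm h)\<^sup>2"
    using hessian_close[of "l / 2" x] l(1) by auto
  have "F (x + h) - F x \<ge> l / 4 * (norm h)\<^sup>2" if h: "norm h < d" for h
  proof -
    obtain \<theta> where \<theta>: "0 < \<theta>" "\<theta> < 1" "F (x + h) = F x + hessian F (x + \<theta> *\<^sub>R h) h \<bullet> h / 2"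
      using taylor[of h] by blast
    have "norm (x + \<theta> *\<^sub>R h - x) \<le> norm h" using \<theta> by (simp add: mult_left_le_one_le)
    then have "\<bar>hessian F (x + \<theta> *\<^sub>R h) h \<bullet> h - ?Q h\<bar> \<le> l / 2 * (norm h)\<^sup>2" using d(2) h by force
    then show ?thesis using \<theta>(3) l(2)[of h] by linarith
  qed
  then show ?thesis using l(1) d(1) by (intro exI[of _ "l / 4"]) auto
qed

end

section \<open>Integrable bounds near zeros\<close>

text \<open>
  Every coordinate of \<open>x\<close> is at most \<open>norm x\<close>, so in dimension three \<open>1 / norm x ^ 2\<close> is dominated
      by
  the product of the one-dimensional functions \<open>\<bar>t\<bar> powr (- 2 / 3)\<close>, which are integrable at 0.
\<close>

lemma nn_integral_powr_finite:
  "(\<integral>\<^sup>+t. indicator {c - R..c + R} t * ennreal (\<bar>t - c\<bar> powr (- 2 / 3)) \<partial>lborel) < \<infinity>"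
proof (cases "R \<ge> 0")
  case True
  let ?f = "\<lambda>t :: real. indicator {0..R} t * t powr (- 2 / 3)"
  have "((\<lambda>t. if t \<in> {0..R} then t powr (- 2 / 3) else 0) has_integral (R powr (- 2 / 3
      + 1) / (- 2 / 3 + 1))) UNIV"
    using has_integral_powr_from_0[of "- 2 / 3" R] True by (simp only: has_integral_restrict_UNIV)
  also have "(\<lambda>t. if t \<in> {0..R} then t powr (- 2 / 3) else 0) = ?f" by (auto simp: fun_eq_iff)
  finally have "(\<integral>\<^sup>+t. ennreal (?f t) \<partial>lborel) = ennreal (R powr (- 2 / 3 + 1) / (- 2 / 3 + 1))"
    by (intro nn_integral_has_integral_lborel) auto
  then have fin: "(\<integral>\<^sup>+t. ennreal (?f t) \<partial>lborel) < \<infinity>" by simp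
  have "(\<integral>\<^sup>+t. ennreal (?f t) \<partial>lborel) = \<bar>- 1 :: real\<bar> * (\<integral>\<^sup>+t. ennreal (?f (0 + - 1 * t)) \<partial>lborel)"
    by (rule nn_integral_real_affine) auto
  then have refl: "(\<integral>\<^sup>+t. ennreal (?f (- t)) \<partial>lborel) = (\<integral>\<^sup>+t. ennreal (?f t) \<partial>lborel)" by simp
  have "(\<integral>\<^sup>+t. indicator {c - R..c + R} t * ennreal (\<bar>t - c\<bar> powr (- 2 / 3)) \<partial>lborel) =
      \<bar>1 :: real\<bar> * (\<integral>\<^sup>+t. indicator {c - R..c + R} (c + 1 * t) * ennreal (\<bar>c
          + 1 * t - c\<bar> powr (- 2 / 3)) \<partial>lborel)"
    by (rule nn_integral_real_affine) auto
  also have "\<dots> \<le> (\<integral>\<^sup>+t. ennreal (?f t) + ennreal (?f (- t)) \<partial>lborel)"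
    by (simp, intro nn_integral_mono) (auto simp: indicator_def abs_if)
  also have "\<dots> = (\<integral>\<^sup>+t. ennreal (?f t) \<partial>lborel) + (\<integral>\<^sup>+t. ennreal (?f (- t)) \<partial>lborel)"
    by (intro nn_integral_add) auto
  also have "\<dots> < \<infinity>" using fin unfolding refl by simp
  finally show ?thesis .
qed simp

lemma AE_coordinate_ne:
  assumes "b \<in> Basis"
  shows "AE x in (lborel :: 'a::euclidean_space measure). x \<bullet> b \<noteq> c"
proof -
  have "{x :: 'a. x \<bullet> b = c} \<in> null_sets lebesgue"
    using negligible_standard_hyperplane[OF assms] negligible_iff_null_sets by blast
  moreover have "{x :: 'a. x \<bullet> b = c} \<in> sets borel"
    by (intro borel_closed closed_Collect_eq continuous_intros)
  ultimately have "{x :: 'a. x \<bullet> b = c} \<in> null_sets lborel"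
    by (simp add: null_sets_completion_iff)
  then show ?thesis using AE_not_in by force
qed

lemma integrable_inverse_square:
  "integrable \<mu> (\<lambda>s. 1 / (norm (s - z))\<^sup>2)"
proof (rule integrableI_bounded)
  define R where "R = pi + norm z"
  define f where "f b t = indicator {z \<bullet> b - R..z \<bullet> b
      + R} t * ennreal (\<bar>t - z \<bullet> b\<bar> powr (- 2 / 3))" for b :: R3 and t
  have f: "f b \<in> borel_measurable borel" for b unfolding f_def by measurable
  have "(\<integral>\<^sup>+s. ennreal (norm (1 / (norm (s - z))\<^sup>2)) \<partial>\<mu>) =
      (\<integral>\<^sup>+s. ennreal (norm (1 / (norm (s - z))\<^sup>2)) * indicator torus_cell s \<partial>lborel)"
    unfolding torus_measure_def by (rule nn_integral_restrict_space) simp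
  also have "\<dots> \<le> (\<integral>\<^sup>+s. (\<Prod>b\<in>Basis. f b (s \<bullet> b)) \<partial>lborel)"
  proof (rule nn_integral_mono_AE)
    have "AE s in lborel. \<forall>b\<in>Basis. s \<bullet> b \<noteq> z \<bullet> b"
      by (intro AE_finite_allI AE_coordinate_ne) auto
    then show "AE s in lborel. ennreal (norm (1 / (norm (s - z))\<^sup>2)) * indicator torus_cell s
        \<le> (\<Prod>b\<in>Basis. f b (s \<bullet> b))"
    proof eventually_elim
      case (elim s)
      show ?case
      proof (cases "s \<in> torus_cell")
        case True
        have f_eq: "f b (s \<bullet> b) = ennreal (\<bar>(s - z) \<bullet> b\<bar> powr (- 2 / 3))" if b: "b \<in> Basis" for b
        proof -
          obtain i where i: "b = axis i 1" using b by (auto simp: Basis_vec_def)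
          have "\<bar>s \<bullet> b\<bar> \<le> pi" using True i by (auto simp: torus_cell_def inner_axis abs_le_iff
              less_imp_le minus_le_iff)
          moreover have "\<bar>z \<bullet> b\<bar> \<le> norm z" using b by (rule Basis_le_norm)
          ultimately have "s \<bullet> b \<in> {z \<bullet> b - R..z \<bullet> b + R}" unfolding R_def by auto
          then show ?thesis by (simp add: f_def inner_diff_left)
        qed
        have "s \<noteq> z" using elim SOME_Basis by blast
        then have n0: "norm (s - z) > 0" by simp
        have "1 / (norm (s - z))\<^sup>2 = (norm (s - z) powr (- 2 / 3)) ^ 3"
        proof -
          have "(norm (s - z) powr (- 2 / 3)) ^ 3 = norm (s - z) powr (- 2)"
            using n0 by (simp add: powr_power)
          also have "\<dots> = 1 / (norm (s - z))\<^sup>2"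
            using n0 by (simp add: powr_minus powr_numeral inverse_eq_divide)
          finally show ?thesis by simp
        qed
        also have "\<dots> = (\<Prod>b\<in>(Basis :: R3 set). norm (s - z) powr (- 2 / 3))" by simp
        also have "\<dots> \<le> (\<Prod>b\<in>Basis. \<bar>(s - z) \<bullet> b\<bar> powr (- 2 / 3))"
        proof (rule prod_mono, intro conjI)
          fix b :: R3 assume b: "b \<in> Basis"
          then have "0 < \<bar>(s - z) \<bullet> b\<bar>" using elim by (simp add: inner_diff_left)
          then show "norm (s - z) powr (- 2 / 3) \<le> \<bar>(s - z) \<bullet> b\<bar> powr (- 2 / 3)"
            using Basis_le_norm[OF b] by (intro powr_mono2') auto
        qed simp
        finally show ?thesis using True f_eq by (simp add: prod_ennreal ennreal_leI)
      qed simp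
    qed
  qed
  also have "\<dots> = (\<Prod>b\<in>Basis. \<integral>\<^sup>+t. f b t \<partial>lborel)"
    by (rule nn_integral_lborel_prod) (use f in auto)
  also have "\<dots> < \<infinity>"
  proof -
    have fin: "(\<integral>\<^sup>+t. f b t \<partial>lborel) < \<infinity>" for b
      unfolding f_def by (rule nn_integral_powr_finite)
    have "(\<Prod>b\<in>B. \<integral>\<^sup>+t. f b t \<partial>lborel) < \<infinity>" if "finite B" for B
      using that by induction (use fin in \<open>auto simp: ennreal_mult_less_top\<close>)
    then show ?thesis by simp
  qed
  finally show "(\<integral>\<^sup>+s. ennreal (norm (1 / (norm (s - z))\<^sup>2)) \<partial>\<mu>) < \<infinity>" .
qed measurable

text \<open>
  Local quadratic lower bounds at the points of a compact set combine, by a finite subcover, into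
  one bound by the distance to a finite set. At a point where the function is positive, the local
  bound holds by continuity.
\<close>

lemma local_bound_positive:
  fixes F :: "'a::real_normed_vector \<Rightarrow> real"
  assumes "continuous_on UNIV F" "F z > 0"
  shows "\<exists>c>0. \<exists>d>0. \<forall>x. norm (x - z) < d \<longrightarrow> F x \<ge> c * (norm (x - z))\<^sup>2"
proof -
  have "continuous (at z) F" using assms(1) continuous_on_eq_continuous_at by blast
  then obtain d where d: "d > 0" "\<And>x. norm (x - z) < d \<Longrightarrow> \<bar>F x - F z\<bar> < F z / 2"
    using assms(2) unfolding continuous_at_eps_delta by (metis dist_norm half_gt_zero real_norm_def)
  have "F x \<ge> F z / 2 * (norm (x - z))\<^sup>2" if x: "norm (x - z) < min d 1" for x
  proof -
    have "(norm (x - z))\<^sup>2 \<le> 1" using x by (simp add: power_le_one)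
    then have "F z / 2 * (norm (x - z))\<^sup>2 \<le> F z / 2 * 1" using assms(2)
        by (intro mult_left_mono) auto
    moreover have "\<bar>F x - F z\<bar> < F z / 2" using d(2) x by simp
    then have "F x > F z / 2" by linarith
    ultimately show ?thesis by simp
  qed
  then show ?thesis using d(1) assms(2) by (intro exI[of _ "F z / 2"] conjI exI[of _ "min d 1"])
      auto
qed

lemma finite_quadratic_lower_bound:
  fixes F :: "'a::real_normed_vector \<Rightarrow> real"
  assumes "compact K"
    and loc: "\<And>z. z \<in> K \<Longrightarrow> \<exists>c>0. \<exists>d>0. \<forall>x. norm (x - z) < d \<longrightarrow> F x \<ge> c * (norm (x - z))\<^sup>2"
  obtains Z c where "finite Z" "Z \<subseteq> K" "c > 0" "\<And>x. x \<in> K \<Longrightarrow> \<exists>z\<in>Z. F x \<ge> c * (norm (x - z))\<^sup>2"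
proof -
  obtain c d where cd: "\<And>z. z \<in> K \<Longrightarrow> c z > 0" "\<And>z. z \<in> K \<Longrightarrow> d z > 0"
    "\<And>z x. z \<in> K \<Longrightarrow> norm (x - z) < d z \<Longrightarrow> F x \<ge> c z * (norm (x - z))\<^sup>2"
    using loc by metis
  obtain Z where Z: "Z \<subseteq> K" "finite Z" "K \<subseteq> (\<Union>z\<in>Z. ball z (d z))"
    by (rule compactE_image[OF assms(1), of K "\<lambda>z. ball z (d z)"]) (use cd(2) in force)+
  define c0 where "c0 = Min (insert 1 (c ` Z))"
  have c0: "c0 > 0" "\<And>z. z \<in> Z \<Longrightarrow> c0 \<le> c z"
    using cd(1) Z by (auto simp: c0_def)
  show ?thesis
  proof (rule that[OF Z(2,1) c0(1)])
    fix x assume "x \<in> K"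
    then obtain z where z: "z \<in> Z" "norm (x - z) < d z"
      using Z(3) by (auto simp: dist_norm norm_minus_commute)
    then have "c0 * (norm (x - z))\<^sup>2 \<le> c z * (norm (x - z))\<^sup>2" using c0(2)
        by (intro mult_right_mono) auto
    also have "\<dots> \<le> F x" using cd(3) z Z(1) by blast
    finally show "\<exists>z\<in>Z. F x \<ge> c0 * (norm (x - z))\<^sup>2" using z(1) by blast
  qed
qed

lemma inverse_bound_from_finite:
  fixes s :: R3
  assumes "finite Z" "c > 0" "z \<in> Z" "y \<ge> c * (norm (s - z))\<^sup>2" "s \<notin> Z"
  shows "y > 0" "1 / y \<le> (\<Sum>z\<in>Z. 1 / c * (1 / (norm (s - z))\<^sup>2))"
proof -
  have "s \<noteq> z" using assms(3,5) by blast
  then have pos: "c * (norm (s - z))\<^sup>2 > 0" using assms(2) by simp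
  then show "y > 0" using assms(4) by linarith
  then have "1 / y \<le> 1 / (c * (norm (s - z))\<^sup>2)" using assms(4) pos by (intro divide_left_mono) auto
  also have "\<dots> = 1 / c * (1 / (norm (s - z))\<^sup>2)" by simp
  also have "\<dots> \<le> (\<Sum>z\<in>Z. 1 / c * (1 / (norm (s - z))\<^sup>2))"
    using assms by (intro member_le_sum) auto
  finally show "1 / y \<le> (\<Sum>z\<in>Z. 1 / c * (1 / (norm (s - z))\<^sup>2))" .
qed

lemma integrable_inverse_square_sum:
  assumes "finite Z"
  shows "integrable \<mu> (\<lambda>s. \<Sum>z\<in>Z. 1 / c * (1 / (norm (s - z))\<^sup>2))"
  by (intro Bochner_Integration.integrable_sum integrable_mult_right integrable_inverse_square)

text \<open>A zero of order at most 2 is harmless for the reciprocal in dimension three.\<close>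

lemma inverse_integrable_of_power_zeros:
  assumes F: "torus_fun F" "continuous_on UNIV F" and nn: "\<And>p. F p \<ge> 0" and pz: "power_zeros F"
  obtains g N where "integrable \<mu> g" "finite N" "\<And>p. p \<in> torus_cell - N \<Longrightarrow> F p > 0 \<and> 1 / F p \<le> g p"
proof -
  obtain C \<delta> \<beta> where C: "C > 0" "\<delta> > 0"
    and \<beta>: "\<And>z. z \<in> torus_zeros F \<Longrightarrow> 0 < \<beta> z \<and> \<beta> z \<le> 2"
    and bnd: "\<And>z p. z \<in> torus_zeros F \<Longrightarrow> p \<in> torus_nbhd \<delta> z \<Longrightarrow> \<bar>F p\<bar> \<ge> C * torus_dist p z powr \<beta> z"
    using pz unfolding power_zeros_def by blast
  have "\<exists>c>0. \<exists>d>0. \<forall>x. norm (x - z) < d \<longrightarrow> F x \<ge> c * (norm (x - z))\<^sup>2" for z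
  proof (cases "F z = 0")
    case True
    have "F x \<ge> C * (norm (x - z))\<^sup>2" if x: "norm (x - z) < min \<delta> 1" for x
    proof -
      let ?z = "torus_rep z"
      have z: "?z \<in> torus_zeros F"
        using True torus_rep_in_cell torus_fun_rep[OF F(1)] by (simp add: torus_zeros_def)
      have d: "torus_dist (torus_rep x) ?z = norm (x - z)"
        using x pi_ge_two by (intro torus_dist_rep) auto
      have "torus_rep x \<in> torus_nbhd \<delta> ?z"
        using d x torus_rep_in_cell by (simp add: torus_nbhd_def)
      then have "C * norm (x - z) powr \<beta> ?z \<le> F x"
        using bnd[OF z] d nn torus_fun_rep[OF F(1)] by (metis abs_of_nonneg)
      moreover have "norm (x - z) powr 2 \<le> norm (x - z) powr \<beta> ?z"
        using \<beta>[OF z] x by (intro powr_mono') auto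
      then have "C * (norm (x - z))\<^sup>2 \<le> C * norm (x - z) powr \<beta> ?z"
        using C by (intro mult_left_mono) auto
      ultimately show ?thesis by linarith
    qed
    then show ?thesis using C by (intro exI[of _ C] conjI exI[of _ "min \<delta> 1"]) auto
  next
    case False
    then show ?thesis using nn[of z] by (intro local_bound_positive F(2)) simp
  qed
  then obtain Z c where Z: "finite Z" "c > 0"
    "\<And>x. x \<in> torus_cube \<Longrightarrow> \<exists>z\<in>Z. F x \<ge> c * (norm (x - z))\<^sup>2"
    using finite_quadratic_lower_bound[OF compact_torus_cube, of F] by metis
  show ?thesis
  proof (rule that[OF integrable_inverse_square_sum[OF Z(1), of c] Z(1)])
    fix p assume p: "p \<in> torus_cell - Z"
    then obtain z where "z \<in> Z" "F p \<ge> c * (norm (p - z))\<^sup>2" using Z(3) cell_subset_cube by blast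
    then show "F p > 0 \<and> 1 / F p \<le> (\<Sum>z\<in>Z. 1 / c * (1 / (norm (p - z))\<^sup>2))"
      using inverse_bound_from_finite[OF Z(1,2)] p by blast
  qed
qed

text \<open>
  For \<open>w2\<close> the bound in the pair variable dominates a bound in the second variable alone, uniformly
  in the first.
\<close>

lemma symbol_minimum_bound:
  fixes w2 :: "R3 \<times> R3 \<Rightarrow> real"
  assumes w2: "torus_fun2 w2" "continuous_on UNIV w2"
    and m: "m = minimum (w2 ` (torus_cell \<times> torus_cell))"
    and umin: "unique_nondegenerate_min w2 (p0, p0)"
    and smooth: "continuous_third_partials w2"
  obtains g N where "integrable \<mu> g" "finite N" "\<And>x. m \<le> w2 x"
    "\<And>p s. s \<in> torus_cell - N \<Longrightarrow> w2 (p, s) > m \<and> 1 / (w2 (p, s) - m) \<le> g s"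
proof -
  have p0: "p0 \<in> torus_cell" and um: "\<And>x. x \<in> torus_cell \<times> torus_cell \<Longrightarrow> x \<noteq> (p0, p0) \<Longrightarrow> w2 (p0, p0)
      < w2 x"
    and bij: "bij (hessian w2 (p0, p0))"
    using umin unfolding unique_nondegenerate_min_def by auto
  have rep: "w2 (p, q) = w2 (torus_rep p, torus_rep q)" for p q
    using torus_fun2_rep[OF w2(1)] by simp
  have min0: "w2 (p0, p0) \<le> w2 x" for x
  proof -
    have "w2 (p0, p0) \<le> w2 (torus_rep (fst x), torus_rep (snd x))"
      using um[of "(torus_rep (fst x), torus_rep (snd x))"] torus_rep_in_cell
      by (cases "(torus_rep (fst x), torus_rep (snd x)) = (p0, p0)") (auto intro: less_imp_le)
    then show ?thesis using rep[of "fst x" "snd x"] by simp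
  qed
  have m0: "m = w2 (p0, p0)"
    unfolding m by (rule minimum_eqI) (use p0 min0 in auto)
  have shift: "w2 ((p, q) + (h, k)) = w2 ((torus_rep p, torus_rep q) + (h, k))" for p q h k
  proof -
    have 1: "torus_fun (\<lambda>p. w2 (p + h, y))" for y
      using w2(1) unfolding torus_fun2_def torus_fun_def by (metis add.assoc add.commute)
    have 2: "torus_fun (\<lambda>q. w2 (x, q + k))" for x
      using w2(1) unfolding torus_fun2_def torus_fun_def by (metis add.assoc add.commute)
    show ?thesis using torus_fun_rep[OF 1] torus_fun_rep[OF 2] by simp
  qed
  let ?F = "\<lambda>x. w2 x - m"
  have "\<exists>c>0. \<exists>d>0. \<forall>x. norm (x - z) < d \<longrightarrow> ?F x \<ge> c * (norm (x - z))\<^sup>2" for z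
  proof (cases "?F z = 0")
    case True
    obtain p q where z: "z = (p, q)" by fastforce
    have *: "(torus_rep p, torus_rep q) = (p0, p0)"
    proof (rule ccontr)
      assume "(torus_rep p, torus_rep q) \<noteq> (p0, p0)"
      then have "w2 (p0, p0) < w2 (torus_rep p, torus_rep q)"
        using um torus_rep_in_cell by blast
      then show False using True rep[of p q] by (simp add: z m0)
    qed
    obtain c d where cd: "c > 0" "d > 0" "\<And>h. norm h < d \<Longrightarrow> w2 ((p0, p0)
        + h) - w2 (p0, p0) \<ge> c * (norm h)\<^sup>2"
      using quadratic_growth[OF smooth min0 bij] by blast
    have "?F x \<ge> c * (norm (x - z))\<^sup>2" if "norm (x - z) < d" for x
    proof -
      have "w2 x = w2 ((p0, p0) + (x - z))"
        using shift[of p q "fst (x - z)" "snd (x - z)"] * z by (cases x) simp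
      then show ?thesis using cd(3)[OF that] m0 by simp
    qed
    then show ?thesis using cd by blast
  next
    case False
    then show ?thesis using min0[of z] m0
      by (intro local_bound_positive continuous_intros w2(2)) auto
  qed
  then obtain Z c where Z: "finite Z" "c > 0"
    "\<And>x. x \<in> torus_cube \<times> torus_cube \<Longrightarrow> \<exists>z\<in>Z. ?F x \<ge> c * (norm (x - z))\<^sup>2"
    using finite_quadratic_lower_bound[OF compact_Times[OF compact_torus_cube compact_torus_cube],
        of ?F] by metis
  have fin: "finite (snd ` Z)" using Z(1) by simp
  show ?thesis
  proof (rule that[OF integrable_inverse_square_sum[OF fin, of c] fin])
    show "m \<le> w2 x" for x using min0 m0 by simp
    fix p s assume s: "s \<in> torus_cell - snd ` Z"
    have "(torus_rep p, s) \<in> torus_cube \<times> torus_cube"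
      using s torus_rep_in_cell cell_subset_cube by blast
    then obtain z where z: "z \<in> Z" "?F (torus_rep p, s) \<ge> c * (norm ((torus_rep p, s) - z))\<^sup>2"
      using Z(3) by blast
    have "norm (s - snd z) \<le> norm ((torus_rep p, s) - z)"
      using norm_snd_le[of "s - snd z" "torus_rep p - fst z"] by (cases z) simp
    then have "c * (norm (s - snd z))\<^sup>2 \<le> c * (norm ((torus_rep p, s) - z))\<^sup>2"
      using Z(2) by (intro mult_left_mono power_mono) auto
    also note z(2)
    also have "w2 (torus_rep p, s) = w2 (p, s)"
      using torus_fun_rep[of "\<lambda>p. w2 (p, s)"] w2(1) by (simp add: torus_fun2_def)
    finally show "w2 (p, s) > m \<and> 1 / (w2 (p, s) - m) \<le> (\<Sum>z\<in>snd ` Z. 1 / c * (1 / (norm (s - z))\<^sup>2))"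
      using inverse_bound_from_finite[OF fin Z(2), of "snd z" s "w2 (p, s) - m"] z(1) s by auto
  qed
qed

section \<open>Two facts of linear algebra\<close>

lemma homogeneous_system_nontrivial:
  fixes a :: "nat \<Rightarrow> 'i \<Rightarrow> real"
  assumes "finite I" "n < card I"
  shows "\<exists>c. (\<exists>i\<in>I. c i \<noteq> 0) \<and> (\<forall>k<n. (\<Sum>i\<in>I. c i * a k i) = 0)"
  using assms
proof (induction n arbitrary: I a)
  case 0
  then have "I \<noteq> {}" by auto
  then show ?case by (intro exI[of _ "\<lambda>_. 1"]) auto
next
  case (Suc n)
  show ?case
  proof (cases "\<forall>i\<in>I. a n i = 0")
    case True
    obtain c where c: "\<exists>i\<in>I. c i \<noteq> 0" "\<And>k. k < n \<Longrightarrow> (\<Sum>i\<in>I. c i * a k i) = 0"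
      using Suc.IH[of I a] Suc.prems by auto
    then show ?thesis using True by (intro exI[of _ c]) (auto simp: less_Suc_eq)
  next
    case False
    then obtain j where j: "j \<in> I" "a n j \<noteq> 0" by blast
    \<comment> \<open>The \<open>n\<close>-th equation expresses the unknown \<open>j\<close> by the others.\<close>
    let ?I = "I - {j}"
    have "n < card ?I" using Suc.prems j by simp
    then obtain c where c: "\<exists>i\<in>?I. c i \<noteq> 0"
      "\<And>k. k < n \<Longrightarrow> (\<Sum>i\<in>?I. c i * (a k i - a n i * a k j / a n j)) = 0"
      using Suc.IH[of ?I "\<lambda>k i. a k i - a n i * a k j / a n j"] Suc.prems by auto
    define c' where "c' = c(j := - (\<Sum>i\<in>?I. c i * a n i) / a n j)"
    have split: "(\<Sum>i\<in>I. c' i * a k i) = (\<Sum>i\<in>?I. c i * (a k i - a n i * a k j / a n j))" for k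
    proof -
      have "(\<Sum>i\<in>I. c' i * a k i) = c' j * a k j + (\<Sum>i\<in>?I. c' i * a k i)"
        using Suc.prems j by (simp add: sum.remove)
      also have "(\<Sum>i\<in>?I. c' i * a k i) = (\<Sum>i\<in>?I. c i * a k i)"
        by (intro sum.cong) (auto simp: c'_def)
      also have "c' j * a k j = - (\<Sum>i\<in>?I. c i * (a n i * a k j / a n j))"
        by (simp add: c'_def sum_distrib_right sum_divide_distrib sum_negf mult.assoc)
      finally show ?thesis by (simp add: sum_subtractf right_diff_distrib)
    qed
    have "(\<Sum>i\<in>I. c' i * a n i) = 0" unfolding split using j by simp
    moreover have "\<exists>i\<in>I. c' i \<noteq> 0" using c(1) by (auto simp: c'_def)
    ultimately show ?thesis using c(2) split by (intro exI[of _ c']) (auto simp: less_Suc_eq)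
  qed
qed

text \<open>
  Let \<open>b e\<close> be a family of symmetric matrices that decreases in \<open>e\<close>, with the \<open>i\<close>-th row of
  \<open>b (E i)\<close> equal to zero. Adding the indices in increasing order of \<open>E i\<close>, the form stays negative
  beyond all \<open>E i\<close>: at \<open>e = E i\<close> the new vector is in the kernel and changes nothing, and for
  larger \<open>e\<close> it becomes negative as well.
\<close>

lemma pencil_negative:
  fixes b :: "real \<Rightarrow> 'i \<Rightarrow> 'i \<Rightarrow> real" and E :: "'i \<Rightarrow> real"
  assumes fin: "finite S" and inj: "inj_on E S" and EJ: "\<And>i. i \<in> S \<Longrightarrow> E i \<in> J"
    and sym: "\<And>e i j. b e i j = b e j i"
    and ker: "\<And>i j. i \<in> S \<Longrightarrow> j \<in> S \<Longrightarrow> b (E i) i j = 0"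
    and mono: "\<And>e e' c. e \<in> J \<Longrightarrow> e' \<in> J \<Longrightarrow> e \<le> e' \<Longrightarrow>
      (\<Sum>i\<in>S. \<Sum>j\<in>S. c i * c j * b e' i j) \<le> (\<Sum>i\<in>S. \<Sum>j\<in>S. c i * c j * b e i j)"
    and strict: "\<And>i e. i \<in> S \<Longrightarrow> e \<in> J \<Longrightarrow> E i < e \<Longrightarrow> b e i i < 0"
    and e: "e \<in> J" "\<And>i. i \<in> S \<Longrightarrow> E i < e" and c: "\<exists>i\<in>S. c i \<noteq> 0"
  shows "(\<Sum>i\<in>S. \<Sum>j\<in>S. c i * c j * b e i j) < 0"
proof -
  define q where "q T e c = (\<Sum>i\<in>T. \<Sum>j\<in>T. c i * c j * b e i j)" for T e and c :: "'i \<Rightarrow> real"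
  have restrict: "q T e c = q S e (\<lambda>i. if i \<in> T then c i else 0)" if "T \<subseteq> S" for T e c
  proof -
    have "q T e c = (\<Sum>i\<in>T. \<Sum>j\<in>S. c i * (if j \<in> T then c j else 0) * b e i j)"
      unfolding q_def using that fin by (intro sum.cong sum.mono_neutral_cong_left) auto
    also have "\<dots> = q S e (\<lambda>i. if i \<in> T then c i else 0)"
      unfolding q_def using that fin by (intro sum.mono_neutral_cong_left) auto
    finally show ?thesis .
  qed
  have q_mono: "q T e' c \<le> q T e c" if "T \<subseteq> S" "e \<in> J" "e' \<in> J" "e \<le> e'" for T e e' c
    unfolding restrict[OF that(1)] unfolding q_def by (rule mono) (use that in auto)
  have q_insert: "q (insert k T) e c = q T e c + 2 * c k * (\<Sum>j\<in>T. c j * b e k j) + (c k)\<^sup>2 * b e k k"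
    if "finite T" "k \<notin> T" for k T e c
  proof -
    have "q (insert k T) e c = (\<Sum>j\<in>insert k T. c k * c j * b e k j) + (\<Sum>i\<in>T. c i * c k * b e i k
        + (\<Sum>j\<in>T. c i * c j * b e i j))"
      unfolding q_def using that by simp
    also have "(\<Sum>i\<in>T. c i * c k * b e i k + (\<Sum>j\<in>T. c i * c j * b e i j))
        = c k * (\<Sum>j\<in>T. c j * b e k j) + q T e c"
      unfolding q_def by (simp add: sum.distrib sum_distrib_left sym[of _ k] ac_simps)
    also have "(\<Sum>j\<in>insert k T. c k * c j * b e k j) = (c k)\<^sup>2 * b e k k
        + c k * (\<Sum>j\<in>T. c j * b e k j)"
      using that by (simp add: sum_distrib_left power2_eq_square ac_simps)
    finally show ?thesis by simp
  qed
  have "T \<subseteq> S \<Longrightarrow> e \<in> J \<Longrightarrow> (\<And>i. i \<in> T \<Longrightarrow> E i < e) \<Longrightarrow> \<exists>i\<in>T. c i \<noteq> 0 \<Longrightarrow> q T e c < 0" if "finite T" for T e c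
    using that
  proof (induction arbitrary: e c rule: finite_ranking_induct[where f = E])
    case (insert k T)
    show ?case
    proof (cases "k \<in> T")
      case True
      then show ?thesis using insert by (simp add: insert_absorb)
    next
      case False
      have kS: "k \<in> S" and TS: "T \<subseteq> S" using insert.prems by auto
      have kJ: "E k \<in> J" using EJ kS .
      show ?thesis
      proof (cases "\<exists>i\<in>T. c i \<noteq> 0")
        case True
        have "E i < E k" if "i \<in> T" for i
          using insert.hyps(2)[OF that] inj that False TS kS
              by (metis inj_onD order_less_le subsetD)
        then have "q T (E k) c < 0" using insert.IH[OF TS kJ _ True] by blast
        moreover have "q (insert k T) (E k) c = q T (E k) c"
          unfolding q_insert[OF insert.hyps(1) False] using ker kS TS by (simp add: subset_iff)
        moreover have "q (insert k T) e c \<le> q (insert k T) (E k) c"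
          using insert.prems kJ by (intro q_mono) (auto intro: less_imp_le)
        ultimately show ?thesis by simp
      next
        case F: False
        then have "c k \<noteq> 0" using insert.prems(4) by auto
        moreover have "b e k k < 0" using strict[OF kS] insert.prems by auto
        moreover have "q T e c = 0" "(\<Sum>j\<in>T. c j * b e k j) = 0" using F by (simp_all add: q_def)
        ultimately show ?thesis
          unfolding q_insert[OF insert.hyps(1) False] by (simp add: mult_pos_neg)
      qed
    qed
  qed auto
  from this[OF fin order_refl e(1) e(2) c] show ?thesis unfolding q_def .
qed

text \<open>
  The mirror image of the preceding lemma under \<open>e \<mapsto> - e\<close>, \<open>b \<mapsto> - b\<close>.
\<close>

lemma pencil_positive:
  fixes b :: "real \<Rightarrow> 'i \<Rightarrow> 'i \<Rightarrow> real" and E :: "'i \<Rightarrow> real"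
  assumes fin: "finite S" and inj: "inj_on E S" and EJ: "\<And>i. i \<in> S \<Longrightarrow> E i \<in> J"
    and sym: "\<And>e i j. b e i j = b e j i"
    and ker: "\<And>i j. i \<in> S \<Longrightarrow> j \<in> S \<Longrightarrow> b (E i) i j = 0"
    and mono: "\<And>e e' c. e \<in> J \<Longrightarrow> e' \<in> J \<Longrightarrow> e \<le> e' \<Longrightarrow>
      (\<Sum>i\<in>S. \<Sum>j\<in>S. c i * c j * b e' i j) \<le> (\<Sum>i\<in>S. \<Sum>j\<in>S. c i * c j * b e i j)"
    and strict: "\<And>i e. i \<in> S \<Longrightarrow> e \<in> J \<Longrightarrow> e < E i \<Longrightarrow> b e i i > 0"
    and e: "e \<in> J" "\<And>i. i \<in> S \<Longrightarrow> e < E i" and c: "\<exists>i\<in>S. c i \<noteq> 0"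
  shows "(\<Sum>i\<in>S. \<Sum>j\<in>S. c i * c j * b e i j) > 0"
proof -
  have "(\<Sum>i\<in>S. \<Sum>j\<in>S. c i * c j * - b (- (- e)) i j) < 0"
  proof (rule pencil_negative[where b = "\<lambda>e i j. - b (- e) i j" and E = "\<lambda>i. - E i" and J
      = "uminus ` J"])
    show "inj_on (\<lambda>i. - E i) S" using inj by (simp add: inj_on_def)
    fix e e' c assume "e \<in> uminus ` J" "e' \<in> uminus ` J" "e \<le> e'"
    then have "(\<Sum>i\<in>S. \<Sum>j\<in>S. c i * c j * b (- e) i j) \<le> (\<Sum>i\<in>S. \<Sum>j\<in>S. c i * c j * b (- e') i j)"
      by (intro mono) auto
    then show "(\<Sum>i\<in>S. \<Sum>j\<in>S. c i * c j * - b (- e') i j) \<le> (\<Sum>i\<in>S. \<Sum>j\<in>S. c i * c j * - b (- e) i j)"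
      by (simp add: sum_negf)
  qed (use assms in \<open>auto\<close>)
  then show ?thesis by (simp add: sum_negf)
qed

section \<open>Square integrable functions on the torus\<close>

definition square_integrable :: "(R3 \<Rightarrow> real) \<Rightarrow> bool" where
  "square_integrable f \<longleftrightarrow> f \<in> borel_measurable \<mu> \<and> integrable \<mu> (\<lambda>p. (f p)\<^sup>2)"

lemma square_integrable_measurable: "square_integrable f \<Longrightarrow> f \<in> borel_measurable \<mu>"
  by (simp add: square_integrable_def)

lemma abs_mult_le_squares: "\<bar>x * y\<bar> \<le> x\<^sup>2 + y\<^sup>2" for x y :: real
proof -
  have "0 \<le> (\<bar>x\<bar> - \<bar>y\<bar>)\<^sup>2" by simp
  then have "2 * (\<bar>x\<bar> * \<bar>y\<bar>) \<le> x\<^sup>2 + y\<^sup>2" by (simp add: power2_diff)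
  moreover have "0 \<le> \<bar>x\<bar> * \<bar>y\<bar>" by simp
  ultimately show ?thesis unfolding abs_mult by linarith
qed

lemma square_integrable_mult:
  assumes "square_integrable f" "square_integrable h"
  shows "integrable \<mu> (\<lambda>p. f p * h p)"
proof (rule Bochner_Integration.integrable_bound)
  show "integrable \<mu> (\<lambda>p. (f p)\<^sup>2 + (h p)\<^sup>2)" using assms by (simp add: square_integrable_def)
  show "(\<lambda>p. f p * h p) \<in> borel_measurable \<mu>"
    using assms by (intro borel_measurable_times square_integrable_measurable)
  show "AE p in \<mu>. norm (f p * h p) \<le> norm ((f p)\<^sup>2 + (h p)\<^sup>2)"
    using abs_mult_le_squares by (intro AE_I2) (simp add: abs_of_nonneg)
qed

lemma square_integrable_bounded_mult:
  assumes f: "square_integrable f" and v: "v \<in> borel_measurable \<mu>" "\<And>p. \<bar>v p\<bar> \<le> C"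
  shows "square_integrable (\<lambda>p. v p * f p)"
  unfolding square_integrable_def
proof
  show m: "(\<lambda>p. v p * f p) \<in> borel_measurable \<mu>"
    by (rule borel_measurable_times[OF v(1) square_integrable_measurable[OF f]])
  show "integrable \<mu> (\<lambda>p. (v p * f p)\<^sup>2)"
  proof (rule Bochner_Integration.integrable_bound)
    show "integrable \<mu> (\<lambda>p. C\<^sup>2 * (f p)\<^sup>2)" using f by (simp add: square_integrable_def)
    show "(\<lambda>p. (v p * f p)\<^sup>2) \<in> borel_measurable \<mu>" using m by measurable
    have "(v p)\<^sup>2 \<le> C\<^sup>2" for p using v(2)[of p] by (simp add: abs_le_square_iff[symmetric] abs_le_iff)
    then show "AE p in \<mu>. norm ((v p * f p)\<^sup>2) \<le> norm (C\<^sup>2 * (f p)\<^sup>2)"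
      by (intro AE_I2) (simp add: power_mult_distrib mult_right_mono)
  qed
qed

lemma square_integrable_add:
  assumes "square_integrable f" "square_integrable h"
  shows "square_integrable (\<lambda>p. f p + h p)"
proof -
  have "integrable \<mu> (\<lambda>p. (f p)\<^sup>2 + (h p)\<^sup>2 + 2 * (f p * h p))"
    using square_integrable_mult[OF assms] assms
    by (intro Bochner_Integration.integrable_add integrable_mult_right) (auto simp:
        square_integrable_def)
  moreover have "(\<lambda>p. (f p)\<^sup>2 + (h p)\<^sup>2 + 2 * (f p * h p)) = (\<lambda>p. (f p + h p)\<^sup>2)"
    by (simp add: fun_eq_iff power2_sum)
  ultimately show ?thesis using assms by (auto simp: square_integrable_def intro:
      borel_measurable_add)
qed

lemma square_integrable_cmult: "square_integrable f \<Longrightarrow> square_integrable (\<lambda>p. c * f p)"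
  
  by (auto simp: square_integrable_def power_mult_distrib intro: borel_measurable_times)

lemma square_integrable_sum:
  assumes "\<And>i. i \<in> I \<Longrightarrow> square_integrable (F i)"
  shows "square_integrable (\<lambda>p. \<Sum>i\<in>I. c i * F i p)"
proof (cases "finite I")
  case True
  then show ?thesis using assms
  proof induction
    case (insert i I)
    then show ?case
      by (simp add: square_integrable_add square_integrable_cmult)
  qed (simp add: square_integrable_def)
qed (simp add: square_integrable_def)

lemma square_integrable_bounded:
  assumes "v \<in> borel_measurable \<mu>" "\<And>p. \<bar>v p\<bar> \<le> C"
  shows "square_integrable v"
proof -
  have "square_integrable (\<lambda>p. v p * 1)"
    by (rule square_integrable_bounded_mult[OF _ assms]) (simp add: square_integrable_def)
  then show ?thesis by simp
qed

lemma square_integrable_integrable: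
  "square_integrable f \<Longrightarrow> integrable \<mu> f"
  using square_integrable_mult[of f "\<lambda>_. 1"] by (simp add: square_integrable_def)

lemma continuous_torus_measurable:
  fixes v :: "R3 \<Rightarrow> real"
  shows "continuous_on UNIV v \<Longrightarrow> v \<in> borel_measurable \<mu>"
  by (intro measurable_torus borel_measurable_continuous_onI)

lemma square_integrable_continuous:
  assumes "torus_fun v" "continuous_on UNIV v"
  shows "square_integrable v"
proof -
  obtain C where "\<And>p. \<bar>v p\<bar> \<le> C" using torus_fun_bounded[OF assms] by blast
  then show ?thesis by (intro square_integrable_bounded continuous_torus_measurable assms(2))
qed

lemma square_integrable_continuous_mult:
  assumes "torus_fun v" "continuous_on UNIV v" "square_integrable f"
  shows "square_integrable (\<lambda>p. v p * f p)"
proof -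
  obtain C where "\<And>p. \<bar>v p\<bar> \<le> C" using torus_fun_bounded[OF assms(1,2)] by blast
  then show ?thesis by (intro square_integrable_bounded_mult continuous_torus_measurable assms)
qed

lemma AE_torus_fst:
  assumes "AE p in \<mu>. P p"
  shows "AE x in \<mu> \<Otimes>\<^sub>M \<mu>. P (fst x)"
proof -
  obtain A where A: "A \<in> null_sets \<mu>" "\<And>p. p \<in> space \<mu> - A \<Longrightarrow> P p"
    using assms by (meson AE_E3)
  then have "A \<times> space \<mu> \<in> null_sets (\<mu> \<Otimes>\<^sub>M \<mu>)"
    by (intro null_setsI) (auto simp: null_sets_def torus.emeasure_pair_measure_Times simp del:
        space_torus_measure)
  then have "AE x in \<mu> \<Otimes>\<^sub>M \<mu>. x \<notin> A \<times> space \<mu>" by (rule AE_not_in)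
  moreover have "AE x in \<mu> \<Otimes>\<^sub>M \<mu>. x \<in> space (\<mu> \<Otimes>\<^sub>M \<mu>)" by simp
  ultimately show ?thesis
  proof eventually_elim
    case (elim x)
    then have "fst x \<in> space \<mu> - A" by (auto simp: space_pair_measure)
    then show ?case by (rule A(2))
  qed
qed

lemma AE_torus_snd:
  assumes "AE p in \<mu>. P p"
  shows "AE x in \<mu> \<Otimes>\<^sub>M \<mu>. P (snd x)"
proof -
  obtain A where A: "A \<in> null_sets \<mu>" "\<And>p. p \<in> space \<mu> - A \<Longrightarrow> P p"
    using assms by (meson AE_E3)
  then have "space \<mu> \<times> A \<in> null_sets (\<mu> \<Otimes>\<^sub>M \<mu>)"
    by (intro null_setsI) (auto simp: null_sets_def torus.emeasure_pair_measure_Times simp del: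
        space_torus_measure)
  then have "AE x in \<mu> \<Otimes>\<^sub>M \<mu>. x \<notin> space \<mu> \<times> A" by (rule AE_not_in)
  moreover have "AE x in \<mu> \<Otimes>\<^sub>M \<mu>. x \<in> space (\<mu> \<Otimes>\<^sub>M \<mu>)" by simp
  ultimately show ?thesis
  proof eventually_elim
    case (elim x)
    then have "snd x \<in> space \<mu> - A" by (auto simp: space_pair_measure)
    then show ?case by (rule A(2))
  qed
qed

lemma product_integral:
  fixes f h :: "R3 \<Rightarrow> real"
  assumes f: "integrable \<mu> f" and h: "integrable \<mu> h"
  shows "integrable (\<mu> \<Otimes>\<^sub>M \<mu>) (\<lambda>x. f (fst x) * h (snd x))"
    and "(\<integral>x. f (fst x) * h (snd x) \<partial>(\<mu> \<Otimes>\<^sub>M \<mu>)) = (\<integral>p. f p \<partial>\<mu>) * (\<integral>s. h s \<partial>\<mu>)"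
proof -
  have m: "f \<in> borel_measurable \<mu>" "h \<in> borel_measurable \<mu>" using f h by auto
  show i: "integrable (\<mu> \<Otimes>\<^sub>M \<mu>) (\<lambda>x. f (fst x) * h (snd x))"
  proof (rule torus2.Fubini_integrable)
    show "(\<lambda>x. f (fst x) * h (snd x)) \<in> borel_measurable (\<mu> \<Otimes>\<^sub>M \<mu>)"
      using m by measurable
    have "(\<integral>y. norm (f (fst (x, y)) * h (snd (x, y))) \<partial>\<mu>) = \<bar>f x\<bar> * (\<integral>y. \<bar>h y\<bar> \<partial>\<mu>)" for x
      by (simp add: abs_mult)
    then show "integrable \<mu> (\<lambda>x. \<integral>y. norm (f (fst (x, y)) * h (snd (x, y))) \<partial>\<mu>)"
      using f by simp
    show "AE x in \<mu>. integrable \<mu> (\<lambda>y. f (fst (x, y)) * h (snd (x, y)))"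
      using h by simp
  qed
  show "(\<integral>x. f (fst x) * h (snd x) \<partial>(\<mu> \<Otimes>\<^sub>M \<mu>)) = (\<integral>p. f p \<partial>\<mu>) * (\<integral>s. h s \<partial>\<mu>)"
    using torus2.integral_fst'[OF i] by (simp add: case_prod_beta)
qed

section \<open>The Schur complement of the operator matrix\<close>

text \<open>
  The function \<open>g\<close> dominates \<open>1 / (w2 (p, s) - e)\<close> for all \<open>e \<le> m\<close>, uniformly in \<open>p\<close>. It is a
  sum of inverse squares of distances, and \<open>N\<close> is the set of its poles.
\<close>

locale symbol =
  fixes w2 :: "R3 \<times> R3 \<Rightarrow> real" and m :: real and g :: "R3 \<Rightarrow> real" and N :: "R3 set"
  assumes w2_torus: "torus_fun2 w2" and w2_sym: "sym_fun w2" and w2_cont: "continuous_on UNIV w2"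
    and g_integrable: "integrable \<mu> g" and N_finite: "finite N" and m_le: "m \<le> w2 x"
    and g_bound: "s \<in> torus_cell - N \<Longrightarrow> w2 (p, s) > m \<and> 1 / (w2 (p, s) - m) \<le> g s"
begin

definition res :: "real \<Rightarrow> R3 \<times> R3 \<Rightarrow> real" where
  "res e x = 1 / (w2 x - e)"

lemma w2_measurable [measurable]: "w2 \<in> borel_measurable borel"
  using w2_cont by (rule borel_measurable_continuous_onI)

lemma res_measurable [measurable]: "res e \<in> borel_measurable (\<mu> \<Otimes>\<^sub>M \<mu>)"
  unfolding res_def[abs_def] by (intro borel_measurable_divide borel_measurable_diff
      measurable_torus2) auto

lemma res_measurable_snd [measurable]: "(\<lambda>s. res e (p, s)) \<in> borel_measurable \<mu>"
proof -
  have "(\<lambda>s. w2 (p, s)) \<in> borel_measurable borel"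
    by (intro borel_measurable_continuous_onI continuous_on_compose2[OF w2_cont]
        continuous_intros) auto
  then show ?thesis unfolding res_def[abs_def]
    by (intro borel_measurable_divide borel_measurable_diff measurable_torus) auto
qed

lemma w2_swap: "w2 (p, q) = w2 (q, p)"
  using w2_sym by (simp add: sym_fun_def)

lemma res_swap: "res e (p, q) = res e (q, p)"
  by (simp add: res_def w2_swap[of p])

lemma res_torus: "torus_fun (\<lambda>p. res e (p, s))"
  using w2_torus by (simp add: res_def torus_fun2_def torus_fun_def)

lemma res_mono: "w2 x > m \<Longrightarrow> e \<le> e' \<Longrightarrow> e' \<le> m \<Longrightarrow> 0 < res e x \<and> res e x \<le> res e' x"
  unfolding res_def by (auto intro!: divide_left_mono mult_pos_pos)

lemma res_strict: "w2 x > m \<Longrightarrow> e < e' \<Longrightarrow> e' \<le> m \<Longrightarrow> res e x < res e' x"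
  unfolding res_def by (auto intro!: divide_strict_left_mono mult_pos_pos)

lemma AE_res_snd:
  assumes "e \<le> m"
  shows "AE s in \<mu>. w2 (p, s) > m \<and> 0 < res e (p, s) \<and> res e (p, s) \<le> g s"
  using AE_torus_finite[OF N_finite] AE_space
proof eventually_elim
  case (elim s)
  then have "w2 (p, s) > m" "res m (p, s) \<le> g s" using g_bound[of s p] by (auto simp: res_def)
  then show ?case using res_mono[of "(p, s)" e m] assms by force
qed

text \<open>
  By the symmetry of \<open>w2\<close> the same function bounds the resolvent in either variable, so the
  resolvent is at most \<open>sqrt (g p) * sqrt (g s)\<close>, a product of square integrable functions.
\<close>

lemma AE_res:
  assumes "e \<le> m"
  shows "AE x in \<mu> \<Otimes>\<^sub>M \<mu>. w2 x > m \<and> 0 < res e x \<and> res e x \<le> g (fst x) \<and> res e x \<le> g (snd x)"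
proof -
  have "AE s in \<mu>. \<forall>p. w2 (p, s) > m \<and> 0 < res e (p, s) \<and> res e (p, s) \<le> g s"
    using AE_torus_finite[OF N_finite] AE_space
  proof eventually_elim
    case (elim s)
    show ?case
    proof
      fix p
      have "w2 (p, s) > m" "res m (p, s) \<le> g s" using g_bound[of s p] elim by (auto simp: res_def)
      then show "w2 (p, s) > m \<and> 0 < res e (p, s) \<and> res e (p, s) \<le> g s"
        using res_mono[of "(p, s)" e m] assms by force
    qed
  qed
  from AE_torus_fst[OF this] AE_torus_snd[OF this] show ?thesis
  proof eventually_elim
    case (elim x)
    from elim(1)[rule_format, of "snd x"] elim(2)[rule_format, of "fst x"] show ?case
      using res_swap[of e "fst x" "snd x"] by simp
  qed
qed

lemma res_integrable_fst:
  assumes e: "e \<le> m" and u: "integrable \<mu> u"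
  shows "integrable (\<mu> \<Otimes>\<^sub>M \<mu>) (\<lambda>x. res e x * u (fst x))"
proof (rule Bochner_Integration.integrable_bound)
  show "integrable (\<mu> \<Otimes>\<^sub>M \<mu>) (\<lambda>x. \<bar>u (fst x)\<bar> * g (snd x))"
    using product_integral(1)[of "\<lambda>p. \<bar>u p\<bar>" g] u g_integrable by simp
  have [measurable]: "u \<in> borel_measurable \<mu>" using u by simp
  show "(\<lambda>x. res e x * u (fst x)) \<in> borel_measurable (\<mu> \<Otimes>\<^sub>M \<mu>)" by measurable
  show "AE x in \<mu> \<Otimes>\<^sub>M \<mu>. norm (res e x * u (fst x)) \<le> norm (\<bar>u (fst x)\<bar> * g (snd x))"
    using AE_res[OF e]
  proof eventually_elim
    case (elim x)
    then have "\<bar>u (fst x)\<bar> * res e x \<le> \<bar>u (fst x)\<bar> * g (snd x)" by (intro mult_left_mono) auto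
    then show ?case using elim by (simp add: abs_mult mult.commute)
  qed
qed

lemma swap_integrable:
  fixes F :: "R3 \<times> R3 \<Rightarrow> real"
  assumes "integrable (\<mu> \<Otimes>\<^sub>M \<mu>) F"
  shows "integrable (\<mu> \<Otimes>\<^sub>M \<mu>) (\<lambda>x. F (snd x, fst x))"
  using torus2.integrable_product_swap[OF assms] by (simp add: case_prod_unfold)

lemma swap_integral:
  fixes F :: "R3 \<times> R3 \<Rightarrow> real"
  assumes "F \<in> borel_measurable (\<mu> \<Otimes>\<^sub>M \<mu>)"
  shows "(\<integral>x. F (snd x, fst x) \<partial>(\<mu> \<Otimes>\<^sub>M \<mu>)) = (\<integral>x. F x \<partial>(\<mu> \<Otimes>\<^sub>M \<mu>))"
  using torus2.integral_product_swap[OF assms] by (simp add: case_prod_unfold)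

lemma res_swap': "res e (snd x, fst x) = res e x"
  using res_swap[of e "fst x" "snd x"] by simp

lemma res_integrable_snd:
  assumes e: "e \<le> m" and u: "integrable \<mu> u"
  shows "integrable (\<mu> \<Otimes>\<^sub>M \<mu>) (\<lambda>x. res e x * u (snd x))"
  using swap_integrable[OF res_integrable_fst[OF assms]] by (simp add: res_swap')

lemma res_integrable:
  assumes e: "e \<le> m" and f: "square_integrable f" and h: "square_integrable h"
  shows "integrable (\<mu> \<Otimes>\<^sub>M \<mu>) (\<lambda>x. res e x * (f (fst x) * h (snd x)))"
proof (rule Bochner_Integration.integrable_bound)
  have [measurable]: "f \<in> borel_measurable \<mu>" "h \<in> borel_measurable \<mu>"
    using f h by (auto simp: square_integrable_def)
  \<comment> \<open>Each square is paired with the bound on the resolvent in the other variable.\<close>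
  show "integrable (\<mu> \<Otimes>\<^sub>M \<mu>) (\<lambda>x. res e x * (f (fst x))\<^sup>2 + res e x * (h (snd x))\<^sup>2)"
    using f h by (intro Bochner_Integration.integrable_add
        res_integrable_fst[OF e, of "\<lambda>p. (f p)\<^sup>2"] res_integrable_snd[OF e, of "\<lambda>p. (h p)\<^sup>2"]) (auto
            simp: square_integrable_def)
  show "(\<lambda>x. res e x * (f (fst x) * h (snd x))) \<in> borel_measurable (\<mu> \<Otimes>\<^sub>M \<mu>)" by measurable
  show "AE x in \<mu> \<Otimes>\<^sub>M \<mu>. norm (res e x * (f (fst x) * h (snd x))) \<le> norm (res e x * (f (fst x))\<^sup>2
      + res e x * (h (snd x))\<^sup>2)"
    using AE_res[OF e]
  proof eventually_elim
    case (elim x)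
    then have "res e x * \<bar>f (fst x) * h (snd x)\<bar> \<le> res e x * ((f (fst x))\<^sup>2 + (h (snd x))\<^sup>2)"
      by (intro mult_left_mono abs_mult_le_squares) auto
    then show ?case using elim by (simp add: abs_mult distrib_left)
  qed
qed

end

text \<open>
  The parameters cover two Schur complements at once. Eliminating the two-particle component of
  \<open>H - e\<close> when \<open>v2 = 0\<close> gives \<open>a = w1\<close>, \<open>v = v1\<close>, \<open>\<tau> = 1\<close>, \<open>\<kappa> = 1 / 2\<close>. When \<open>v1 = 0\<close>, the
  function \<open>\<lambda>p. \<integral>s. v2 s * f2 (p, s)\<close> satisfies a homogeneous equation of the same form with
  \<open>a = 1\<close>, \<open>v = v2\<close>, \<open>\<tau> = 0\<close>, \<open>\<kappa> = 1\<close>; the scalar component is then decoupled and adds its square to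
  the quadratic form.
\<close>

locale pencil = symbol +
  fixes a v v0 :: "R3 \<Rightarrow> real" and w0 \<tau> \<kappa> :: real
  assumes a_torus: "torus_fun a" and a_cont: "continuous_on UNIV a"
    and v_torus: "torus_fun v" and v_cont: "continuous_on UNIV v"
    and v0_torus: "torus_fun v0" and v0_cont: "continuous_on UNIV v0"
    and \<kappa>_pos: "\<kappa> > 0"
    and \<tau>_cases: "\<tau> = 1 \<or> \<tau> = 0 \<and> a = (\<lambda>_. 1) \<and> v0 = (\<lambda>_. 0) \<and> w0 = 1"
begin

text \<open>
  \<open>D\<close> is \<open>Delta1\<close> or \<open>Delta2\<close>, the multiplication part of the Schur complement, and \<open>kern\<close> is its
  integral part. Up to sign and factor, \<open>res e x * X f x\<close> is the two-particle function that belongs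
  to \<open>f\<close>.
\<close>

definition D :: "R3 \<Rightarrow> real \<Rightarrow> real" where
  "D p e = a p - \<tau> * e - \<kappa> * (\<integral>s. (v s)\<^sup>2 / (w2 (p, s) - e) \<partial>\<mu>)"

definition X :: "(R3 \<Rightarrow> real) \<Rightarrow> R3 \<times> R3 \<Rightarrow> real" where
  "X f x = v (snd x) * f (fst x) + v (fst x) * f (snd x)"

definition kern :: "real \<Rightarrow> (R3 \<Rightarrow> real) \<Rightarrow> (R3 \<Rightarrow> real) \<Rightarrow> real" where
  "kern e f h = (\<integral>x. res e x * ((v (fst x) * f (fst x)) * (v (snd x) * h (snd x))) \<partial>(\<mu> \<Otimes>\<^sub>M \<mu>))"

definition B :: "real \<Rightarrow> real \<Rightarrow> (R3 \<Rightarrow> real) \<Rightarrow> real \<Rightarrow> (R3 \<Rightarrow> real) \<Rightarrow> real" where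
  "B e x f y h = (w0 - \<tau> * e) * x * y + x * (\<integral>p. v0 p * h p \<partial>\<mu>) + y * (\<integral>p. v0 p * f p \<partial>\<mu>)
    + (\<integral>p. D p e * f p * h p \<partial>\<mu>) - \<kappa> * kern e f h"

lemma \<tau>_nonneg: "\<tau> \<ge> 0"
  using \<tau>_cases by auto

lemma v_measurable [measurable]: "v \<in> borel_measurable \<mu>"
  by (rule continuous_torus_measurable[OF v_cont])

lemma v_square: "square_integrable v"
  by (rule square_integrable_continuous[OF v_torus v_cont])

lemma v_mult: "square_integrable f \<Longrightarrow> square_integrable (\<lambda>p. v p * f p)"
  by (rule square_integrable_continuous_mult[OF v_torus v_cont])

lemma D_res: "D p e = a p - \<tau> * e - \<kappa> * (\<integral>s. res e (p, s) * (v s)\<^sup>2 \<partial>\<mu>)"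
  by (simp add: D_def res_def)

lemma D_torus: "torus_fun (\<lambda>p. D p e)"
  using a_torus res_torus unfolding D_res torus_fun_def by simp

lemma v2_res_integrable:
  assumes "e \<le> m"
  shows "integrable \<mu> (\<lambda>s. res e (p, s) * (v s)\<^sup>2)"
proof -
  obtain C where C: "\<And>p. \<bar>v p\<bar> \<le> C" using torus_fun_bounded[OF v_torus v_cont] by blast
  have C2: "(v p)\<^sup>2 \<le> C\<^sup>2" for p using C[of p] by (simp add: abs_le_square_iff[symmetric] abs_le_iff)
  show ?thesis
  proof (rule Bochner_Integration.integrable_bound)
    show "integrable \<mu> (\<lambda>s. g s * C\<^sup>2)" using g_integrable by simp
    show "AE s in \<mu>. norm (res e (p, s) * (v s)\<^sup>2) \<le> norm (g s * C\<^sup>2)"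
      using AE_res_snd[OF assms, of p] by eventually_elim (auto simp: abs_mult intro!: mult_mono C2)
  qed measurable
qed

text \<open>
  The bound \<open>g\<close> on the resolvent is uniform in the first variable and in \<open>e \<le> m\<close>, so dominated
  convergence gives joint continuity up to the threshold \<open>e = m\<close>.
\<close>

lemma D_cont: "continuous_on (UNIV \<times> {..m}) (\<lambda>x. D (fst x) (snd x))"
proof -
  obtain C where C: "\<And>p. \<bar>v p\<bar> \<le> C" using torus_fun_bounded[OF v_torus v_cont] by blast
  have C2: "(v p)\<^sup>2 \<le> C\<^sup>2" for p using C[of p] by (simp add: abs_le_square_iff[symmetric] abs_le_iff)
  have "continuous_on (UNIV \<times> {..m}) (\<lambda>x. \<integral>s. res (snd x) (fst x, s) * (v s)\<^sup>2 \<partial>\<mu>)"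
    unfolding continuous_on_sequentially
  proof (intro ballI allI impI)
    fix x :: "nat \<Rightarrow> R3 \<times> real" and y
    assume y: "y \<in> UNIV \<times> {..m}" and *: "(\<forall>n. x n \<in> UNIV \<times> {..m}) \<and> x \<longlonglongrightarrow> y"
    then have lim: "(\<lambda>n. fst (x n)) \<longlonglongrightarrow> fst y" "(\<lambda>n. snd (x n)) \<longlonglongrightarrow> snd y"
      by (auto intro: tendsto_intros)
    have le: "snd (x n) \<le> m" for n using * by (metis SigmaE atMost_iff snd_conv)
    have "(\<lambda>n. \<integral>s. res (snd (x n)) (fst (x n), s) * (v s)\<^sup>2 \<partial>\<mu>) \<longlonglongrightarrow> (\<integral>s. res (snd y) (fst y, s) * (v
        s)\<^sup>2 \<partial>\<mu>)"
    proof (rule integral_dominated_convergence)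
      show "integrable \<mu> (\<lambda>s. g s * C\<^sup>2)" using g_integrable by simp
      show "AE s in \<mu>. norm (res (snd (x n)) (fst (x n), s) * (v s)\<^sup>2) \<le> g s * C\<^sup>2" for n
        using AE_res_snd[OF le, of "fst (x n)" n] by eventually_elim (auto simp: abs_mult intro!:
            mult_mono C2)
      show "AE s in \<mu>. (\<lambda>n. res (snd (x n)) (fst (x n), s) * (v s)\<^sup>2) \<longlonglongrightarrow> res (snd y) (fst y, s) * (v
          s)\<^sup>2"
        using AE_res_snd[OF order_refl, of "fst y"]
      proof eventually_elim
        case (elim s)
        have "(\<lambda>n. w2 (fst (x n), s)) \<longlonglongrightarrow> w2 (fst y, s)"
          by (rule continuous_on_tendsto_compose[OF w2_cont]) (auto intro!: tendsto_intros lim)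
        then show ?case unfolding res_def
          using elim y by (intro tendsto_intros lim) auto
      qed
    qed measurable
    then show "((\<lambda>x. \<integral>s. res (snd x) (fst x, s) * (v s)\<^sup>2 \<partial>\<mu>) \<circ> x) \<longlonglongrightarrow> (\<integral>s. res (snd y) (fst y, s) *
        (v s)\<^sup>2 \<partial>\<mu>)"
      by (simp add: comp_def)
  qed
  then show ?thesis unfolding D_res
    by (intro continuous_intros continuous_on_compose2[OF a_cont]) auto
qed

lemma D_cont_fst: "e \<le> m \<Longrightarrow> continuous_on UNIV (\<lambda>p. D p e)"
  by (rule continuous_on_compose2[OF D_cont, of UNIV "\<lambda>p. (p, e)", simplified])
    (auto intro: continuous_intros)

lemma D_antimono: "e \<le> e' \<Longrightarrow> e' \<le> m \<Longrightarrow> D p e' \<le> D p e"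
proof -
  assume e: "e \<le> e'" "e' \<le> m"
  have "(\<integral>s. res e (p, s) * (v s)\<^sup>2 \<partial>\<mu>) \<le> (\<integral>s. res e' (p, s) * (v s)\<^sup>2 \<partial>\<mu>)"
  proof (rule integral_mono_AE)
    show "AE s in \<mu>. res e (p, s) * (v s)\<^sup>2 \<le> res e' (p, s) * (v s)\<^sup>2"
      using AE_res_snd[OF order_refl, of p]
      by eventually_elim (use res_mono e in \<open>auto intro!: mult_right_mono\<close>)
  qed (use v2_res_integrable e in auto)
  then have "\<kappa> * (\<integral>s. res e (p, s) * (v s)\<^sup>2 \<partial>\<mu>) \<le> \<kappa> * (\<integral>s. res e' (p, s) * (v s)\<^sup>2 \<partial>\<mu>)"
    using \<kappa>_pos by (intro mult_left_mono) auto
  moreover have "\<tau> * e \<le> \<tau> * e'" using e \<tau>_nonneg by (intro mult_left_mono) auto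
  ultimately show ?thesis unfolding D_res by linarith
qed

lemma D_mult: "e \<le> m \<Longrightarrow> square_integrable f \<Longrightarrow> square_integrable (\<lambda>p. D p e * f p)"
  by (rule square_integrable_continuous_mult[OF D_torus D_cont_fst])

lemma D_integrable:
  assumes "e \<le> m" "square_integrable f" "square_integrable h"
  shows "integrable \<mu> (\<lambda>p. D p e * f p * h p)"
  by (rule square_integrable_mult[OF D_mult[OF assms(1,2)] assms(3)])

lemma v0_integrable: "square_integrable f \<Longrightarrow> integrable \<mu> (\<lambda>p. v0 p * f p)"
  by (rule square_integrable_mult[OF square_integrable_continuous[OF v0_torus v0_cont]])

lemma kern_integrable:
  assumes "e \<le> m" "square_integrable f" "square_integrable h"
  shows "integrable (\<mu> \<Otimes>\<^sub>M \<mu>) (\<lambda>x. res e x * ((v (fst x) * f (fst x)) * (v (snd x) * h (snd x))))"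
  by (rule res_integrable[OF assms(1) v_mult[OF assms(2)] v_mult[OF assms(3)]])

lemma kern_commute:
  assumes "square_integrable f" "square_integrable h"
  shows "kern e f h = kern e h f"
proof -
  have [measurable]: "f \<in> borel_measurable \<mu>" "h \<in> borel_measurable \<mu>"
    using assms by (auto simp: square_integrable_def)
  have "(\<lambda>x. res e x * ((v (fst x) * f (fst x)) * (v (snd x) * h (snd x)))) \<in> borel_measurable (\<mu>
      \<Otimes>\<^sub>M \<mu>)"
    by measurable
  from swap_integral[OF this] show ?thesis
    unfolding kern_def by (simp add: res_swap' mult.commute)
qed

lemma B_commute:
  assumes "square_integrable f" "square_integrable h"
  shows "B e x f y h = B e y h x f"
  unfolding B_def kern_commute[OF assms] by (simp add: ac_simps)

lemma B_sum_right:
  assumes e: "e \<le> m" and f: "square_integrable f" and F: "\<And>i. i \<in> S \<Longrightarrow> square_integrable (F i)"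
  shows "B e x f (\<Sum>i\<in>S. c i * Y i) (\<lambda>p. \<Sum>i\<in>S. c i * F i p) = (\<Sum>i\<in>S. c i * B e x f (Y i) (F i))"
proof -
  have 1: "(\<integral>p. v0 p * (\<Sum>i\<in>S. c i * F i p) \<partial>\<mu>) = (\<Sum>i\<in>S. c i * (\<integral>p. v0 p * F i p \<partial>\<mu>))"
  proof -
    have "(\<integral>p. v0 p * (\<Sum>i\<in>S. c i * F i p) \<partial>\<mu>) = (\<integral>p. (\<Sum>i\<in>S. c i * (v0 p * F i p)) \<partial>\<mu>)"
      by (simp add: sum_distrib_left ac_simps)
    also have "\<dots> = (\<Sum>i\<in>S. c i * (\<integral>p. v0 p * F i p \<partial>\<mu>))"
      using v0_integrable[OF F] by (subst Bochner_Integration.integral_sum) auto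
    finally show ?thesis .
  qed
  have 2: "(\<integral>p. D p e * f p * (\<Sum>i\<in>S. c i * F i p) \<partial>\<mu>) = (\<Sum>i\<in>S. c i * (\<integral>p. D p e * f p * F i p \<partial>\<mu>))"
  proof -
    have "(\<integral>p. D p e * f p * (\<Sum>i\<in>S. c i * F i p) \<partial>\<mu>) = (\<integral>p. (\<Sum>i\<in>S. c i * (D p e * f p * F i p)) \<partial>\<mu>)"
      by (simp add: sum_distrib_left ac_simps)
    also have "\<dots> = (\<Sum>i\<in>S. c i * (\<integral>p. D p e * f p * F i p \<partial>\<mu>))"
      using D_integrable[OF e f F] by (subst Bochner_Integration.integral_sum) auto
    finally show ?thesis .
  qed
  have 3: "kern e f (\<lambda>p. \<Sum>i\<in>S. c i * F i p) = (\<Sum>i\<in>S. c i * kern e f (F i))"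
  proof -
    have "kern e f (\<lambda>p. \<Sum>i\<in>S. c i * F i p) =
        (\<integral>x. (\<Sum>i\<in>S. c i * (res e x * ((v (fst x) * f (fst x)) * (v (snd x) * F i (snd x))))) \<partial>(\<mu>
            \<Otimes>\<^sub>M \<mu>))"
      unfolding kern_def by (simp add: sum_distrib_left ac_simps)
    also have "\<dots> = (\<Sum>i\<in>S. c i * kern e f (F i))"
      unfolding kern_def using kern_integrable[OF e f F]
          by (subst Bochner_Integration.integral_sum) auto
    finally show ?thesis .
  qed
  show ?thesis unfolding B_def 1 2 3
    by (simp add: sum_distrib_left sum_distrib_right distrib_left right_diff_distrib sum.distrib
        sum_subtractf ac_simps)
qed

lemma B_sum:
  assumes e: "e \<le> m" and F: "\<And>i. i \<in> S \<Longrightarrow> square_integrable (F i)"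
  shows "B e (\<Sum>i\<in>S. c i * Y i) (\<lambda>p. \<Sum>i\<in>S. c i * F i p) (\<Sum>i\<in>S. c i * Y i) (\<lambda>p. \<Sum>i\<in>S. c i * F i p) =
    (\<Sum>i\<in>S. \<Sum>j\<in>S. c i * c j * B e (Y i) (F i) (Y j) (F j))" (is "B e ?x ?f ?x ?f = _")
proof -
  have f: "square_integrable ?f" by (rule square_integrable_sum[OF F])
  have "B e ?x ?f ?x ?f = (\<Sum>i\<in>S. c i * B e ?x ?f (Y i) (F i))"
    by (rule B_sum_right[OF e f F])
  also have "\<dots> = (\<Sum>i\<in>S. c i * (\<Sum>j\<in>S. c j * B e (Y i) (F i) (Y j) (F j)))"
  proof (intro sum.cong refl)
    fix i assume i: "i \<in> S"
    have "B e ?x ?f (Y i) (F i) = B e (Y i) (F i) ?x ?f" by (rule B_commute[OF f F[OF i]])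
    also have "\<dots> = (\<Sum>j\<in>S. c j * B e (Y i) (F i) (Y j) (F j))" by (rule B_sum_right[OF e F[OF i] F])
    finally show "c i * B e ?x ?f (Y i) (F i) = c i * (\<Sum>j\<in>S. c j * B e (Y i) (F i) (Y j) (F j))"
        by simp
  qed
  finally show ?thesis by (simp add: sum_distrib_left ac_simps)
qed

lemma X_square_integrable:
  assumes e: "e \<le> m" and f: "square_integrable f"
  shows "integrable (\<mu> \<Otimes>\<^sub>M \<mu>) (\<lambda>x. res e x * (X f x)\<^sup>2)"
    and "(\<integral>x. res e x * (X f x)\<^sup>2 \<partial>(\<mu> \<Otimes>\<^sub>M \<mu>)) =
      2 * (\<integral>p. (f p)\<^sup>2 * (\<integral>s. res e (p, s) * (v s)\<^sup>2 \<partial>\<mu>) \<partial>\<mu>) + 2 * kern e f f"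
    and "integrable \<mu> (\<lambda>p. (f p)\<^sup>2 * (\<integral>s. res e (p, s) * (v s)\<^sup>2 \<partial>\<mu>))"
proof -
  have [measurable]: "f \<in> borel_measurable \<mu>" using f by (auto simp: square_integrable_def)
  obtain C where C: "\<And>p. \<bar>v p\<bar> \<le> C" using torus_fun_bounded[OF v_torus v_cont] by blast
  have C2: "(v p)\<^sup>2 \<le> C\<^sup>2" for p using C[of p] by (simp add: abs_le_square_iff[symmetric] abs_le_iff)
  let ?F = "\<lambda>x. res e x * ((f (fst x))\<^sup>2 * (v (snd x))\<^sup>2)"
  let ?K = "\<lambda>x. res e x * ((v (fst x) * f (fst x)) * (v (snd x) * f (snd x)))"
  have iF: "integrable (\<mu> \<Otimes>\<^sub>M \<mu>) ?F"
  proof (rule Bochner_Integration.integrable_bound)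
    show "integrable (\<mu> \<Otimes>\<^sub>M \<mu>) (\<lambda>x. C\<^sup>2 * (res e x * (f (fst x))\<^sup>2))"
      using res_integrable_fst[OF e, of "\<lambda>p. (f p)\<^sup>2"] f by (simp add: square_integrable_def)
    show "AE x in \<mu> \<Otimes>\<^sub>M \<mu>. norm (?F x) \<le> norm (C\<^sup>2 * (res e x * (f (fst x))\<^sup>2))"
      using AE_res[OF e]
    proof eventually_elim
      case (elim x)
      then have "res e x * (f (fst x))\<^sup>2 * (v (snd x))\<^sup>2 \<le> res e x * (f (fst x))\<^sup>2 * C\<^sup>2"
        by (intro mult_left_mono C2) auto
      then show ?case using elim by (simp add: abs_mult ac_simps)
    qed
  qed measurable
  have iF': "integrable (\<mu> \<Otimes>\<^sub>M \<mu>) (\<lambda>x. res e x * ((f (snd x))\<^sup>2 * (v (fst x))\<^sup>2))"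
    using swap_integrable[OF iF] by (simp add: res_swap')
  have iK: "integrable (\<mu> \<Otimes>\<^sub>M \<mu>) ?K" by (rule kern_integrable[OF e f f])
  have eq: "res e x * (X f x)\<^sup>2 = ?F x + res e x * ((f (snd x))\<^sup>2 * (v (fst x))\<^sup>2) + 2 * ?K x" for x
    by (simp add: X_def power2_eq_square algebra_simps)
  show "integrable (\<mu> \<Otimes>\<^sub>M \<mu>) (\<lambda>x. res e x * (X f x)\<^sup>2)"
    unfolding eq by (intro Bochner_Integration.integrable_add integrable_mult_right iF iF' iK)
  have F_eq: "(\<integral>s. ?F (p, s) \<partial>\<mu>) = (f p)\<^sup>2 * (\<integral>s. res e (p, s) * (v s)\<^sup>2 \<partial>\<mu>)" for p
  proof -
    have "(\<integral>s. ?F (p, s) \<partial>\<mu>) = (\<integral>s. (f p)\<^sup>2 * (res e (p, s) * (v s)\<^sup>2) \<partial>\<mu>)"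
      by (intro Bochner_Integration.integral_cong) auto
    then show ?thesis by simp
  qed
  have intF: "(\<integral>x. ?F x \<partial>(\<mu> \<Otimes>\<^sub>M \<mu>)) = (\<integral>p. (f p)\<^sup>2 * (\<integral>s. res e (p, s) * (v s)\<^sup>2 \<partial>\<mu>) \<partial>\<mu>)"
    using torus2.integral_fst'[OF iF] unfolding F_eq by simp
  show "integrable \<mu> (\<lambda>p. (f p)\<^sup>2 * (\<integral>s. res e (p, s) * (v s)\<^sup>2 \<partial>\<mu>))"
    using torus2.integrable_fst'[OF iF] unfolding F_eq by simp
  have intF': "(\<integral>x. res e x * ((f (snd x))\<^sup>2 * (v (fst x))\<^sup>2) \<partial>(\<mu> \<Otimes>\<^sub>M \<mu>)) = (\<integral>x. ?F x \<partial>(\<mu> \<Otimes>\<^sub>M \<mu>))"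
    using swap_integral[of ?F] iF by (simp add: res_swap')
  have "(\<integral>x. res e x * (X f x)\<^sup>2 \<partial>(\<mu> \<Otimes>\<^sub>M \<mu>)) = (\<integral>x. ?F x \<partial>(\<mu> \<Otimes>\<^sub>M \<mu>)) +
      (\<integral>x. res e x * ((f (snd x))\<^sup>2 * (v (fst x))\<^sup>2) \<partial>(\<mu> \<Otimes>\<^sub>M \<mu>)) + 2 * (\<integral>x. ?K x \<partial>(\<mu> \<Otimes>\<^sub>M \<mu>))"
    unfolding eq using iF iF' iK by simp
  then show "(\<integral>x. res e x * (X f x)\<^sup>2 \<partial>(\<mu> \<Otimes>\<^sub>M \<mu>)) =
      2 * (\<integral>p. (f p)\<^sup>2 * (\<integral>s. res e (p, s) * (v s)\<^sup>2 \<partial>\<mu>) \<partial>\<mu>) + 2 * kern e f f"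
    unfolding intF' intF kern_def by simp
qed

text \<open>Written with \<open>X f\<close>, the quadratic form depends on \<open>e\<close> monotonically term by term.\<close>

lemma B_quadratic:
  assumes e: "e \<le> m" and f: "square_integrable f"
  shows "B e x f x f = w0 * x\<^sup>2 + 2 * x * (\<integral>p. v0 p * f p \<partial>\<mu>) + (\<integral>p. a p * (f p)\<^sup>2 \<partial>\<mu>)
    - \<tau> * e * (x\<^sup>2 + (\<integral>p. (f p)\<^sup>2 \<partial>\<mu>)) - \<kappa> / 2 * (\<integral>x. res e x * (X f x)\<^sup>2 \<partial>(\<mu> \<Otimes>\<^sub>M \<mu>))"
proof -
  have ia: "integrable \<mu> (\<lambda>p. a p * (f p)\<^sup>2)"
    using square_integrable_mult[OF square_integrable_continuous_mult[OF a_torus a_cont f] f]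
    by (simp add: power2_eq_square mult.assoc)
  have if2: "integrable \<mu> (\<lambda>p. (f p)\<^sup>2)" using f by (simp add: square_integrable_def)
  have "(\<integral>p. D p e * f p * f p \<partial>\<mu>) = (\<integral>p. a p * (f p)\<^sup>2 - \<tau> * e * (f p)\<^sup>2 - \<kappa> * ((f p)\<^sup>2 * (\<integral>s. res e
      (p, s) * (v s)\<^sup>2 \<partial>\<mu>)) \<partial>\<mu>)"
    unfolding D_res by (intro Bochner_Integration.integral_cong) (auto simp: power2_eq_square
        algebra_simps)
  also have "\<dots> = (\<integral>p. a p * (f p)\<^sup>2 \<partial>\<mu>) - \<tau> * e * (\<integral>p. (f p)\<^sup>2 \<partial>\<mu>) - \<kappa> * (\<integral>p. (f p)\<^sup>2 * (\<integral>s. res e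
      (p, s) * (v s)\<^sup>2 \<partial>\<mu>) \<partial>\<mu>)"
    using ia if2 X_square_integrable(3)[OF assms] by simp
  finally show ?thesis
    unfolding B_def X_square_integrable(2)[OF assms] by (simp add: power2_eq_square algebra_simps)
qed

lemma B_antimono:
  assumes e: "e \<le> e'" "e' \<le> m" and f: "square_integrable f"
  shows "B e' x f x f \<le> B e x f x f"
proof -
  have em: "e \<le> m" using e by simp
  have "(\<integral>x. res e x * (X f x)\<^sup>2 \<partial>(\<mu> \<Otimes>\<^sub>M \<mu>)) \<le> (\<integral>x. res e' x * (X f x)\<^sup>2 \<partial>(\<mu> \<Otimes>\<^sub>M \<mu>))"
  proof (rule integral_mono_AE)
    show "AE x in \<mu> \<Otimes>\<^sub>M \<mu>. res e x * (X f x)\<^sup>2 \<le> res e' x * (X f x)\<^sup>2"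
      using AE_res[OF order_refl] by eventually_elim (use res_mono e in \<open>auto intro!:
          mult_right_mono\<close>)
  qed (use X_square_integrable(1) f e em in auto)
  then have "\<kappa> / 2 * (\<integral>x. res e x * (X f x)\<^sup>2 \<partial>(\<mu> \<Otimes>\<^sub>M \<mu>))
      \<le> \<kappa> / 2 * (\<integral>x. res e' x * (X f x)\<^sup>2 \<partial>(\<mu> \<Otimes>\<^sub>M \<mu>))"
    using \<kappa>_pos by (intro mult_left_mono) auto
  moreover have "\<tau> * e * (x\<^sup>2 + (\<integral>p. (f p)\<^sup>2 \<partial>\<mu>)) \<le> \<tau> * e' * (x\<^sup>2 + (\<integral>p. (f p)\<^sup>2 \<partial>\<mu>))"
    using e \<tau>_nonneg by (intro mult_right_mono mult_left_mono add_nonneg_nonneg) auto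
  ultimately show ?thesis
    unfolding B_quadratic[OF em f] B_quadratic[OF e(2) f] by linarith
qed

text \<open>
  Strict decrease can fail only when \<open>\<tau> = 0\<close> and \<open>X f = 0\<close>, and then the form is positive for all
  \<open>e\<close>; hence its sign change is strict in every case.
\<close>

lemma B_strict:
  assumes e: "e < e'" "e' \<le> m" and f: "square_integrable f"
    and nonnull: "x \<noteq> 0 \<or> \<not> (AE p in \<mu>. f p = 0)" and le: "B e x f x f \<le> 0"
  shows "B e' x f x f < 0"
proof (rule ccontr)
  assume "\<not> B e' x f x f < 0"
  have em: "e \<le> m" using e by simp
  let ?I = "\<lambda>e. \<integral>x. res e x * (X f x)\<^sup>2 \<partial>(\<mu> \<Otimes>\<^sub>M \<mu>)"
  let ?n = "x\<^sup>2 + (\<integral>p. (f p)\<^sup>2 \<partial>\<mu>)"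
  have f2: "integrable \<mu> (\<lambda>p. (f p)\<^sup>2)" using f by (simp add: square_integrable_def)
  have n_pos: "?n > 0"
  proof -
    have iff: "(\<integral>p. (f p)\<^sup>2 \<partial>\<mu>) = 0 \<longleftrightarrow> (AE p in \<mu>. (f p)\<^sup>2 = 0)"
      by (rule integral_nonneg_eq_0_iff_AE) (use f2 in auto)
    have ge: "0 \<le> (\<integral>p. (f p)\<^sup>2 \<partial>\<mu>)" by simp
    show ?thesis
    proof (cases "x = 0")
      case True
      then have "(\<integral>p. (f p)\<^sup>2 \<partial>\<mu>) \<noteq> 0" using nonnull unfolding iff by simp
      then show ?thesis using ge True by (simp only: less_le) simp
    next
      case False
      then have "x\<^sup>2 > 0" by simp
      then show ?thesis using ge by linarith
    qed
  qed
  have i: "integrable (\<mu> \<Otimes>\<^sub>M \<mu>) (\<lambda>x. res e x * (X f x)\<^sup>2)" "integrable (\<mu> \<Otimes>\<^sub>M \<mu>) (\<lambda>x. res e' x * (X f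
      x)\<^sup>2)"
    using X_square_integrable(1) f em e by auto
  have nn: "AE x in \<mu> \<Otimes>\<^sub>M \<mu>. 0 \<le> res e' x * (X f x)\<^sup>2 - res e x * (X f x)\<^sup>2"
    using AE_res[OF order_refl] by eventually_elim (use res_mono e in \<open>auto intro!:
        mult_right_mono\<close>)
  have "?I e' - ?I e = (\<integral>x. res e' x * (X f x)\<^sup>2 - res e x * (X f x)\<^sup>2 \<partial>(\<mu> \<Otimes>\<^sub>M \<mu>))"
    using i by simp
  also have "\<dots> \<ge> 0" by (rule integral_nonneg_AE[OF nn])
  finally have d1: "?I e' - ?I e \<ge> 0" .
  have "B e x f x f - B e' x f x f = \<tau> * (e' - e) * ?n + \<kappa> / 2 * (?I e' - ?I e)"
    unfolding B_quadratic[OF em f] B_quadratic[OF e(2) f] by (simp add: algebra_simps)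
  moreover have d2: "\<tau> * (e' - e) * ?n \<ge> 0" using \<tau>_nonneg e n_pos by simp
  moreover have "\<kappa> / 2 * (?I e' - ?I e) \<ge> 0" using d1 \<kappa>_pos by simp
  ultimately have z: "\<tau> * (e' - e) * ?n = 0" "\<kappa> / 2 * (?I e' - ?I e) = 0"
    using le \<open>\<not> B e' x f x f < 0\<close> by linarith+
  have \<tau>: "\<tau> = 0" using z(1) e n_pos by simp
  then have triv: "a = (\<lambda>_. 1)" "v0 = (\<lambda>_. 0)" "w0 = 1" using \<tau>_cases by auto
  have "(\<integral>x. res e' x * (X f x)\<^sup>2 - res e x * (X f x)\<^sup>2 \<partial>(\<mu> \<Otimes>\<^sub>M \<mu>)) = 0"
    using z(2) \<kappa>_pos i by simp
  then have "AE x in \<mu> \<Otimes>\<^sub>M \<mu>. res e' x * (X f x)\<^sup>2 - res e x * (X f x)\<^sup>2 = 0"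
    using integral_nonneg_eq_0_iff_AE[OF _ nn] i by simp
  then have "AE x in \<mu> \<Otimes>\<^sub>M \<mu>. res e x * (X f x)\<^sup>2 = 0"
    using AE_res[OF order_refl]
  proof eventually_elim
    case (elim x)
    then have "(res e' x - res e x) * (X f x)\<^sup>2 = 0" by (simp add: left_diff_distrib)
    moreover have "res e x < res e' x" using elim e by (intro res_strict) auto
    ultimately show ?case by simp
  qed
  then have "?I e = 0" by (rule integral_eq_zero_AE)
  then have "B e x f x f = ?n" by (subst B_quadratic[OF em f]) (simp add: triv \<tau>)
  then show False using le n_pos by simp
qed

text \<open>
  The last two conditions are the two lines of the equation whose bilinear form is \<open>B e\<close>.
\<close>

definition kernel_pair :: "real \<Rightarrow> real \<Rightarrow> (R3 \<Rightarrow> real) \<Rightarrow> bool" where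
  "kernel_pair e x f \<longleftrightarrow> square_integrable f \<and> (x \<noteq> 0 \<or> \<not> (AE p in \<mu>. f p = 0)) \<and>
     (w0 - \<tau> * e) * x + (\<integral>p. v0 p * f p \<partial>\<mu>) = 0 \<and>
     (AE p in \<mu>. x * v0 p + D p e * f p = \<kappa> * v p * (\<integral>s. res e (p, s) * (v s * f s) \<partial>\<mu>))"

lemma kernel_pair_B:
  assumes e: "e \<le> m" and k: "kernel_pair e x f" and h: "square_integrable h"
  shows "B e x f y h = 0"
proof -
  have f: "square_integrable f" and x: "(w0 - \<tau> * e) * x + (\<integral>p. v0 p * f p \<partial>\<mu>) = 0"
    and eq: "AE p in \<mu>. x * v0 p + D p e * f p = \<kappa> * v p * (\<integral>s. res e (p, s) * (v s * f s) \<partial>\<mu>)"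
    using k by (auto simp: kernel_pair_def)
  let ?K = "\<lambda>x. res e x * ((v (fst x) * h (fst x)) * (v (snd x) * f (snd x)))"
  have iK: "integrable (\<mu> \<Otimes>\<^sub>M \<mu>) ?K" by (rule kern_integrable[OF e h f])
  have K_eq: "(\<integral>s. ?K (p, s) \<partial>\<mu>) = v p * h p * (\<integral>s. res e (p, s) * (v s * f s) \<partial>\<mu>)" for p
  proof -
    have "(\<integral>s. ?K (p, s) \<partial>\<mu>) = (\<integral>s. (v p * h p) * (res e (p, s) * (v s * f s)) \<partial>\<mu>)"
      by (intro Bochner_Integration.integral_cong) auto
    then show ?thesis by simp
  qed
  have "kern e f h = (\<integral>p. v p * h p * (\<integral>s. res e (p, s) * (v s * f s) \<partial>\<mu>) \<partial>\<mu>)"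
    unfolding kern_commute[OF f h] using torus2.integral_fst'[OF iK] unfolding K_eq kern_def by simp
  moreover have i: "integrable \<mu> (\<lambda>p. v p * h p * (\<integral>s. res e (p, s) * (v s * f s) \<partial>\<mu>))"
    using torus2.integrable_fst'[OF iK] unfolding K_eq by simp
  ultimately have "\<kappa> * kern e f h = (\<integral>p. \<kappa> * (v p * h p * (\<integral>s. res e (p, s) * (v s * f s) \<partial>\<mu>)) \<partial>\<mu>)"
    by simp
  also have "\<dots> = (\<integral>p. x * (v0 p * h p) + D p e * f p * h p \<partial>\<mu>)"
  proof (rule integral_cong_AE)
    show "AE p in \<mu>. \<kappa> * (v p * h p * (\<integral>s. res e (p, s) * (v s * f s) \<partial>\<mu>)) = x * (v0 p * h p)
        + D p e * f p * h p"
      using eq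
    proof eventually_elim
      case (elim p)
      have "\<kappa> * (v p * h p * (\<integral>s. res e (p, s) * (v s * f s) \<partial>\<mu>))
          = (\<kappa> * v p * (\<integral>s. res e (p, s) * (v s * f s) \<partial>\<mu>)) * h p"
        by simp
      also have "\<dots> = (x * v0 p + D p e * f p) * h p" using elim by simp
      finally show ?case by (simp add: algebra_simps)
    qed
    show "(\<lambda>p. x * (v0 p * h p) + D p e * f p * h p) \<in> borel_measurable \<mu>"
      using v0_integrable[OF h] D_integrable[OF e f h]
      by (intro borel_measurable_integrable) simp
  qed (use i in auto)
  also have "\<dots> = x * (\<integral>p. v0 p * h p \<partial>\<mu>) + (\<integral>p. D p e * f p * h p \<partial>\<mu>)"
    using v0_integrable[OF h] D_integrable[OF e f h] by simp
  finally have "B e x f y h = y * ((w0 - \<tau> * e) * x + (\<integral>p. v0 p * f p \<partial>\<mu>))"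
    unfolding B_def by (simp add: algebra_simps)
  then show ?thesis unfolding x by simp
qed

end

section \<open>Counting eigenvalues\<close>

context pencil
begin

lemma kern_cmult: "kern e (\<lambda>p. c * f p) (\<lambda>p. c * f p) = c\<^sup>2 * kern e f f"
proof -
  have "kern e (\<lambda>p. c * f p) (\<lambda>p. c * f p) =
      (\<integral>x. c\<^sup>2 * (res e x * ((v (fst x) * f (fst x)) * (v (snd x) * f (snd x)))) \<partial>(\<mu> \<Otimes>\<^sub>M \<mu>))"
    unfolding kern_def by (intro Bochner_Integration.integral_cong) (auto simp: power2_eq_square)
  then show ?thesis by (simp add: kern_def)
qed

lemma kern_null:
  assumes "AE p in \<mu>. f p = 0"
  shows "kern e f f = 0"
  unfolding kern_def
proof (rule integral_eq_zero_AE)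
  show "AE x in \<mu> \<Otimes>\<^sub>M \<mu>. res e x * ((v (fst x) * f (fst x)) * (v (snd x) * f (snd x))) = 0"
    using AE_torus_fst[OF assms] by eventually_elim simp
qed

text \<open>
  In a space of dimension \<open>n\<close> on which \<open>\<sigma> B e\<close> is negative, \<open>n - 1\<close> vectors without scalar
  component can be chosen orthonormal for the weight \<open>\<sigma> D e\<close>: each new vector is a nontrivial
  solution of fewer than \<open>n\<close> linear equations. Negativity says that the kernel form is at
  least 1 on each of them.
\<close>

lemma orthonormal_test_functions:
  assumes e: "e \<le> m" and S: "finite S" and F: "\<And>i. i \<in> S \<Longrightarrow> square_integrable (F i)"
    and W: "AE p in \<mu>. \<sigma> * D p e > 0"
    and neg: "\<And>c. \<exists>i\<in>S. c i \<noteq> 0 \<Longrightarrow>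
      \<sigma> * B e (\<Sum>i\<in>S. c i * Y i) (\<lambda>p. \<Sum>i\<in>S. c i * F i p) (\<Sum>i\<in>S. c i * Y i) (\<lambda>p. \<Sum>i\<in>S. c i * F i p)
          < 0"
    and k: "k < card S"
  shows "\<exists>u. (\<forall>i<k. square_integrable (u i) \<and> 1 \<le> \<sigma> * \<kappa> * kern e (u i) (u i)) \<and>
    (\<forall>i<k. \<forall>j<k. (\<integral>p. \<sigma> * D p e * u i p * u j p \<partial>\<mu>) = (if i = j then 1 else 0))"
  using k
proof (induction k)
  case (Suc k)
  then obtain u where u: "\<And>i. i < k \<Longrightarrow> square_integrable (u i)"
    "\<And>i. i < k \<Longrightarrow> 1 \<le> \<sigma> * \<kappa> * kern e (u i) (u i)"
    "\<And>i j. i < k \<Longrightarrow> j < k \<Longrightarrow> (\<integral>p. \<sigma> * D p e * u i p * u j p \<partial>\<mu>) = (if i = j then 1 else 0)"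
    by auto
  have WI: "integrable \<mu> (\<lambda>p. \<sigma> * D p e * f p * h p)"
      if "square_integrable f" "square_integrable h" for f h
    using integrable_mult_right[OF D_integrable[OF e that], of \<sigma>] by (simp add: mult.assoc)
  \<comment> \<open>Orthogonality to the \<open>k\<close> earlier functions, and a vanishing scalar component.\<close>
  let ?a = "\<lambda>i r. if i < k then (\<integral>p. \<sigma> * D p e * u i p * F r p \<partial>\<mu>) else Y r"
  obtain c where c: "\<exists>i\<in>S. c i \<noteq> 0" "\<And>i. i < Suc k \<Longrightarrow> (\<Sum>r\<in>S. c r * ?a i r) = 0"
    using homogeneous_system_nontrivial[OF S Suc.prems, of ?a] by blast
  define f where "f p = (\<Sum>r\<in>S. c r * F r p)" for p
  have f: "square_integrable f" unfolding f_def[abs_def] by (rule square_integrable_sum[OF F])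
  have x0: "(\<Sum>r\<in>S. c r * Y r) = 0" using c(2)[of k] by simp
  have orth: "(\<integral>p. \<sigma> * D p e * u i p * f p \<partial>\<mu>) = 0" if i: "i < k" for i
  proof -
    have "(\<integral>p. \<sigma> * D p e * u i p * f p \<partial>\<mu>) = (\<integral>p. (\<Sum>r\<in>S. c r * (\<sigma> * D p e * u i p * F r p)) \<partial>\<mu>)"
      unfolding f_def by (intro Bochner_Integration.integral_cong) (auto simp: sum_distrib_left
          ac_simps)
    also have "\<dots> = (\<Sum>r\<in>S. c r * (\<integral>p. \<sigma> * D p e * u i p * F r p \<partial>\<mu>))"
      using WI[OF u(1)[OF i] F] by (subst Bochner_Integration.integral_sum) auto
    also have "\<dots> = 0" using c(2)[of i] i by simp
    finally show ?thesis .
  qed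
  define n where "n = (\<integral>p. \<sigma> * D p e * f p * f p \<partial>\<mu>)"
  have "\<sigma> * B e 0 f 0 f < 0"
    using neg[OF c(1)] unfolding x0 f_def[symmetric] by simp
  moreover have "\<sigma> * B e 0 f 0 f = n - \<sigma> * \<kappa> * kern e f f"
    unfolding B_def n_def by (simp add: algebra_simps flip: integral_mult_right_zero)
  ultimately have lt: "n < \<sigma> * \<kappa> * kern e f f" by simp
  have nn: "AE p in \<mu>. 0 \<le> \<sigma> * D p e * f p * f p"
    using W
  proof eventually_elim
    case (elim p)
    then have "0 \<le> (\<sigma> * D p e) * (f p)\<^sup>2" by simp
    then show ?case by (simp add: power2_eq_square mult.assoc)
  qed
  have "n \<ge> 0" unfolding n_def by (rule integral_nonneg_AE[OF nn])
  moreover have "n \<noteq> 0"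
  proof
    assume "n = 0"
    then have "AE p in \<mu>. \<sigma> * D p e * f p * f p = 0"
      using integral_nonneg_eq_0_iff_AE[OF WI[OF f f] nn] by (simp add: n_def)
    then have "AE p in \<mu>. f p = 0" using W by eventually_elim auto
    then show False using lt \<open>n = 0\<close> kern_null by simp
  qed
  ultimately have n: "n > 0" by simp
  define w where "w p = 1 / sqrt n * f p" for p
  have w: "square_integrable w" unfolding w_def[abs_def] by (rule square_integrable_cmult[OF f])
  have kw: "1 \<le> \<sigma> * \<kappa> * kern e w w"
  proof -
    have "kern e w w = kern e f f / n"
      unfolding w_def[abs_def] kern_cmult using n by (simp add: power_divide)
    then show ?thesis using lt n by simp
  qed
  have ww: "(\<integral>p. \<sigma> * D p e * w p * w p \<partial>\<mu>) = 1"
  proof -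
    have "(\<integral>p. \<sigma> * D p e * w p * w p \<partial>\<mu>) = (\<integral>p. (1 / n) * (\<sigma> * D p e * f p * f p) \<partial>\<mu>)"
      using n by (intro Bochner_Integration.integral_cong)
        (auto simp: w_def real_sqrt_mult[symmetric] simp flip: power2_eq_square)
    then show ?thesis using n by (simp add: n_def[symmetric])
  qed
  have uw: "(\<integral>p. \<sigma> * D p e * u i p * w p \<partial>\<mu>) = 0" if "i < k" for i
  proof -
    have "(\<integral>p. \<sigma> * D p e * u i p * w p \<partial>\<mu>) = (\<integral>p. (1 / sqrt n) * (\<sigma> * D p e * u i p * f p) \<partial>\<mu>)"
      by (intro Bochner_Integration.integral_cong) (auto simp: w_def)
    then show ?thesis using orth[OF that] by simp
  qed
  have wu: "(\<integral>p. \<sigma> * D p e * w p * u i p \<partial>\<mu>) = 0" if "i < k" for i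
  proof -
    have "(\<integral>p. \<sigma> * D p e * w p * u i p \<partial>\<mu>) = (\<integral>p. \<sigma> * D p e * u i p * w p \<partial>\<mu>)"
      by (intro Bochner_Integration.integral_cong) auto
    then show ?thesis using uw[OF that] by simp
  qed
  show ?case
    by (intro exI[of _ "u(k := w)"]) (use u w kw ww uw wu in \<open>auto simp: less_Suc_eq\<close>)
qed simp

text \<open>
  The products \<open>u i \<otimes> u i\<close>, weighted with \<open>sqrt W\<close> in both variables, are orthonormal in two
  variables, so Bessel's inequality for the weighted kernel bounds their number by its
  Hilbert-Schmidt norm. Here Bessel's inequality is the nonnegativity of the integral of
  \<open>(A - t U)\<^sup>2\<close>, with \<open>A\<close> the weighted kernel, \<open>U\<close> the sum of the products and \<open>t = \<sigma> / \<kappa>\<close>.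
\<close>

lemma test_functions_bound:
  assumes e: "e \<le> m" and \<sigma>: "\<sigma>\<^sup>2 = 1" and W: "AE p in \<mu>. \<sigma> * D p e > 0"
    and h: "integrable \<mu> h"
    and dom: "AE x in \<mu> \<Otimes>\<^sub>M \<mu>. (res e x * (v (fst x) * v (snd x)))\<^sup>2 \<le>
      (\<sigma> * D (fst x) e) * (\<sigma> * D (snd x) e) * (h (fst x) * h (snd x))"
    and u: "\<And>i. i < k \<Longrightarrow> square_integrable (u i)"
      "\<And>i. i < k \<Longrightarrow> 1 \<le> \<sigma> * \<kappa> * kern e (u i) (u i)"
    and orth: "\<And>i j. i < k \<Longrightarrow> j < k \<Longrightarrow> (\<integral>p. \<sigma> * D p e * u i p * u j p \<partial>\<mu>) = (if i = j then 1 else 0)"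
  shows "real k \<le> \<kappa>\<^sup>2 * (\<integral>p. h p \<partial>\<mu>)\<^sup>2"
proof -
  define W where "W p = \<sigma> * D p e" for p
  define s where "s p = sqrt (W p)" for p
  define t where "t = \<sigma> / \<kappa>"
  define A where "A x = res e x * (v (fst x) * v (snd x)) / (s (fst x) * s (snd x))" for x
  define U where "U x = (\<Sum>i<k. (s (fst x) * u i (fst x)) * (s (snd x) * u i (snd x)))" for x
  let ?K = "\<lambda>i x. res e x * ((v (fst x) * u i (fst x)) * (v (snd x) * u i (snd x)))"
  let ?P = "\<lambda>i j x. (W (fst x) * u i (fst x) * u j (fst x)) * (W (snd x) * u i (snd x) * u j (snd
      x))"
  have iK: "integrable (\<mu> \<Otimes>\<^sub>M \<mu>) (?K i)" if "i < k" for i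
    by (rule kern_integrable[OF e u(1)[OF that] u(1)[OF that]])
  have iW: "integrable \<mu> (\<lambda>p. W p * u i p * u j p)" if "i < k" "j < k" for i j
    using integrable_mult_right[OF D_integrable[OF e u(1)[OF that(1)] u(1)[OF that(2)]], of \<sigma>]
    by (simp add: W_def mult.assoc)
  have iP: "integrable (\<mu> \<Otimes>\<^sub>M \<mu>) (?P i j)" "(\<integral>x. ?P i j x \<partial>(\<mu> \<Otimes>\<^sub>M \<mu>)) = (if i = j then 1 else 0)"
      if "i < k" "j < k" for i j
    using product_integral[OF iW[OF that] iW[OF that]] orth[OF that] by (auto simp: W_def)
  have ih: "integrable (\<mu> \<Otimes>\<^sub>M \<mu>) (\<lambda>x. h (fst x) * h (snd x))"
    "(\<integral>x. h (fst x) * h (snd x) \<partial>(\<mu> \<Otimes>\<^sub>M \<mu>)) = (\<integral>p. h p \<partial>\<mu>)\<^sup>2"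
    using product_integral[OF h h] by (auto simp: power2_eq_square)
  let ?G = "\<lambda>x. h (fst x) * h (snd x) - 2 * t * (\<Sum>i<k. ?K i x) + t\<^sup>2 * (\<Sum>i<k. \<Sum>j<k. ?P i j x)"
  have W': "AE p in \<mu>. W p > 0" using W by (simp add: W_def)
  have "AE x in \<mu> \<Otimes>\<^sub>M \<mu>. 0 \<le> ?G x"
    using dom AE_torus_fst[OF W'] AE_torus_snd[OF W']
  proof eventually_elim
    case (elim x)
    have s: "s (fst x) > 0" "s (snd x) > 0" "(s (fst x))\<^sup>2 = W (fst x)" "(s (snd x))\<^sup>2 = W (snd x)"
      using elim by (auto simp: s_def)
    have AU: "A x * U x = (\<Sum>i<k. ?K i x)"
      unfolding U_def A_def sum_distrib_left using s(1,2)
          by (intro sum.cong) (auto simp: field_simps)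
    have UU: "(U x)\<^sup>2 = (\<Sum>i<k. \<Sum>j<k. ?P i j x)"
      unfolding U_def power2_eq_square sum_product s(3,4)[symmetric]
      by (intro sum.cong refl) (simp add: ac_simps power2_eq_square)
    have AA: "(A x)\<^sup>2 \<le> h (fst x) * h (snd x)"
    proof -
      have "(A x)\<^sup>2 = (res e x * (v (fst x) * v (snd x)))\<^sup>2 / (W (fst x) * W (snd x))"
        by (simp add: A_def power_divide power_mult_distrib s(3,4))
      also have "\<dots> \<le> h (fst x) * h (snd x)"
        using elim by (simp add: pos_divide_le_eq W_def[symmetric] mult.commute)
      finally show ?thesis .
    qed
    have "0 \<le> (A x - t * U x)\<^sup>2" by simp
    also have "\<dots> = (A x)\<^sup>2 - 2 * t * (A x * U x) + t\<^sup>2 * (U x)\<^sup>2"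
      by (simp add: power2_diff power_mult_distrib)
    finally show ?case using AA unfolding AU UU by linarith
  qed
  then have "0 \<le> (\<integral>x. ?G x \<partial>(\<mu> \<Otimes>\<^sub>M \<mu>))" by (rule integral_nonneg_AE)
  also have "\<dots> = (\<integral>p. h p \<partial>\<mu>)\<^sup>2 - 2 * t * (\<Sum>i<k. kern e (u i) (u i)) + t\<^sup>2 * (\<Sum>i<k. \<Sum>j<k. if i
      = j then 1 else 0)"
  proof -
    have iKs: "integrable (\<mu> \<Otimes>\<^sub>M \<mu>) (\<lambda>x. \<Sum>i<k. ?K i x)"
      "(\<integral>x. (\<Sum>i<k. ?K i x) \<partial>(\<mu> \<Otimes>\<^sub>M \<mu>)) = (\<Sum>i<k. kern e (u i) (u i))"
      using iK by (auto simp: kern_def Bochner_Integration.integral_sum intro!: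
          Bochner_Integration.integrable_sum)
    have iPs: "integrable (\<mu> \<Otimes>\<^sub>M \<mu>) (\<lambda>x. \<Sum>i<k. \<Sum>j<k. ?P i j x)"
      using iP(1) by (intro Bochner_Integration.integrable_sum) auto
    have "(\<integral>x. (\<Sum>i<k. \<Sum>j<k. ?P i j x) \<partial>(\<mu> \<Otimes>\<^sub>M \<mu>)) = (\<Sum>i<k. \<integral>x. (\<Sum>j<k. ?P i j x) \<partial>(\<mu> \<Otimes>\<^sub>M \<mu>))"
      using iP(1) by (intro Bochner_Integration.integral_sum Bochner_Integration.integrable_sum)
          auto
    also have "\<dots> = (\<Sum>i<k. \<Sum>j<k. \<integral>x. ?P i j x \<partial>(\<mu> \<Otimes>\<^sub>M \<mu>))"
      using iP(1) by (intro sum.cong refl Bochner_Integration.integral_sum) auto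
    also have "\<dots> = (\<Sum>i<k. \<Sum>j<k. if i = j then 1 else 0)"
      using iP(2) by (intro sum.cong refl) auto
    finally have iPs2: "(\<integral>x. (\<Sum>i<k. \<Sum>j<k. ?P i j x) \<partial>(\<mu> \<Otimes>\<^sub>M \<mu>)) = (\<Sum>i<k. \<Sum>j<k. if i
        = j then 1 else 0)" .
    show ?thesis
      unfolding iPs2[symmetric] iKs(2)[symmetric] ih(2)[symmetric] using iPs iKs(1) ih(1)
      by (subst Bochner_Integration.integral_add Bochner_Integration.integral_diff; auto)+
  qed
  also have "(\<Sum>i<k. \<Sum>j<k. if i = j then 1 else 0) = real k" by simp
  finally have 1: "2 * t * (\<Sum>i<k. kern e (u i) (u i)) \<le> (\<integral>p. h p \<partial>\<mu>)\<^sup>2 + t\<^sup>2 * real k" by simp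
  have "real k \<le> (\<Sum>i<k. \<sigma> * \<kappa> * kern e (u i) (u i))"
    using sum_mono[of "{..<k}" "\<lambda>_. 1" "\<lambda>i. \<sigma> * \<kappa> * kern e (u i) (u i)"] u(2) by simp
  also have "\<dots> = \<sigma> * \<kappa> * (\<Sum>i<k. kern e (u i) (u i))" by (simp add: sum_distrib_left)
  finally have 2: "real k \<le> \<sigma> * \<kappa> * (\<Sum>i<k. kern e (u i) (u i))" .
  have "\<kappa>\<^sup>2 * (2 * t * (\<Sum>i<k. kern e (u i) (u i))) = 2 * (\<sigma> * \<kappa> * (\<Sum>i<k. kern e (u i) (u i)))"
    using \<kappa>_pos by (simp add: t_def power2_eq_square)
  moreover have "\<kappa>\<^sup>2 * (2 * t * (\<Sum>i<k. kern e (u i) (u i))) \<le> \<kappa>\<^sup>2 * (\<integral>p. h p \<partial>\<mu>)\<^sup>2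
      + \<kappa>\<^sup>2 * (t\<^sup>2 * real k)"
    unfolding distrib_left[symmetric] using 1 by (intro mult_left_mono) auto
  moreover have "\<kappa>\<^sup>2 * (t\<^sup>2 * real k) = real k" using \<kappa>_pos \<sigma> by (simp add: t_def power_divide)
  ultimately show ?thesis using 2 by linarith
qed

text \<open>
  The kernel vectors of \<open>B (E i)\<close> span a space on which \<open>B e\<close> is negative if all \<open>E i < e\<close>, and
  positive if all \<open>E i > e\<close>. The sign of \<open>D e\<close> is the opposite one, so the two preceding lemmas
      bound
  the number of the \<open>E i\<close>.
\<close>

lemma finite_kernel_energies:
  assumes e: "e \<le> m" and side: "\<sigma> = 1 \<and> (\<forall>E\<in>T. E < e) \<or> \<sigma> = - 1 \<and> (\<forall>E\<in>T. e < E \<and> E \<le> m)"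
    and W: "AE p in \<mu>. \<sigma> * D p e > 0"
    and h: "integrable \<mu> h"
    and dom: "AE x in \<mu> \<Otimes>\<^sub>M \<mu>. (res e x * (v (fst x) * v (snd x)))\<^sup>2 \<le>
      (\<sigma> * D (fst x) e) * (\<sigma> * D (snd x) e) * (h (fst x) * h (snd x))"
    and T: "\<And>E. E \<in> T \<Longrightarrow> \<exists>x f. kernel_pair E x f"
  shows "finite T"
proof -
  have Tm: "E \<le> m" if "E \<in> T" for E using side e that by force
  have \<sigma>: "\<sigma>\<^sup>2 = 1" using side by auto
  have "\<forall>E. \<exists>x f. square_integrable f \<and> (E \<in> T \<longrightarrow> kernel_pair E x f)"
  proof
    fix E
    have "square_integrable (\<lambda>_. 0)" by (simp add: square_integrable_def)
    then show "\<exists>x f. square_integrable f \<and> (E \<in> T \<longrightarrow> kernel_pair E x f)"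
      using T[of E] unfolding kernel_pair_def by blast
  qed
  then obtain Y F where F: "\<And>E. square_integrable (F E)" and K: "\<And>E. E \<in> T
      \<Longrightarrow> kernel_pair E (Y E) (F E)"
    by metis
  have nonnull: "Y E \<noteq> 0 \<or> \<not> (AE p in \<mu>. F E p = 0)" if "E \<in> T" for E
    using K[OF that] by (simp add: kernel_pair_def)
  define b where "b e i j = B e (Y i) (F i) (Y j) (F j)" for e i j
  have sym: "b e i j = b e j i" for e i j unfolding b_def by (rule B_commute[OF F F])
  have ker: "b i i j = 0" if "i \<in> T" for i j
    unfolding b_def by (rule kernel_pair_B[OF Tm[OF that] K[OF that] F])
  define n where "n = nat \<lfloor>\<kappa>\<^sup>2 * (\<integral>p. h p \<partial>\<mu>)\<^sup>2\<rfloor> + 1"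
  have "card S \<le> n" if ST: "S \<subseteq> T" "finite S" for S
  proof -
    let ?q = "\<lambda>e c. \<Sum>i\<in>S. \<Sum>j\<in>S. c i * c j * b e i j"
    have q: "?q e c = B e (\<Sum>i\<in>S. c i * Y i) (\<lambda>p. \<Sum>i\<in>S. c i * F i p) (\<Sum>i\<in>S. c i * Y i) (\<lambda>p. \<Sum>i\<in>S. c
        i * F i p)"
      if "e \<le> m" for e c
      unfolding b_def by (rule B_sum[OF that F, symmetric])
    have mono: "?q e' c \<le> ?q e c" if "e \<in> {..m}" "e' \<in> {..m}" "e \<le> e'" for e e' c
      using that by (simp add: q B_antimono square_integrable_sum F)
    have "\<sigma> * ?q e c < 0" if c: "\<exists>i\<in>S. c i \<noteq> 0" for c
      using side
    proof (elim disjE conjE)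
      assume *: "\<sigma> = 1" "\<forall>E\<in>T. E < e"
      have "?q e c < 0"
      proof (rule pencil_negative[where E = "\<lambda>i. i" and J = "{..m}"])
        show "b e i i < 0" if "i \<in> S" "e \<in> {..m}" "i < e" for i e
          using B_strict[OF that(3) _ F nonnull] ker[of i i] that ST by (auto simp: b_def)
      qed (use * mono ST Tm ker sym e c in auto)
      then show ?thesis using * by simp
    next
      assume *: "\<sigma> = - 1" "\<forall>E\<in>T. e < E \<and> E \<le> m"
      have "?q e c > 0"
      proof (rule pencil_positive[where E = "\<lambda>i. i" and J = "{..m}"])
        show "b e i i > 0" if "i \<in> S" "e \<in> {..m}" "e < i" for i e
          using B_strict[OF that(3) _ F nonnull] ker[of i i] that ST Tm
              by (fastforce simp: b_def not_le[symmetric])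
      qed (use * mono ST Tm ker sym e c in auto)
      then show ?thesis using * by simp
    qed
    then have neg: "\<sigma> * B e (\<Sum>i\<in>S. c i * Y i) (\<lambda>p. \<Sum>i\<in>S. c i * F i p) (\<Sum>i\<in>S. c i * Y i) (\<lambda>p. \<Sum>i\<in>S.
        c i * F i p) < 0"
      if "\<exists>i\<in>S. c i \<noteq> 0" for c using that q[OF e] by simp
    show ?thesis
    proof (cases "card S = 0")
      case False
      then have "card S - 1 < card S" by simp
      from orthonormal_test_functions[OF e ST(2) F W neg this]
      obtain u where "\<And>i. i < card S - 1 \<Longrightarrow> square_integrable (u i)"
        "\<And>i. i < card S - 1 \<Longrightarrow> 1 \<le> \<sigma> * \<kappa> * kern e (u i) (u i)"
        "\<And>i j. i < card S - 1 \<Longrightarrow> j < card S - 1 \<Longrightarrow>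
          (\<integral>p. \<sigma> * D p e * u i p * u j p \<partial>\<mu>) = (if i = j then 1 else 0)" by auto
      from test_functions_bound[OF e \<sigma> W h dom this]
      have "real (card S - 1) \<le> \<kappa>\<^sup>2 * (\<integral>p. h p \<partial>\<mu>)\<^sup>2" .
      then show ?thesis unfolding n_def by linarith
    qed simp
  qed
  then show ?thesis using finite_if_finite_subsets_card_bdd[of T n] by blast
qed

text \<open>
  At \<open>e = m\<close> the kernel is unbounded, but it is dominated by \<open>sqrt g\<close> in both variables while the
  weight \<open>D m\<close> stays away from 0.
\<close>

lemma kernel_energies_positive_threshold:
  assumes c: "c > 0" "\<And>p. D p m \<ge> c"
  shows "finite {E. E < m \<and> (\<exists>x f. kernel_pair E x f)}"
proof -
  obtain C where C: "C > 0" "\<And>p. \<bar>v p\<bar> \<le> C" using torus_fun_bounded[OF v_torus v_cont] by blast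
  show ?thesis
  proof (rule finite_kernel_energies[where e = m and \<sigma> = 1 and h = "\<lambda>p. C\<^sup>2 / c * g p"])
    show "AE p in \<mu>. 0 < 1 * D p m" using c by (intro AE_I2) (metis mult_1 order_less_le_trans)
    show "integrable \<mu> (\<lambda>p. C\<^sup>2 / c * g p)" using g_integrable by simp
    show "AE x in \<mu> \<Otimes>\<^sub>M \<mu>. (res m x * (v (fst x) * v (snd x)))\<^sup>2 \<le>
        (1 * D (fst x) m) * (1 * D (snd x) m) * ((C\<^sup>2 / c * g (fst x)) * (C\<^sup>2 / c * g (snd x)))"
      using AE_res[OF order_refl]
    proof eventually_elim
      case (elim x)
      have "\<bar>v (fst x) * v (snd x)\<bar> \<le> C * C" unfolding abs_mult using C by (intro mult_mono) auto
      then have "(v (fst x) * v (snd x))\<^sup>2 \<le> (C * C)\<^sup>2"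
        using C(1) abs_le_square_iff[of "v (fst x) * v (snd x)" "C * C"] by simp
      moreover have "(res m x)\<^sup>2 \<le> g (fst x) * g (snd x)"
        unfolding power2_eq_square using elim by (intro mult_mono) auto
      ultimately have "(res m x * (v (fst x) * v (snd x)))\<^sup>2 \<le> (g (fst x) * g (snd x)) * (C * C)\<^sup>2"
        unfolding power_mult_distrib[of "res m x"] using elim by (intro mult_mono) auto
      also have "\<dots> = (c * c) * ((C\<^sup>2 / c * g (fst x)) * (C\<^sup>2 / c * g (snd x)))"
        using c by (simp add: power2_eq_square)
      also have "\<dots> \<le> (1 * D (fst x) m) * (1 * D (snd x) m) * ((C\<^sup>2 / c * g (fst x)) * (C\<^sup>2 / c * g
          (snd x)))"
      proof -
        have "0 \<le> g (fst x)" "0 \<le> g (snd x)" using elim by auto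
        moreover have "c * c \<le> (1 * D (fst x) m) * (1 * D (snd x) m)"
          using c by (simp only: mult_1, intro mult_mono) (auto intro: order_trans[OF less_imp_le])
        ultimately show ?thesis using c(1) by (intro mult_right_mono mult_nonneg_nonneg) auto
      qed
      finally show ?case .
    qed
  qed auto
qed

text \<open>
  For \<open>e < m\<close> the situation is reversed: the kernel is bounded and the weight has zeros, which by
  the order condition leave its reciprocal integrable.
\<close>

lemma kernel_energies_beyond_zero:
  assumes e: "e < m" and \<sigma>: "\<sigma> = 1 \<or> \<sigma> = - 1" and sign: "\<And>p. \<sigma> * D p e \<ge> 0"
    and pz: "power_zeros (\<lambda>p. D p e)"
  shows "finite {E. E < m \<and> \<sigma> * E < \<sigma> * e \<and> (\<exists>x f. kernel_pair E x f)}"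
proof -
  obtain C where C: "C > 0" "\<And>p. \<bar>v p\<bar> \<le> C" using torus_fun_bounded[OF v_torus v_cont] by blast
  define W where "W p = \<sigma> * D p e" for p
  define K where "K = C\<^sup>2 / (m - e)"
  have K: "K > 0" using C e by (simp add: K_def)
  have W: "torus_fun W" "continuous_on UNIV W"
    using D_torus D_cont_fst[of e] e unfolding W_def torus_fun_def
        by (auto intro: continuous_intros)
  have "power_zeros W"
  proof -
    have "\<bar>W p\<bar> = \<bar>D p e\<bar>" "W p = 0 \<longleftrightarrow> D p e = 0" for p using \<sigma> by (auto simp: W_def)
    then show ?thesis using pz by (simp add: power_zeros_def torus_zeros_def)
  qed
  then obtain G N where G: "integrable \<mu> G" "finite N" "\<And>p. p \<in> torus_cell - N \<Longrightarrow> W p > 0 \<and> 1 / W p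
      \<le> G p"
    using inverse_integrable_of_power_zeros[OF W sign[folded W_def]] by metis
  have AEW: "AE p in \<mu>. W p > 0 \<and> 1 / W p \<le> G p"
    using AE_torus_finite[OF G(2)] AE_space by eventually_elim (use G(3) in auto)
  show ?thesis
  proof (rule finite_kernel_energies[where e = e and \<sigma> = \<sigma> and h = "\<lambda>p. K * (1 / W p)"])
    show "\<sigma> = 1 \<and> (\<forall>E\<in>{E. E < m \<and> \<sigma> * E < \<sigma> * e \<and> (\<exists>x f. kernel_pair E x f)}. E < e) \<or>
        \<sigma> = - 1 \<and> (\<forall>E\<in>{E. E < m \<and> \<sigma> * E < \<sigma> * e \<and> (\<exists>x f. kernel_pair E x f)}. e < E \<and> E \<le> m)"
      using \<sigma> by auto
    show "AE p in \<mu>. 0 < \<sigma> * D p e" using AEW by eventually_elim (simp add: W_def)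
    show "integrable \<mu> (\<lambda>p. K * (1 / W p))"
    proof (intro integrable_mult_right, rule Bochner_Integration.integrable_bound[OF G(1)])
      show "(\<lambda>p. 1 / W p) \<in> borel_measurable \<mu>"
        by (intro borel_measurable_divide continuous_torus_measurable W borel_measurable_const)
      show "AE p in \<mu>. norm (1 / W p) \<le> norm (G p)" using AEW by eventually_elim auto
    qed
    show "AE x in \<mu> \<Otimes>\<^sub>M \<mu>. (res e x * (v (fst x) * v (snd x)))\<^sup>2 \<le>
        (\<sigma> * D (fst x) e) * (\<sigma> * D (snd x) e) * ((K * (1 / W (fst x))) * (K * (1 / W (snd x))))"
      using AE_torus_fst[OF AEW] AE_torus_snd[OF AEW]
    proof eventually_elim
      case (elim x)
      have "\<bar>res e x\<bar> \<le> 1 / (m - e)"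
        using m_le[of x] e unfolding res_def by (auto simp: abs_if field_simps)
      moreover have "\<bar>v (fst x) * v (snd x)\<bar> \<le> C * C" unfolding abs_mult using C
          by (intro mult_mono) auto
      ultimately have "\<bar>res e x * (v (fst x) * v (snd x))\<bar> \<le> 1 / (m - e) * (C * C)"
        unfolding abs_mult[of "res e x"] using e by (intro mult_mono) auto
      also have "\<dots> = \<bar>K\<bar>" unfolding abs_of_pos[OF K] by (simp add: K_def power2_eq_square)
      finally have "(res e x * (v (fst x) * v (snd x)))\<^sup>2 \<le> K\<^sup>2" using abs_le_square_iff by blast
      also have "\<dots> = W (fst x) * W (snd x) * ((K * (1 / W (fst x))) * (K * (1 / W (snd x))))"
        using elim by (simp add: power2_eq_square)
      finally show ?case by (simp add: W_def)
    qed
  qed (use e in auto)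
qed

end

section \<open>The threshold conditions\<close>

context pencil
begin

lemma D_zero_between:
  assumes e: "e \<le> m" and "D p e \<le> 0" "D q e \<ge> 0"
  shows "\<exists>r. D r e = 0"
proof -
  have "connected ((\<lambda>p. D p e) ` UNIV)"
    by (intro connected_continuous_image D_cont_fst e connected_UNIV)
  then have "{D p e..D q e} \<subseteq> (\<lambda>p. D p e) ` UNIV"
    by (intro connected_contains_Icc) auto
  then have "0 \<in> (\<lambda>p. D p e) ` UNIV" using assms(2,3) by fastforce
  then show ?thesis by auto
qed

text \<open>
  As \<open>e\<close> tends to minus infinity, the integral in \<open>D\<close> tends to 0, while the remaining part tends to
  infinity or is equal to 1.
\<close>

lemma D_pos_low: "\<exists>z<m. \<forall>e\<le>z. \<forall>p. D p e > 0"
proof -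
  define V where "V = (\<integral>s. (v s)\<^sup>2 \<partial>\<mu>)"
  have V: "V \<ge> 0" by (simp add: V_def)
  have v2: "integrable \<mu> (\<lambda>s. (v s)\<^sup>2)" using v_square by (simp add: square_integrable_def)
  obtain A where A: "A > 0" "\<And>p. \<bar>a p\<bar> \<le> A" using torus_fun_bounded[OF a_torus a_cont] by blast
  define t where "t = 1 + \<kappa> * V + \<bar>m\<bar> + A"
  have t: "t > 0" "t \<ge> 1" "\<kappa> * V < t" using \<kappa>_pos V A by (auto simp: t_def add_pos_nonneg)
  have est: "D p e \<ge> a p - \<tau> * e - \<kappa> * V / t" if e: "e \<le> m - t" for p e
  proof -
    have em: "e \<le> m" using e t by simp
    have "(\<integral>s. res e (p, s) * (v s)\<^sup>2 \<partial>\<mu>) \<le> (\<integral>s. 1 / t * (v s)\<^sup>2 \<partial>\<mu>)"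
    proof (rule integral_mono)
      fix s
      have "res e (p, s) \<le> 1 / t"
        using m_le[of "(p, s)"] e t unfolding res_def
            by (intro divide_left_mono) (auto intro!: mult_pos_pos)
      then show "res e (p, s) * (v s)\<^sup>2 \<le> 1 / t * (v s)\<^sup>2" by (intro mult_right_mono) auto
    qed (use v2 v2_res_integrable[OF em] in auto)
    also have "\<dots> = V / t" by (simp add: V_def)
    finally have "\<kappa> * (\<integral>s. res e (p, s) * (v s)\<^sup>2 \<partial>\<mu>) \<le> \<kappa> * (V / t)"
      using \<kappa>_pos by (intro mult_left_mono) auto
    then show ?thesis unfolding D_res by simp
  qed
  have lt: "\<kappa> * V / t < 1" using t by simp
  show ?thesis
  proof (intro exI[of _ "m - t"] conjI allI impI)
    fix e p assume e: "e \<le> m - t"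
    show "D p e > 0"
    proof (cases "\<tau> = 1")
      case True
      have "\<bar>a p\<bar> \<le> A" by (rule A(2))
      moreover have "- e \<ge> 1 + \<kappa> * V + A" using e by (simp add: t_def)
      moreover have "0 \<le> \<kappa> * V" using \<kappa>_pos V by simp
      ultimately have "a p - \<tau> * e \<ge> 1" using True by simp
      then show ?thesis using est[OF e, of p] lt by linarith
    next
      case False
      then have "a p - \<tau> * e = 1" using \<tau>_cases by auto
      then show ?thesis using est[OF e, of p] lt by linarith
    qed
  qed (use t in simp)
qed

text \<open>
  Compactness, up to and including the threshold, makes \<open>E_min\<close> and \<open>E_max\<close> genuine least and
  greatest elements.
\<close>

lemma zero_energies_compact: "compact {e. e \<le> m \<and> (\<exists>p. D p e = 0)}"
proof -
  obtain z where z: "z < m" "\<And>e p. e \<le> z \<Longrightarrow> D p e > 0" using D_pos_low by blast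
  define K where "K = torus_cube \<times> {z..m}"
  have K: "compact K" unfolding K_def by (intro compact_Times compact_torus_cube compact_Icc)
  have "continuous_on K (\<lambda>x. D (fst x) (snd x))"
    by (rule continuous_on_subset[OF D_cont]) (auto simp: K_def)
  then have "closed (K \<inter> (\<lambda>x. D (fst x) (snd x)) -` {0})"
    using K by (intro continuous_closed_preimage compact_imp_closed) auto
  then have "compact (K \<inter> (K \<inter> (\<lambda>x. D (fst x) (snd x)) -` {0}))"
    using K by (intro compact_Int_closed)
  then have "compact (snd ` (K \<inter> (K \<inter> (\<lambda>x. D (fst x) (snd x)) -` {0})))"
    by (intro compact_continuous_image continuous_intros)
  also have "snd ` (K \<inter> (K \<inter> (\<lambda>x. D (fst x) (snd x)) -` {0})) = {e. e \<le> m \<and> (\<exists>p. D p e = 0)}"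
  proof safe
    fix e p assume ep: "e \<le> m" "D p e = 0"
    then have "z < e" using z(2)[of e p] by force
    moreover have "D (torus_rep p) e = 0" using torus_fun_rep[OF D_torus] ep by simp
    ultimately have "(torus_rep p, e) \<in> K \<inter> (K \<inter> (\<lambda>x. D (fst x) (snd x)) -` {0})"
      using ep torus_rep_in_cell cell_subset_cube by (auto simp: K_def)
    then show "e \<in> snd ` (K \<inter> (K \<inter> (\<lambda>x. D (fst x) (snd x)) -` {0}))" by force
  qed (auto simp: K_def)
  finally show ?thesis .
qed

lemma zero_below:
  assumes "D p m < 0"
  shows "\<exists>e<m. D p e = 0"
proof -
  obtain z where z: "z < m" "D p z > 0" using D_pos_low by blast
  have "continuous_on {z..m} (\<lambda>e. D p e)"
    by (rule continuous_on_compose2[OF D_cont, of "{z..m}" "\<lambda>e. (p, e)", simplified])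
      (auto intro: continuous_intros)
  then obtain e where "z \<le> e" "e \<le> m" "D p e = 0"
    using IVT2'[of "\<lambda>e. D p e" m 0 z] z assms by auto
  moreover from this assms have "e \<noteq> m" by auto
  ultimately show ?thesis by (intro exI[of _ e]) auto
qed

text \<open>
  Between \<open>E_min\<close> and \<open>E_max\<close> (or \<open>m\<close>, in the second condition) the function \<open>D e\<close> is nonpositive
      at one
  point and nonnegative at another one, hence has a zero, so an isolated energy cannot lie there.
  In the first condition the counting lemma applies at \<open>m\<close>. In the other two it applies below
  \<open>E_min\<close> and above \<open>E_max\<close>, because at the end point itself \<open>D\<close> has a definite sign
      and zeros of order
  at most 2. Isolation enters through the assumption that \<open>D e\<close> has no zeros for \<open>e \<noteq> E\<close> near \<open>E\<close>.
\<close>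

lemma finite_of_threshold_condition:
  assumes thr: "threshold_condition D S m"
    and S_zero: "\<And>E. E \<in> S \<Longrightarrow> E \<le> m \<Longrightarrow> \<exists>p. D p E = 0"
    and zero_S: "\<And>E p. E < m \<Longrightarrow> D p E = 0 \<Longrightarrow> E \<in> S"
    and T: "\<And>E. E \<in> T \<Longrightarrow> E < m \<and> (\<exists>x f. kernel_pair E x f)"
    and iso: "\<And>E. E \<in> T \<Longrightarrow> \<exists>d>0. \<forall>e p. e \<noteq> E \<longrightarrow> \<bar>e - E\<bar> < d \<longrightarrow> e < m \<longrightarrow> D p e \<noteq> 0"
  shows "finite T"
proof -
  have gap: "\<not> (l < E \<and> E < u)" if ET: "E \<in> T" and "u \<le> m" and z: "\<And>e. l < e \<Longrightarrow> e < u \<Longrightarrow> \<exists>p. D p e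
      = 0" for E l u
  proof
    assume E: "l < E \<and> E < u"
    obtain d where d: "d > 0" "\<And>e p. e \<noteq> E \<Longrightarrow> \<bar>e - E\<bar> < d \<Longrightarrow> e < m \<Longrightarrow> D p e \<noteq> 0"
      using iso[OF ET] by blast
    define e where "e = E + min (d / 2) ((u - E) / 2)"
    have "e \<noteq> E" "\<bar>e - E\<bar> < d" "l < e" "e < u" using d(1) E
        by (auto simp: e_def min_def field_simps)
    then show False using z d(2) \<open>u \<le> m\<close> by fastforce
  qed
  have D_rep: "D p e = D (torus_rep p) e" for p e using torus_fun_rep[OF D_torus] by simp
  have nonneg: "D p e \<ge> 0" if "\<forall>p \<in> torus_cell - torus_zeros (\<lambda>p. D p e). D p e > 0" for p e
    using that torus_rep_in_cell[of p] unfolding D_rep[of p] torus_zeros_def 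
    by (cases "D (torus_rep p) e = 0") (auto intro: less_imp_le)
  have nonpos: "D p e \<le> 0" if "\<forall>p \<in> torus_cell - torus_zeros (\<lambda>p. D p e). D p e < 0" for p e
    using that torus_rep_in_cell[of p] unfolding D_rep[of p] torus_zeros_def 
    by (cases "D (torus_rep p) e = 0") (auto intro: less_imp_le)
  let ?Z = "{e. e \<le> m \<and> (\<exists>p. D p e = 0)}"
  obtain pm where pm: "minimum ((\<lambda>p. D p m) ` torus_cell) = D pm m" "\<And>q. D pm m \<le> D q m"
    using torus_fun_attains_min[OF D_torus D_cont_fst[OF order_refl]] by blast
  obtain pM where pM: "maximum ((\<lambda>p. D p m) ` torus_cell) = D pM m" "\<And>q. D q m \<le> D pM m"
    using torus_fun_attains_max[OF D_torus D_cont_fst[OF order_refl]] by blast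
  have Emin: "E_min S m < m" if "D pm m < 0"
  proof -
    obtain e where e: "e < m" "D pm e = 0" using zero_below[OF \<open>D pm m < 0\<close>] by blast
    then have "?Z \<noteq> {}" by (auto intro: less_imp_le)
    then obtain e0 where e0: "e0 \<in> ?Z" "\<And>e. e \<in> ?Z \<Longrightarrow> e0 \<le> e"
      using compact_attains_inf[OF zero_energies_compact] by blast
    have "e0 \<le> e" using e0(2)[of e] e by (auto intro: less_imp_le)
    then have "e0 < m" using e by simp
    moreover have "E_min S m = e0"
      unfolding E_min_def using e0 \<open>e0 < m\<close> zero_S S_zero by (intro minimum_eqI) auto
    ultimately show ?thesis by simp
  qed
  have below: "finite {E \<in> T. E < e}" if "e < m" "\<And>p. D p e \<ge> 0" "power_zeros (\<lambda>p. D p e)" for e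
    by (rule finite_subset[OF _ kernel_energies_beyond_zero[OF that(1) disjI1[OF refl] _ that(3)]])
      (use T that(2) in auto)
  have above: "finite {E \<in> T. e < E}" if "e < m" "\<And>p. D p e \<le> 0" "power_zeros (\<lambda>p. D p e)" for e
    by (rule finite_subset[OF _ kernel_energies_beyond_zero[OF that(1) disjI2[OF refl] _ that(3)]])
      (use T that(2) in auto)
  consider "condition1 D m" | "condition2 D S m" | "condition3 D S m"
    using thr unfolding threshold_condition_def by blast
  then show ?thesis
  proof cases
    case 1
    then have "D pm m > 0" unfolding condition1_def pm(1) .
    from kernel_energies_positive_threshold[OF this pm(2)] show ?thesis
      by (rule rev_finite_subset) (use T in auto)
  next
    case 2
    define e0 where "e0 = E_min S m"
    have c: "D pm m < 0" "D pM m \<ge> 0" "power_zeros (\<lambda>p. D p e0)"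
      "\<forall>p \<in> torus_cell - torus_zeros (\<lambda>p. D p e0). D p e0 > 0"
      using 2 unfolding condition2_def pm(1) pM(1) e0_def by auto
    have e0: "e0 < m" using Emin[OF c(1)] by (simp add: e0_def)
    obtain p0 where p0: "D p0 e0 = 0" using c(3) by (auto simp: power_zeros_def torus_zeros_def)
    have "\<exists>p. D p e = 0" if "e0 < e" "e < m" for e
    proof (rule D_zero_between)
      show "D p0 e \<le> 0" using D_antimono[of e0 e p0] that p0 by simp
      show "D pM e \<ge> 0" using D_antimono[of e m pM] that c(2) by simp
    qed (use that in simp)
    then have "T \<subseteq> {E \<in> T. E < e0} \<union> {e0}" using gap[of _ m e0] T by fastforce
    moreover have "finite {E \<in> T. E < e0}" by (rule below[OF e0 nonneg[OF c(4)] c(3)])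
    ultimately show ?thesis using finite_subset by blast
  next
    case 3
    define e0 e1 where "e0 = E_min S m" and "e1 = E_max S m"
    have c: "D pM m < 0" "power_zeros (\<lambda>p. D p e0)"
      "\<forall>p \<in> torus_cell - torus_zeros (\<lambda>p. D p e0). D p e0 > 0"
      "power_zeros (\<lambda>p. D p e1)"
      "\<forall>p \<in> torus_cell - torus_zeros (\<lambda>p. D p e1). D p e1 < 0"
      using 3 unfolding condition3_def pM(1) e0_def e1_def by auto
    have neg: "D pm m < 0" using pm(2)[of pM] c(1) by simp
    have e0: "e0 < m" using Emin[OF neg] by (simp add: e0_def)
    have e1: "e1 < m"
    proof -
      obtain e where e: "e < m" "D pm e = 0" using zero_below[OF neg] by blast
      then have "?Z \<noteq> {}" by (auto intro: less_imp_le)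
      then obtain e' where e': "e' \<in> ?Z" "\<And>e. e \<in> ?Z \<Longrightarrow> e \<le> e'"
        using compact_attains_sup[OF zero_energies_compact] by blast
      have "e' \<noteq> m"
      proof
        assume "e' = m"
        then obtain p where "D p m = 0" using e'(1) by auto
        then show False using pM(2)[of p] c(1) by simp
      qed
      then have "e' < m" using e'(1) by simp
      moreover have "e1 = e'"
        unfolding e1_def E_max_def using e' \<open>e' < m\<close> zero_S S_zero by (intro maximum_eqI) auto
      ultimately show ?thesis by simp
    qed
    obtain p0 where p0: "D p0 e0 = 0" using c(2) by (auto simp: power_zeros_def torus_zeros_def)
    obtain p1 where p1: "D p1 e1 = 0" using c(4) by (auto simp: power_zeros_def torus_zeros_def)
    have "\<exists>p. D p e = 0" if "e0 < e" "e < e1" for e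
    proof (rule D_zero_between)
      show "D p0 e \<le> 0" using D_antimono[of e0 e p0] that p0 e1 by simp
      show "D p1 e \<ge> 0" using D_antimono[of e e1 p1] that p1 e1 by simp
    qed (use that e1 in simp)
    then have "T \<subseteq> {E \<in> T. E < e0} \<union> {E \<in> T. e1 < E} \<union> {e0, e1}" using gap[of _ e1 e0] e1
        by fastforce
    moreover have "finite {E \<in> T. E < e0}" by (rule below[OF e0 nonneg[OF c(3)] c(2)])
    moreover have "finite {E \<in> T. e1 < E}" by (rule above[OF e1 nonpos[OF c(5)] c(4)])
    ultimately show ?thesis by (meson finite.emptyI finite_UnI finite_insert finite_subset)
  qed
qed

end

section \<open>Complex square integrable functions\<close>

definition csquare_integrable :: "'a measure \<Rightarrow> ('a \<Rightarrow> complex) \<Rightarrow> bool" where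
  "csquare_integrable M f \<longleftrightarrow> f \<in> borel_measurable M \<and> integrable M (\<lambda>x. (cmod (f x))\<^sup>2)"

lemma csquare_add:
  assumes "csquare_integrable M f" "csquare_integrable M h"
  shows "csquare_integrable M (\<lambda>x. f x + h x)"
  unfolding csquare_integrable_def
proof
  have [measurable]: "f \<in> borel_measurable M" "h \<in> borel_measurable M"
    using assms by (auto simp: csquare_integrable_def)
  show "(\<lambda>x. f x + h x) \<in> borel_measurable M" by measurable
  show "integrable M (\<lambda>x. (cmod (f x + h x))\<^sup>2)"
  proof (rule Bochner_Integration.integrable_bound)
    show "integrable M (\<lambda>x. 2 * (cmod (f x))\<^sup>2 + 2 * (cmod (h x))\<^sup>2)"
      using assms by (simp add: csquare_integrable_def)
    have "(cmod (f x + h x))\<^sup>2 \<le> 2 * (cmod (f x))\<^sup>2 + 2 * (cmod (h x))\<^sup>2" for x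
    proof -
      have "(cmod (f x + h x))\<^sup>2 \<le> (cmod (f x) + cmod (h x))\<^sup>2"
        by (intro power_mono norm_triangle_ineq) auto
      also have "\<dots> \<le> 2 * (cmod (f x))\<^sup>2 + 2 * (cmod (h x))\<^sup>2"
        using sum_squares_bound[of "cmod (f x)" "cmod (h x)"] by (simp add: power2_sum)
      finally show ?thesis .
    qed
    then show "AE x in M. norm ((cmod (f x + h x))\<^sup>2) \<le> norm (2 * (cmod (f x))\<^sup>2 + 2 * (cmod (h x))\<^sup>2)"
      by (intro AE_I2) (simp add: abs_of_nonneg)
  qed measurable
qed

lemma csquare_bounded_mult:
  assumes f: "csquare_integrable M f" and b: "b \<in> borel_measurable M" "\<And>x. cmod (b x) \<le> C"
  shows "csquare_integrable M (\<lambda>x. b x * f x)"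
  unfolding csquare_integrable_def
proof
  have [measurable]: "f \<in> borel_measurable M" "b \<in> borel_measurable M"
    using assms by (auto simp: csquare_integrable_def)
  show "(\<lambda>x. b x * f x) \<in> borel_measurable M" by measurable
  show "integrable M (\<lambda>x. (cmod (b x * f x))\<^sup>2)"
  proof (rule Bochner_Integration.integrable_bound)
    show "integrable M (\<lambda>x. C\<^sup>2 * (cmod (f x))\<^sup>2)"
      using f by (simp add: csquare_integrable_def)
    have "(cmod (b x * f x))\<^sup>2 \<le> C\<^sup>2 * (cmod (f x))\<^sup>2" for x
      unfolding norm_mult power_mult_distrib by (intro mult_right_mono power_mono b) auto
    then show "AE x in M. norm ((cmod (b x * f x))\<^sup>2) \<le> norm (C\<^sup>2 * (cmod (f x))\<^sup>2)"
      by (intro AE_I2) (simp add: abs_of_nonneg)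
  qed measurable
qed

lemma csquare_cmult: "csquare_integrable M f \<Longrightarrow> csquare_integrable M (\<lambda>x. c * f x)"
  by (rule csquare_bounded_mult[where C = "cmod c"]) auto

lemma csquare_diff:
  assumes "csquare_integrable M f" "csquare_integrable M h"
  shows "csquare_integrable M (\<lambda>x. f x - h x)"
  using csquare_add[OF assms(1) csquare_cmult[OF assms(2), of "- 1"]] by simp

lemma csquare_mult_integrable:
  assumes "csquare_integrable M f" "csquare_integrable M h"
  shows "integrable M (\<lambda>x. f x * h x)"
proof (rule Bochner_Integration.integrable_bound)
  show "integrable M (\<lambda>x. (cmod (f x))\<^sup>2 + (cmod (h x))\<^sup>2)"
    using assms by (simp add: csquare_integrable_def)
  show "(\<lambda>x. f x * h x) \<in> borel_measurable M"
    using assms by (intro borel_measurable_times) (auto simp: csquare_integrable_def)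
  show "AE x in M. norm (f x * h x) \<le> norm ((cmod (f x))\<^sup>2 + (cmod (h x))\<^sup>2)"
    using abs_mult_le_squares[of "cmod (f _)" "cmod (h _)"] by (intro AE_I2) (simp add: norm_mult)
qed

lemma csquare_null_iff:
  assumes "csquare_integrable M f"
  shows "(\<integral>x. (cmod (f x))\<^sup>2 \<partial>M) = 0 \<longleftrightarrow> (AE x in M. f x = 0)"
proof -
  have "(\<integral>x. (cmod (f x))\<^sup>2 \<partial>M) = 0 \<longleftrightarrow> (AE x in M. (cmod (f x))\<^sup>2 = 0)"
    using assms by (intro integral_nonneg_eq_0_iff_AE) (auto simp: csquare_integrable_def)
  then show ?thesis by simp
qed

lemma csquare_Cauchy_Schwarz:
  assumes f: "csquare_integrable M f" and h: "csquare_integrable M h"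
  shows "(cmod (\<integral>x. f x * h x \<partial>M))\<^sup>2 \<le> (\<integral>x. (cmod (f x))\<^sup>2 \<partial>M) * (\<integral>x. (cmod (h x))\<^sup>2 \<partial>M)"
proof -
  define F H G where "F = (\<integral>x. (cmod (f x))\<^sup>2 \<partial>M)" and "H = (\<integral>x. (cmod (h x))\<^sup>2 \<partial>M)"
    and "G = (\<integral>x. cmod (f x) * cmod (h x) \<partial>M)"
  have i: "integrable M (\<lambda>x. (cmod (f x))\<^sup>2)" "integrable M (\<lambda>x. (cmod (h x))\<^sup>2)"
    using f h by (auto simp: csquare_integrable_def)
  have iG: "integrable M (\<lambda>x. cmod (f x) * cmod (h x))"
    using integrable_norm[OF csquare_mult_integrable[OF f h]] by (simp add: norm_mult)
  have q: "0 \<le> s\<^sup>2 * F - 2 * s * t * G + t\<^sup>2 * H" for s t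
  proof -
    have "0 \<le> (\<integral>x. (s * cmod (f x) - t * cmod (h x))\<^sup>2 \<partial>M)" by simp
    also have "\<dots> = (\<integral>x. s\<^sup>2 * (cmod (f x))\<^sup>2 - 2 * s * t * (cmod (f x) * cmod (h x))
        + t\<^sup>2 * (cmod (h x))\<^sup>2 \<partial>M)"
      by (intro Bochner_Integration.integral_cong) (auto simp: power2_eq_square algebra_simps)
    also have "\<dots> = s\<^sup>2 * F - 2 * s * t * G + t\<^sup>2 * H"
      unfolding F_def G_def H_def using i iG by simp
    finally show ?thesis .
  qed
  have pos: "F \<ge> 0" "H \<ge> 0" "G \<ge> 0" by (auto simp: F_def H_def G_def)
  have "G\<^sup>2 \<le> F * H"
  proof (cases "H = 0")
    case True
    have "G = 0"
    proof (rule ccontr)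
      assume "G \<noteq> 0"
      then have "G > 0" using pos by simp
      have "0 \<le> F - 2 * ((F + 1) / (2 * G)) * G" using q[of 1 "(F + 1) / (2 * G)"] True by simp
      then show False using \<open>G > 0\<close> by simp
    qed
    then show ?thesis using pos by simp
  next
    case False
    have "0 \<le> H * (F * H - G\<^sup>2)" using q[of H G] by (simp add: power2_eq_square algebra_simps)
    then show ?thesis using False pos by (simp add: zero_le_mult_iff)
  qed
  moreover have "cmod (\<integral>x. f x * h x \<partial>M) \<le> G"
    unfolding G_def using integral_norm_bound[of M "\<lambda>x. f x * h x"] by (simp add: norm_mult)
  then have "(cmod (\<integral>x. f x * h x \<partial>M))\<^sup>2 \<le> G\<^sup>2" by (intro power_mono) auto
  ultimately show ?thesis unfolding F_def H_def by simp
qed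

lemma csquare_integral_add_le:
  assumes "csquare_integrable M f" "csquare_integrable M h"
  shows "(\<integral>x. (cmod (f x + h x))\<^sup>2 \<partial>M) \<le> 2 * (\<integral>x. (cmod (f x))\<^sup>2 \<partial>M) + 2 * (\<integral>x. (cmod (h x))\<^sup>2 \<partial>M)"
proof -
  have i: "integrable M (\<lambda>x. (cmod (f x))\<^sup>2)" "integrable M (\<lambda>x. (cmod (h x))\<^sup>2)" "integrable M (\<lambda>x.
      (cmod (f x + h x))\<^sup>2)"
    using assms csquare_add[OF assms] by (auto simp: csquare_integrable_def)
  have "(\<integral>x. (cmod (f x + h x))\<^sup>2 \<partial>M) \<le> (\<integral>x. 2 * (cmod (f x))\<^sup>2 + 2 * (cmod (h x))\<^sup>2 \<partial>M)"
  proof (rule integral_mono)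
    fix x
    have "(cmod (f x + h x))\<^sup>2 \<le> (cmod (f x) + cmod (h x))\<^sup>2"
      by (intro power_mono norm_triangle_ineq) auto
    also have "\<dots> \<le> 2 * (cmod (f x))\<^sup>2 + 2 * (cmod (h x))\<^sup>2"
      using sum_squares_bound[of "cmod (f x)" "cmod (h x)"] by (simp add: power2_sum)
    finally show "(cmod (f x + h x))\<^sup>2 \<le> 2 * (cmod (f x))\<^sup>2 + 2 * (cmod (h x))\<^sup>2" .
  qed (use i in auto)
  then show ?thesis using i by simp
qed

lemma csquare_integral_mult_le:
  assumes "csquare_integrable M f" "b \<in> borel_measurable M" "\<And>x. cmod (b x) \<le> C"
  shows "(\<integral>x. (cmod (b x * f x))\<^sup>2 \<partial>M) \<le> C\<^sup>2 * (\<integral>x. (cmod (f x))\<^sup>2 \<partial>M)"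
proof -
  have "(\<integral>x. (cmod (b x * f x))\<^sup>2 \<partial>M) \<le> (\<integral>x. C\<^sup>2 * (cmod (f x))\<^sup>2 \<partial>M)"
  proof (rule integral_mono)
    show "(cmod (b x * f x))\<^sup>2 \<le> C\<^sup>2 * (cmod (f x))\<^sup>2" for x
      unfolding norm_mult power_mult_distrib by (intro mult_right_mono power_mono assms) auto
  qed (use assms csquare_bounded_mult[OF assms] in \<open>auto simp: csquare_integrable_def\<close>)
  then show ?thesis by simp
qed

section \<open>Eigenvalues of the generalized Friedrichs models\<close>

lemma L2_torusD:
  assumes "f \<in> L2_torus"
  shows "torus_fun f" "f \<in> borel_measurable borel" "csquare_integrable \<mu> f"
  using assms by (auto simp: L2_torus_def csquare_integrable_def intro: measurable_torus)

lemma L2_torusI: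
  "torus_fun f \<Longrightarrow> f \<in> borel_measurable borel \<Longrightarrow> csquare_integrable \<mu> f \<Longrightarrow> f \<in> L2_torus"
  by (simp add: L2_torus_def csquare_integrable_def)

lemma zero_in_L2_torus: "(\<lambda>_. 0) \<in> L2_torus"
  by (simp add: L2_torus_def torus_fun_def)

text \<open>
  A bounded inverse sends 0 to a null vector, but it also has to send \<open>A f - z f = 0\<close> to \<open>f\<close>.
\<close>

lemma eigenvector_in_spectrum:
  assumes "A f - cscale X z f = 0" "f \<in> vectors X" "0 \<in> vectors X" "seminorm X 0 = 0"
    and nonneg: "\<And>r. seminorm X r \<ge> 0"
    and ne: "\<And>r. r \<in> vectors X \<Longrightarrow> seminorm X r = 0 \<Longrightarrow> seminorm X (r - f) = 0 \<Longrightarrow> False"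
  shows "z \<in> spectrum X A"
proof (rule ccontr)
  assume "z \<notin> spectrum X A"
  then obtain R K where "\<And>g. g \<in> vectors X \<Longrightarrow> R g \<in> vectors X \<and> seminorm X (R g) \<le> K * seminorm X g"
    "\<And>f. f \<in> vectors X \<Longrightarrow> seminorm X (R (A f - cscale X z f) - f) = 0"
    unfolding spectrum_def resolvent_set_def by blast
  from this(1)[OF assms(3)] this(2)[OF assms(2)] show False
    using ne[of "R 0"] nonneg[of "R 0"] assms(1,4) by simp
qed

context pencil
begin

text \<open>
  The analogues of \<open>res\<close> and \<open>D\<close> for a complex spectral parameter, which are needed because
      isolation
  of an eigenvalue is a statement about a complex neighbourhood.
\<close>

definition cres :: "R3 \<Rightarrow> complex \<Rightarrow> R3 \<Rightarrow> complex" where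
  "cres p z s = 1 / (of_real (w2 (p, s)) - z)"

definition cD :: "R3 \<Rightarrow> complex \<Rightarrow> complex" where
  "cD p z = of_real (a p) - of_real \<tau> * z - of_real \<kappa> * (\<integral>s. of_real (v s) * (of_real (v s) * cres
      p z s) \<partial>\<mu>)"

lemma cres_bound:
  assumes "Re z < m"
  shows "cmod (cres p z s) \<le> 1 / (m - Re z)" and "of_real (w2 (p, s)) - z \<noteq> 0"
proof -
  have 1: "m - Re z \<le> cmod (of_real (w2 (p, s)) - z)"
    using m_le[of "(p, s)"] complex_Re_le_cmod[of "of_real (w2 (p, s)) - z"] by simp
  then show "of_real (w2 (p, s)) - z \<noteq> 0" using assms by auto
  show "cmod (cres p z s) \<le> 1 / (m - Re z)"
    unfolding cres_def norm_divide using frac_le[OF _ _ _ 1, of 1 1] assms by simp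
qed

lemma cres_borel [measurable]: "cres p z \<in> borel_measurable borel"
proof -
  have [measurable]: "(\<lambda>s. w2 (p, s)) \<in> borel_measurable borel"
    by (intro borel_measurable_continuous_onI continuous_on_compose2[OF w2_cont]
        continuous_intros) auto
  show ?thesis unfolding cres_def[abs_def] by measurable
qed

lemma v_borel [measurable]: "v \<in> borel_measurable borel"
  by (rule borel_measurable_continuous_onI[OF v_cont])

lemma cres_torus: "torus_fun (cres p z)"
  using w2_torus by (simp add: cres_def torus_fun2_def torus_fun_def)

lemma cres_real: "cres p (of_real E) s = of_real (res E (p, s))"
  by (simp add: cres_def res_def)

lemma csquare_v: "csquare_integrable \<mu> (\<lambda>s. of_real (v s))"
  using v_square by (auto simp: csquare_integrable_def square_integrable_def)

lemma csquare_v_mult: "csquare_integrable \<mu> f \<Longrightarrow> csquare_integrable \<mu> (\<lambda>s. of_real (v s) * f s)"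
proof -
  assume f: "csquare_integrable \<mu> f"
  obtain C where "\<And>p. \<bar>v p\<bar> \<le> C" using torus_fun_bounded[OF v_torus v_cont] by blast
  then show ?thesis by (intro csquare_bounded_mult[OF f, where C = C]) auto
qed

lemma csquare_cres_mult: "Re z < m \<Longrightarrow> csquare_integrable \<mu> f
    \<Longrightarrow> csquare_integrable \<mu> (\<lambda>s. cres p z s * f s)"
  by (rule csquare_bounded_mult[where C = "1 / (m - Re z)"]) (use cres_bound in auto)

lemma csquare_w2_mult:
  assumes "csquare_integrable \<mu> f"
  shows "csquare_integrable \<mu> (\<lambda>q. of_real (w2 (p, q)) * f q)"
proof -
  have c: "continuous_on UNIV (\<lambda>q. w2 (p, q))"
    by (intro continuous_on_compose2[OF w2_cont] continuous_intros) auto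
  have t: "torus_fun (\<lambda>q. w2 (p, q))" using w2_torus by (simp add: torus_fun2_def)
  obtain C where C: "\<And>q. \<bar>w2 (p, q)\<bar> \<le> C" using torus_fun_bounded[OF t c] by blast
  have [measurable]: "(\<lambda>q. w2 (p, q)) \<in> borel_measurable \<mu>"
      by (rule continuous_torus_measurable[OF c])
  show ?thesis by (rule csquare_bounded_mult[OF assms, where C = C]) (use C in auto)
qed

lemma csquare_v_cres: "Re z < m \<Longrightarrow> csquare_integrable \<mu> (\<lambda>s. of_real (v s) * cres p z s)"
  using csquare_cres_mult[OF _ csquare_v, of z p] by (simp add: mult.commute)

lemma cD_real:
  assumes "E < m"
  shows "cD p (of_real E) = of_real (D p E)"
proof -
  have "(\<integral>s. of_real (v s) * (of_real (v s) * cres p (of_real E) s) \<partial>\<mu>)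
      = (\<integral>s. complex_of_real (res E (p, s) * (v s)\<^sup>2) \<partial>\<mu>)"
    by (intro Bochner_Integration.integral_cong) (auto simp: cres_real power2_eq_square)
  also have "\<dots> = of_real (\<integral>s. res E (p, s) * (v s)\<^sup>2 \<partial>\<mu>)"
    by (rule integral_complex_of_real)
  finally show ?thesis by (simp add: cD_def D_res)
qed

text \<open>
  The difference quotient of \<open>- cD\<close> at a real zero has positive real part on the whole half-plane to
  the left of \<open>m\<close>, so the zero is the only one there, and the eigenvalue is isolated.
\<close>

lemma cD_nonzero:
  assumes E: "E < m" "D p E = 0" and z: "Re z < m" "z \<noteq> of_real E"
  shows "cD p z \<noteq> 0"
proof -
  let ?r = "\<lambda>s. res E (p, s)"
  let ?q = "\<lambda>s. of_real (v s) * (of_real (v s) * (cres p z s * of_real (?r s)))"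
  have EC: "Re (complex_of_real E) < m" using E by simp
  have r_csq: "csquare_integrable \<mu> (\<lambda>s. of_real (v s) * of_real (?r s))"
    using csquare_v_cres[OF EC, of p] by (simp add: cres_real)
  have iz: "integrable \<mu> (\<lambda>s. of_real (v s) * (of_real (v s) * cres p z s))"
    by (rule csquare_mult_integrable[OF csquare_v csquare_v_cres[OF z(1)]])
  have iE: "integrable \<mu> (\<lambda>s. complex_of_real (v s) * (of_real (v s) * of_real (?r s)))"
    by (rule csquare_mult_integrable[OF csquare_v r_csq])
  have iq: "integrable \<mu> ?q"
    using csquare_mult_integrable[OF csquare_v csquare_cres_mult[OF z(1) r_csq]]
        by (simp add: ac_simps)
  have r_pos: "?r s > 0" for s using m_le[of "(p, s)"] E by (simp add: res_def)
  have c_pos: "Re (cres p z s) > 0" for s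
  proof -
    have "Re (of_real (w2 (p, s)) - z) > 0" using m_le[of "(p, s)"] z by simp
    then show ?thesis unfolding cres_def using cres_bound(2)[OF z(1), of p s]
      by (simp add: Re_divide_numeral complex_div_gt_0 Re_divide sum_power2_gt_zero_iff)
  qed
  have "cD p (of_real E) = 0" using cD_real E by simp
  then have "cD p z = cD p z - cD p (of_real E)" by simp
  also have "\<dots> = - of_real \<tau> * (z - of_real E) - of_real \<kappa> *
      ((\<integral>s. of_real (v s) * (of_real (v s) * cres p z s) \<partial>\<mu>) - (\<integral>s. of_real (v s) * (of_real (v s)
          * of_real (?r s)) \<partial>\<mu>))"
    unfolding cD_def cres_real by (simp add: algebra_simps)
  also have "(\<integral>s. of_real (v s) * (of_real (v s) * cres p z s) \<partial>\<mu>) - (\<integral>s. of_real (v s) * (of_real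
      (v s) * of_real (?r s)) \<partial>\<mu>) =
      (\<integral>s. of_real (v s) * (of_real (v s) * cres p z s) - of_real (v s) * (of_real (v s) * of_real
          (?r s)) \<partial>\<mu>)"
    using iz iE by simp
  also have "\<dots> = (\<integral>s. (z - of_real E) * ?q s \<partial>\<mu>)"
  proof (rule Bochner_Integration.integral_cong[OF refl])
    fix s
    have "cres p z s - of_real (?r s) = (z - of_real E) * (cres p z s * of_real (?r s))"
      using cres_bound(2)[OF z(1), of p s] cres_bound(2)[OF EC, of p s]
      unfolding cres_real[symmetric] cres_def by (simp add: field_simps)
    then show "of_real (v s) * (of_real (v s) * cres p z s) - of_real (v s) * (of_real (v s) *
        of_real (?r s)) =
        (z - of_real E) * ?q s"
      by (simp add: right_diff_distrib[symmetric] ac_simps)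
  qed
  also have "\<dots> = (z - of_real E) * (\<integral>s. ?q s \<partial>\<mu>)" by simp
  finally have *: "cD p z = - (z - of_real E) * (of_real \<tau> + of_real \<kappa> * (\<integral>s. ?q s \<partial>\<mu>))"
    by (simp add: algebra_simps)
  have Re_q: "Re (?q s) = (v s)\<^sup>2 * (Re (cres p z s) * ?r s)" for s
    by (simp add: power2_eq_square)
  have iRe: "integrable \<mu> (\<lambda>s. (v s)\<^sup>2 * (Re (cres p z s) * ?r s))"
    using integrable_Re[OF iq] unfolding Re_q .
  have nn: "AE s in \<mu>. 0 \<le> (v s)\<^sup>2 * (Re (cres p z s) * ?r s)"
    using c_pos r_pos by (intro AE_I2) (simp add: less_imp_le)
  have Re_int: "Re (\<integral>s. ?q s \<partial>\<mu>) = (\<integral>s. (v s)\<^sup>2 * (Re (cres p z s) * ?r s) \<partial>\<mu>)"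
    using integral_Re[OF iq] unfolding Re_q by simp
  have ge0: "Re (\<integral>s. ?q s \<partial>\<mu>) \<ge> 0" unfolding Re_int by (rule integral_nonneg_AE[OF nn])
  have "Re (of_real \<tau> + of_real \<kappa> * (\<integral>s. ?q s \<partial>\<mu>)) > 0"
  proof (cases "\<tau> = 1")
    case True
    then show ?thesis using ge0 \<kappa>_pos by (simp add: add_pos_nonneg)
  next
    case False
    then have \<tau>: "\<tau> = 0" "a p = 1" using \<tau>_cases by auto
    have "Re (\<integral>s. ?q s \<partial>\<mu>) \<noteq> 0"
    proof
      assume "Re (\<integral>s. ?q s \<partial>\<mu>) = 0"
      then have "AE s in \<mu>. (v s)\<^sup>2 * (Re (cres p z s) * ?r s) = 0"
        unfolding Re_int using integral_nonneg_eq_0_iff_AE[OF iRe nn] by simp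
      then have "AE s in \<mu>. ?r s * (v s)\<^sup>2 = 0"
      proof eventually_elim
        case (elim s)
        then show ?case using c_pos[of s] r_pos[of s] by auto
      qed
      then have "(\<integral>s. ?r s * (v s)\<^sup>2 \<partial>\<mu>) = 0" by (rule integral_eq_zero_AE)
      then show False using E(2) \<tau> unfolding D_res by simp
    qed
    then show ?thesis using ge0 \<kappa>_pos \<tau> by simp
  qed
  then have "of_real \<tau> + of_real \<kappa> * (\<integral>s. ?q s \<partial>\<mu>) \<noteq> 0" by (metis less_irrefl zero_complex.sel(1))
  moreover have "z - of_real E \<noteq> 0" using z(2) by simp
  ultimately show ?thesis unfolding * by (simp only: mult_eq_0_iff neg_equal_0_iff_equal) simp
qed

abbreviation (input) r2 :: complex where "r2 \<equiv> of_real (1 / sqrt 2)"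

lemma r2_square: "r2 * r2 = 1 / 2"
proof -
  have "r2 * r2 = of_real (1 / sqrt 2 * (1 / sqrt 2))" by (simp only: of_real_mult)
  also have "1 / sqrt 2 * (1 / sqrt 2) = (1 / 2 :: real)" by simp
  finally show ?thesis by simp
qed

lemma cmod_r2: "(cmod r2)\<^sup>2 = 1 / 2"
  by (simp add: norm_divide power_divide)

text \<open>
  The second line of \<open>(h1 p - z) f = g\<close> gives the function component in terms of the scalar one;
  inserting it in the first line leaves \<open>cD p z\<close> times the scalar component.
\<close>

lemma h1_resolvent:
  assumes par: "\<tau> = 1" "\<kappa> = 1 / 2" and z: "Re z < m" and D0: "cD p z \<noteq> 0"
  shows "z \<in> resolvent_set C_L2_space (h1 a w2 v p)"
proof -
  define I where "I g = (\<integral>s. (of_real (v s) * cres p z s) * g s \<partial>\<mu>)" for g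
  define f0 where "f0 g0 g1 = (g0 - r2 * I g1) / cD p z" for g0 g1
  define f1 where "f1 g0 g1 q = cres p z q * (g1 q - r2 * (of_real (v q) * f0 g0 g1))" for g0 g1 q
  define P where "P = (\<integral>s. (cmod (of_real (v s) * cres p z s))\<^sup>2 \<partial>\<mu>)"
  define V where "V = (\<integral>s. (cmod (of_real (v s)))\<^sup>2 \<partial>\<mu>)"
  define d where "d = 1 / (m - Re z)"
  define Q where "Q = (2 + P) / (cmod (cD p z))\<^sup>2"
  define K where "K = Q + d\<^sup>2 * (2 + Q * V)"
  have pos: "P \<ge> 0" "V \<ge> 0" "Q \<ge> 0" "K \<ge> 0" by (simp_all add: P_def V_def Q_def K_def)
  have csq1: "csquare_integrable \<mu> (\<lambda>q. g1 q - r2 * (of_real (v q) * c))"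
      if "csquare_integrable \<mu> g1" for g1 c
    using that csquare_v_mult[of "\<lambda>_. c"]
    by (intro csquare_diff csquare_cmult) (auto simp: csquare_integrable_def)
  have f1_csq: "csquare_integrable \<mu> (f1 g0 g1)" if "csquare_integrable \<mu> g1" for g0 g1
    unfolding f1_def[abs_def] by (rule csquare_cres_mult[OF z csq1[OF that]])
  have f1_L2: "f1 g0 g1 \<in> L2_torus" if g: "g1 \<in> L2_torus" for g0 g1
  proof (rule L2_torusI)
    show "torus_fun (f1 g0 g1)"
      using L2_torusD(1)[OF g] cres_torus[of p z] v_torus by (simp add: f1_def torus_fun_def)
    show "f1 g0 g1 \<in> borel_measurable borel"
      using L2_torusD(2)[OF g] unfolding f1_def[abs_def] by measurable
  qed (rule f1_csq[OF L2_torusD(3)[OF g]])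
  have v_int: "(\<integral>s. of_real (v s) * f1 g0 g1 s \<partial>\<mu>) = I g1 - r2 * f0 g0 g1 * (\<integral>s. of_real (v s) *
      (of_real (v s) * cres p z s) \<partial>\<mu>)"
    if g: "csquare_integrable \<mu> g1" for g0 g1
  proof -
    have "(\<integral>s. of_real (v s) * f1 g0 g1 s \<partial>\<mu>) = (\<integral>s. (of_real (v s) * cres p z s) * g1 s -
        r2 * f0 g0 g1 * (of_real (v s) * (of_real (v s) * cres p z s)) \<partial>\<mu>)"
      unfolding f1_def by (intro Bochner_Integration.integral_cong refl) (simp add: algebra_simps)
    also have "\<dots> = I g1 - r2 * f0 g0 g1 * (\<integral>s. of_real (v s) * (of_real (v s) * cres p z s) \<partial>\<mu>)"
      using csquare_mult_integrable[OF csquare_v_cres[OF z] g, of p]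
        csquare_mult_integrable[OF csquare_v csquare_v_cres[OF z], of p]
      unfolding I_def by (subst Bochner_Integration.integral_diff) auto
    finally show ?thesis .
  qed
  have cD_eq: "(of_real (a p) - z) - (r2 * r2) * (\<integral>s. of_real (v s) * (of_real (v s) * cres p z s)
      \<partial>\<mu>) = cD p z"
    unfolding r2_square cD_def by (simp add: par)
  have cres_inv: "(of_real (w2 (p, q)) - z) * cres p z q = 1" for q
    using cres_bound(2)[OF z, of p q] by (simp add: cres_def)
  show ?thesis unfolding resolvent_set_def mem_Collect_eq
  proof (intro exI[of _ "\<lambda>(g0, g1). (f0 g0 g1, f1 g0 g1)"] exI[of _ "sqrt K"] conjI ballI)
    fix g assume "g \<in> vectors C_L2_space"
    then obtain g0 g1 where g: "g = (g0, g1)" "g1 \<in> L2_torus" by (auto simp: C_L2_space_def)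
    note gc = L2_torusD(3)[OF g(2)]
    show "(case g of (g0, g1) \<Rightarrow> (f0 g0 g1, f1 g0 g1)) \<in> vectors C_L2_space"
      using f1_L2 g by (simp add: C_L2_space_def)
    define n where "n = (cmod g0)\<^sup>2 + (\<integral>q. (cmod (g1 q))\<^sup>2 \<partial>\<mu>)"
    have n: "(cmod g0)\<^sup>2 \<le> n" "(\<integral>q. (cmod (g1 q))\<^sup>2 \<partial>\<mu>) \<le> n" by (simp_all add: n_def)
    have n0: "n \<ge> 0" by (simp add: n_def)
    have "(cmod (I g1))\<^sup>2 \<le> P * (\<integral>q. (cmod (g1 q))\<^sup>2 \<partial>\<mu>)"
      unfolding I_def P_def by (rule csquare_Cauchy_Schwarz[OF csquare_v_cres[OF z] gc])
    also have "\<dots> \<le> P * n" using n pos by (intro mult_left_mono) auto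
    finally have I: "(cmod (I g1))\<^sup>2 \<le> P * n" .
    have f0b: "(cmod (f0 g0 g1))\<^sup>2 \<le> Q * n"
    proof -
      have "(cmod (g0 - r2 * I g1))\<^sup>2 \<le> (cmod g0 + cmod (r2 * I g1))\<^sup>2"
        by (intro power_mono norm_triangle_ineq4) auto
      also have "\<dots> \<le> 2 * (cmod g0)\<^sup>2 + 2 * (cmod (r2 * I g1))\<^sup>2"
        using sum_squares_bound[of "cmod g0" "cmod (r2 * I g1)"] by (simp add: power2_sum)
      also have "\<dots> = 2 * (cmod g0)\<^sup>2 + (cmod (I g1))\<^sup>2"
        unfolding norm_mult power_mult_distrib cmod_r2 by simp
      also have "\<dots> \<le> (2 + P) * n" using n(1) I by (simp add: distrib_right)
      finally have "(cmod (g0 - r2 * I g1))\<^sup>2 \<le> (2 + P) * n" .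
      then have "(cmod (g0 - r2 * I g1))\<^sup>2 / (cmod (cD p z))\<^sup>2 \<le> (2 + P) * n / (cmod (cD p z))\<^sup>2"
        by (intro divide_right_mono) auto
      then show ?thesis by (simp add: f0_def norm_divide power_divide Q_def)
    qed
    have f1b: "(\<integral>q. (cmod (f1 g0 g1 q))\<^sup>2 \<partial>\<mu>) \<le> d\<^sup>2 * (2 + Q * V) * n"
    proof -
      have "(\<integral>q. (cmod (f1 g0 g1 q))\<^sup>2 \<partial>\<mu>) \<le> d\<^sup>2 * (\<integral>q. (cmod (g1 q - r2 * (of_real (v q) * f0 g0
          g1)))\<^sup>2 \<partial>\<mu>)"
        unfolding f1_def d_def by (rule csquare_integral_mult_le[OF csq1[OF gc]]) (use
            cres_bound(1)[OF z] in auto)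
      also have "(\<integral>q. (cmod (g1 q - r2 * (of_real (v q) * f0 g0 g1)))\<^sup>2 \<partial>\<mu>) \<le>
          2 * (\<integral>q. (cmod (g1 q))\<^sup>2 \<partial>\<mu>) + 2 * (\<integral>q. (cmod ((- r2 * f0 g0 g1) * of_real (v q)))\<^sup>2 \<partial>\<mu>)"
        using csquare_integral_add_le[OF gc csquare_cmult[OF csquare_v, of "- r2 * f0 g0 g1"]]
            by (simp add: ac_simps)
      also have "(\<integral>q. (cmod ((- r2 * f0 g0 g1) * of_real (v q)))\<^sup>2 \<partial>\<mu>)
          = (1 / 2 * (cmod (f0 g0 g1))\<^sup>2) * V"
        unfolding norm_mult norm_minus_cancel power_mult_distrib cmod_r2 V_def by simp
      also have "2 * (\<integral>q. (cmod (g1 q))\<^sup>2 \<partial>\<mu>) + 2 * ((1 / 2 * (cmod (f0 g0 g1))\<^sup>2) * V) \<le> 2 * n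
          + (Q * n) * V"
        using n(2) mult_right_mono[OF f0b pos(2)] by simp
      also have "\<dots> = (2 + Q * V) * n" by (simp add: algebra_simps)
      finally show ?thesis by (simp add: mult_left_mono mult.assoc)
    qed
    have "(cmod (f0 g0 g1))\<^sup>2 + (\<integral>q. (cmod (f1 g0 g1 q))\<^sup>2 \<partial>\<mu>) \<le> K * n"
      using f0b f1b by (simp add: K_def distrib_right)
    then show "seminorm C_L2_space (case g of (g0, g1) \<Rightarrow> (f0 g0 g1, f1 g0 g1))
        \<le> sqrt K * seminorm C_L2_space g"
      unfolding g(1) by (simp add: C_L2_space_def n_def real_sqrt_mult[symmetric])
    have "of_real (a p) * f0 g0 g1 + r2 * (\<integral>s. of_real (v s) * f1 g0 g1 s \<partial>\<mu>) - z * f0 g0 g1 - g0 =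
        ((of_real (a p) - z) - (r2 * r2) * (\<integral>s. of_real (v s) * (of_real (v s) * cres p z s) \<partial>\<mu>))
            * f0 g0 g1 + r2 * I g1 - g0"
      unfolding v_int[OF gc] by (simp add: algebra_simps)
    also have "\<dots> = 0" unfolding cD_eq using D0 by (simp add: f0_def)
    finally have c0: "of_real (a p) * f0 g0 g1 + r2 * (\<integral>s. of_real (v s) * f1 g0 g1 s \<partial>\<mu>) - z * f0
        g0 g1 - g0 = 0" .
    have c1: "r2 * of_real (v q) * f0 g0 g1 + of_real (w2 (p, q)) * f1 g0 g1 q - z * f1 g0 g1 q -
        g1 q = 0" for q
    proof -
      have "r2 * of_real (v q) * f0 g0 g1 + of_real (w2 (p, q)) * f1 g0 g1 q - z * f1 g0 g1 q - g1
          q =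
          r2 * (of_real (v q) * f0 g0 g1) + ((of_real (w2 (p, q)) - z) * cres p z q) * (g1 q - r2
              * (of_real (v q) * f0 g0 g1)) - g1 q"
        unfolding f1_def by (simp add: algebra_simps)
      then show ?thesis unfolding cres_inv by simp
    qed
    show "seminorm C_L2_space (h1 a w2 v p (case g of (g0, g1) \<Rightarrow> (f0 g0 g1, f1 g0 g1)) -
        cscale C_L2_space z (case g of (g0, g1) \<Rightarrow> (f0 g0 g1, f1 g0 g1)) - g) = 0"
      using c0 c1 unfolding g(1) h1_def C_L2_space_def by simp
  next
    fix f assume "f \<in> vectors C_L2_space"
    then obtain k0 k1 where f: "f = (k0, k1)" "k1 \<in> L2_torus" by (auto simp: C_L2_space_def)
    note kc = L2_torusD(3)[OF f(2)]
    define g0 where "g0 = of_real (a p) * k0 + r2 * (\<integral>s. of_real (v s) * k1 s \<partial>\<mu>) - z * k0"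
    define g1 where "g1 q = r2 * of_real (v q) * k0 + of_real (w2 (p, q)) * k1 q - z * k1 q" for q
    have g: "h1 a w2 v p f - cscale C_L2_space z f = (g0, g1)"
      unfolding f(1) h1_def C_L2_space_def by (simp add: g0_def g1_def fun_eq_iff)
    have cg: "cres p z q * g1 q = r2 * k0 * (of_real (v q) * cres p z q) + k1 q" for q
    proof -
      have "cres p z q * g1 q = r2 * k0 * (of_real (v q) * cres p z q)
          + ((of_real (w2 (p, q)) - z) * cres p z q) * k1 q"
        unfolding g1_def by (simp add: algebra_simps)
      then show ?thesis unfolding cres_inv by simp
    qed
    have "I g1 = (\<integral>s. r2 * k0 * (of_real (v s) * (of_real (v s) * cres p z s))
        + of_real (v s) * k1 s \<partial>\<mu>)"
    proof -
      have "(of_real (v s) * cres p z s) * g1 s = r2 * k0 * (of_real (v s) * (of_real (v s) * cres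
          p z s)) + of_real (v s) * k1 s" for s
      proof -
        have "(of_real (v s) * cres p z s) * g1 s = of_real (v s) * (cres p z s * g1 s)"
            by (simp add: ac_simps)
        then show ?thesis unfolding cg by (simp add: algebra_simps)
      qed
      then show ?thesis unfolding I_def by presburger
    qed
    also have "\<dots> = r2 * k0 * (\<integral>s. of_real (v s) * (of_real (v s) * cres p z s) \<partial>\<mu>)
        + (\<integral>s. of_real (v s) * k1 s \<partial>\<mu>)"
      using csquare_mult_integrable[OF csquare_v csquare_v_cres[OF z], of p]
          csquare_mult_integrable[OF csquare_v kc]
      by (subst Bochner_Integration.integral_add) auto
    finally have I: "I g1 = r2 * k0 * (\<integral>s. of_real (v s) * (of_real (v s) * cres p z s) \<partial>\<mu>)
        + (\<integral>s. of_real (v s) * k1 s \<partial>\<mu>)" .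
    have "g0 - r2 * I g1 = ((of_real (a p) - z) - (r2 * r2) * (\<integral>s. of_real (v s) * (of_real (v s)
        * cres p z s) \<partial>\<mu>)) * k0"
      unfolding I g0_def by (simp add: algebra_simps)
    then have f0: "f0 g0 g1 = k0" unfolding cD_eq f0_def using D0 by simp
    have f1: "f1 g0 g1 q = k1 q" for q
      unfolding f1_def f0 right_diff_distrib cg by (simp add: ac_simps)
    show "seminorm C_L2_space ((case h1 a w2 v p f - cscale C_L2_space z f of (g0, g1) \<Rightarrow> (f0 g0
        g1, f1 g0 g1)) - f) = 0"
      unfolding g using f0 f1 by (simp add: f(1) C_L2_space_def)
  qed
qed

lemma h1_eigenvalue:
  assumes par: "\<tau> = 1" "\<kappa> = 1 / 2" and E: "E < m" and D0: "D p E = 0"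
  shows "complex_of_real E \<in> discrete_spectrum C_L2_space (h1 a w2 v p)"
proof -
  let ?z = "complex_of_real E"
  have z: "Re ?z < m" using E by simp
  define b1 where "b1 q = - (r2 * (of_real (v q) * cres p ?z q))" for q
  let ?b = "(1 :: complex, b1)"
  have b1_L2: "b1 \<in> L2_torus"
  proof (rule L2_torusI)
    show "torus_fun b1" using cres_torus[of p ?z] v_torus by (simp add: b1_def torus_fun_def)
    show "b1 \<in> borel_measurable borel" unfolding b1_def[abs_def] by measurable
    show "csquare_integrable \<mu> b1"
      using csquare_cmult[OF csquare_v_cres[OF z], of "- r2"] unfolding b1_def[abs_def] by simp
  qed
  have cres_inv: "(of_real (w2 (p, q)) - ?z) * cres p ?z q = 1" for q
    using cres_bound(2)[OF z, of p q] by (simp add: cres_def)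
  have "(\<integral>s. of_real (v s) * b1 s \<partial>\<mu>) = (\<integral>s. - r2 * (of_real (v s) * (of_real (v s) * cres p ?z
      s)) \<partial>\<mu>)"
    unfolding b1_def by (intro Bochner_Integration.integral_cong) auto
  also have "\<dots> = - r2 * (\<integral>s. of_real (v s) * (of_real (v s) * cres p ?z s) \<partial>\<mu>)"
    by (rule integral_mult_right_zero)
  finally have "of_real (a p) + r2 * (\<integral>s. of_real (v s) * b1 s \<partial>\<mu>) - ?z =
      of_real (a p) - ?z - (r2 * r2) * (\<integral>s. of_real (v s) * (of_real (v s) * cres p ?z s) \<partial>\<mu>)"
    by (simp add: mult.assoc)
  also have "\<dots> = cD p ?z" unfolding r2_square cD_def by (simp add: par)
  also have "\<dots> = 0" using cD_real[OF E] D0 by simp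
  finally have c0: "of_real (a p) + r2 * (\<integral>s. of_real (v s) * b1 s \<partial>\<mu>) - ?z = 0" .
  have c1: "r2 * of_real (v q) + of_real (w2 (p, q)) * b1 q - ?z * b1 q = 0" for q
  proof -
    have "r2 * of_real (v q) + of_real (w2 (p, q)) * b1 q - ?z * b1 q =
        r2 * of_real (v q) - r2 * of_real (v q) * ((of_real (w2 (p, q)) - ?z) * cres p ?z q)"
      unfolding b1_def by (simp add: algebra_simps)
    then show ?thesis unfolding cres_inv by simp
  qed
  have eig: "h1 a w2 v p ?b - cscale C_L2_space ?z ?b = 0"
    using c0 c1 by (simp add: h1_def C_L2_space_def zero_prod_def fun_eq_iff)
  have in_spec: "?z \<in> spectrum C_L2_space (h1 a w2 v p)"
  proof (rule eigenvector_in_spectrum[where f = ?b])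
    show "h1 a w2 v p ?b - cscale C_L2_space ?z ?b = 0" by (rule eig)
    show "?b \<in> vectors C_L2_space" using b1_L2 by (simp add: C_L2_space_def)
    show "0 \<in> vectors C_L2_space" using zero_in_L2_torus
        by (simp add: C_L2_space_def zero_prod_def zero_fun_def)
    show "seminorm C_L2_space 0 = 0" by (simp add: C_L2_space_def zero_prod_def)
    show "seminorm C_L2_space r \<ge> 0" for r by (cases r) (simp add: C_L2_space_def)
    fix r assume r: "seminorm C_L2_space r = 0" "seminorm C_L2_space (r - ?b) = 0"
    obtain r0 r1 where r01: "r = (r0, r1)" by fastforce
    have "r0 = 0" "r0 - 1 = 0"
      using r unfolding r01 by (auto simp: C_L2_space_def add_nonneg_eq_0_iff)
    then show False by simp
  qed
  have iso: "?z isolated_in spectrum C_L2_space (h1 a w2 v p)"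
    unfolding isolated_in_dist_Ex_iff
  proof (intro conjI in_spec exI[of _ "m - E"] ballI impI)
    show "m - E > 0" using E by simp
    fix y assume y: "y \<in> spectrum C_L2_space (h1 a w2 v p)" "dist ?z y < m - E"
    have "Re y - E \<le> cmod (y - ?z)" using complex_Re_le_cmod[of "y - ?z"] by simp
    then have "Re y < m" using y(2) by (simp add: dist_norm norm_minus_commute)
    then show "y = ?z"
      using cD_nonzero[OF E D0, of y] h1_resolvent[OF par, of y p] y(1) by (auto simp: spectrum_def)
  qed
  have b_eig: "?b \<in> eigenspace C_L2_space (h1 a w2 v p) ?z"
  proof -
    have "seminorm C_L2_space (h1 a w2 v p ?b - cscale C_L2_space ?z ?b) = 0"
      unfolding eig by (simp add: C_L2_space_def zero_prod_def)
    moreover have "?b \<in> vectors C_L2_space" using b1_L2 by (simp add: C_L2_space_def)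
    ultimately show ?thesis by (simp add: eigenspace_def)
  qed
  have "finite_dim C_L2_space (eigenspace C_L2_space (h1 a w2 v p) ?z)"
    unfolding finite_dim_def
  proof (rule exI[of _ "1 :: nat"], rule exI[of _ "\<lambda>_. ?b"], intro conjI allI impI ballI)
    fix f assume "f \<in> eigenspace C_L2_space (h1 a w2 v p) ?z"
    then obtain k0 k1 where f: "f = (k0, k1)" "k1 \<in> L2_torus"
      and s: "seminorm C_L2_space (h1 a w2 v p (k0, k1) - cscale C_L2_space ?z (k0, k1)) = 0"
      by (auto simp: eigenspace_def C_L2_space_def)
    note kc = L2_torusD(3)[OF f(2)]
    let ?e = "\<lambda>q. r2 * of_real (v q) * k0 + of_real (w2 (p, q)) * k1 q - ?z * k1 q"
    have "(\<integral>q. (cmod (?e q))\<^sup>2 \<partial>\<mu>) = 0"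
      using s by (simp add: h1_def C_L2_space_def add_nonneg_eq_0_iff)
    moreover have "csquare_integrable \<mu> ?e"
    proof -
      have "csquare_integrable \<mu> (\<lambda>q. of_real (w2 (p, q)) * k1 q)"
        by (rule csquare_w2_mult[OF kc])
      moreover have "csquare_integrable \<mu> (\<lambda>q. r2 * of_real (v q) * k0)"
        using csquare_cmult[OF csquare_v, of "r2 * k0"] by (simp add: ac_simps)
      ultimately show ?thesis by (intro csquare_diff csquare_add csquare_cmult kc)
    qed
    ultimately have "AE q in \<mu>. ?e q = 0" using csquare_null_iff by blast
    then have ae: "AE q in \<mu>. k1 q - k0 * b1 q = 0"
    proof eventually_elim
      case (elim q)
      have "cres p ?z q * ?e q = r2 * of_real (v q) * k0 * cres p ?z q
          + ((of_real (w2 (p, q)) - ?z) * cres p ?z q) * k1 q"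
        by (simp add: algebra_simps)
      then show ?case unfolding cres_inv elim by (simp add: b1_def algebra_simps)
    qed
    have "seminorm C_L2_space (f - cscale C_L2_space k0 ?b) = 0"
      using ae csquare_null_iff[OF csquare_diff[OF kc csquare_cmult[OF L2_torusD(3)[OF b1_L2], of
          k0]]]
      by (simp add: f(1) C_L2_space_def)
    moreover have "(\<Sum>i<1 :: nat. cscale C_L2_space k0 ?b) = cscale C_L2_space k0 ?b"
      by (simp add: lessThan_Suc)
    ultimately show "\<exists>c. seminorm C_L2_space (f - (\<Sum>i<1::nat. cscale C_L2_space (c i) ?b)) = 0"
      by (intro exI[of _ "\<lambda>_. k0"]) (simp only:)
  qed (rule b_eig)
  moreover have "seminorm C_L2_space ?b \<noteq> 0"
    by (simp add: C_L2_space_def add_nonneg_eq_0_iff)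
  ultimately show ?thesis
    unfolding discrete_spectrum_def using iso b_eig by blast
qed

end

context pencil
begin

lemma D_complex:
  "complex_of_real (D p E) = of_real (a p) - of_real \<tau> * of_real E -
    of_real \<kappa> * (\<integral>s. of_real (v s) * (of_real (v s) * of_real (res E (p, s))) \<partial>\<mu>)"
proof -
  have "(\<integral>s. of_real (v s) * (of_real (v s) * of_real (res E (p, s))) \<partial>\<mu>)
      = (\<integral>s. complex_of_real (res E (p, s) * (v s)\<^sup>2) \<partial>\<mu>)"
    by (intro Bochner_Integration.integral_cong) (auto simp: power2_eq_square)
  also have "\<dots> = of_real (\<integral>s. res E (p, s) * (v s)\<^sup>2 \<partial>\<mu>)" by (rule integral_complex_of_real)
  finally show ?thesis by (simp add: D_res)
qed

lemma integral_v_mult_cong: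
  assumes "csquare_integrable \<mu> f" "AE q in \<mu>. f q = c * (of_real (v q) * of_real (res E (p, q)))"
  shows "(\<integral>q. of_real (v q) * f q \<partial>\<mu>) = c * (\<integral>q. of_real (v q) * (of_real (v q) * of_real (res E
      (p, q))) \<partial>\<mu>)"
proof -
  have "(\<integral>q. of_real (v q) * f q \<partial>\<mu>) = (\<integral>q. c * (of_real (v q) * (of_real (v q) * of_real (res E
      (p, q)))) \<partial>\<mu>)"
  proof (rule integral_cong_AE)
    show "(\<lambda>q. of_real (v q) * f q) \<in> borel_measurable \<mu>"
      using csquare_v_mult[OF assms(1)] by (simp add: csquare_integrable_def)
    show "AE q in \<mu>. of_real (v q) * f q = c * (of_real (v q) * (of_real (v q) * of_real (res E
        (p, q))))"
      using assms(2) by eventually_elim (simp add: ac_simps)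
  qed measurable
  then show ?thesis by simp
qed

text \<open>
  The converse includes the threshold \<open>E = m\<close>: there \<open>w2 (p, q) \<noteq> E\<close> still holds
      for almost every \<open>q\<close>, and
  the square integrability of the eigenvector comes with the eigenvector.
\<close>

lemma h1_eigenvalue_zero:
  assumes par: "\<tau> = 1" "\<kappa> = 1 / 2" and E: "E \<le> m"
    and ev: "complex_of_real E \<in> discrete_spectrum C_L2_space (h1 a w2 v p)"
  shows "D p E = 0"
proof -
  let ?z = "complex_of_real E"
  obtain k0 k1 where k1: "k1 \<in> L2_torus" and ne: "seminorm C_L2_space (k0, k1) \<noteq> 0"
    and s: "seminorm C_L2_space (h1 a w2 v p (k0, k1) - cscale C_L2_space ?z (k0, k1)) = 0"
    using ev by (auto simp: discrete_spectrum_def eigenspace_def C_L2_space_def)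
  note kc = L2_torusD(3)[OF k1]
  let ?e = "\<lambda>q. r2 * of_real (v q) * k0 + of_real (w2 (p, q)) * k1 q - ?z * k1 q"
  have c0: "of_real (a p) * k0 + r2 * (\<integral>s. of_real (v s) * k1 s \<partial>\<mu>) - ?z * k0 = 0"
    and "(\<integral>q. (cmod (?e q))\<^sup>2 \<partial>\<mu>) = 0"
    using s by (simp_all add: h1_def C_L2_space_def add_nonneg_eq_0_iff)
  moreover have "csquare_integrable \<mu> ?e"
    using csquare_cmult[OF csquare_v, of "r2 * k0"]
    by (intro csquare_diff csquare_add csquare_cmult csquare_w2_mult kc) (simp add: ac_simps)
  ultimately have "AE q in \<mu>. ?e q = 0" using csquare_null_iff by blast
  then have ae: "AE q in \<mu>. k1 q = (- r2 * k0) * (of_real (v q) * of_real (res E (p, q)))"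
    using AE_res_snd[OF E, of p]
  proof eventually_elim
    case (elim q)
    have ne: "of_real (w2 (p, q)) - ?z \<noteq> 0" using elim E by (simp flip: of_real_diff)
    have "(of_real (w2 (p, q)) - ?z) * k1 q = - r2 * k0 * of_real (v q)"
      using elim(1) by (simp add: algebra_simps add_eq_0_iff2)
    then have "k1 q = - r2 * k0 * of_real (v q) / (of_real (w2 (p, q)) - ?z)"
      unfolding nonzero_eq_divide_eq[OF ne] by (simp only: mult.commute)
    then show ?case by (simp add: res_def)
  qed
  have k0: "k0 \<noteq> 0"
  proof
    assume "k0 = 0"
    then have "AE q in \<mu>. k1 q = 0" using ae by simp
    then show False using ne \<open>k0 = 0\<close> csquare_null_iff[OF kc] by (simp add: C_L2_space_def)
  qed
  have "k0 * of_real (D p E) = of_real (a p) * k0 - ?z * k0 - (r2 * r2) * k0 * (\<integral>s. of_real (v s)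
      * (of_real (v s) * of_real (res E (p, s))) \<partial>\<mu>)"
    unfolding r2_square D_complex by (simp add: par algebra_simps)
  also have "\<dots> = 0" using c0 unfolding integral_v_mult_cong[OF kc ae] by (simp add: algebra_simps)
  finally show ?thesis using k0 by simp
qed

text \<open>
  \<open>h2 p\<close> is a rank one perturbation of a multiplication operator. Its resolvent equation determines
  \<open>\<integral>s. v s * f s\<close> up to the factor \<open>cD p z\<close>, and then \<open>f\<close>.
\<close>

lemma h2_resolvent:
  assumes par: "\<tau> = 0" "\<kappa> = 1" and z: "Re z < m" and D0: "cD p z \<noteq> 0"
  shows "z \<in> resolvent_set L2_torus_space (h2 w2 v p)"
proof -
  have a1: "a p = 1" using \<tau>_cases par by auto
  define I where "I g = (\<integral>s. (of_real (v s) * cres p z s) * g s \<partial>\<mu>)" for g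
  define c where "c g = I g / cD p z" for g
  define R where "R g q = cres p z q * (g q + of_real (v q) * c g)" for g q
  define P where "P = (\<integral>s. (cmod (of_real (v s) * cres p z s))\<^sup>2 \<partial>\<mu>)"
  define V where "V = (\<integral>s. (cmod (of_real (v s)))\<^sup>2 \<partial>\<mu>)"
  define d where "d = 1 / (m - Re z)"
  define Q where "Q = P / (cmod (cD p z))\<^sup>2"
  define K where "K = d\<^sup>2 * (2 + 2 * Q * V)"
  have pos: "P \<ge> 0" "V \<ge> 0" "Q \<ge> 0" "K \<ge> 0" by (simp_all add: P_def V_def Q_def K_def)
  have csqv: "csquare_integrable \<mu> (\<lambda>q. of_real (v q) * x)" for x
    using csquare_v_mult[of "\<lambda>_. x"] by (auto simp: csquare_integrable_def)
  have R_csq: "csquare_integrable \<mu> (R g)" if "csquare_integrable \<mu> g" for g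
    unfolding R_def[abs_def] by (intro csquare_cres_mult[OF z] csquare_add that csqv)
  have R_L2: "R g \<in> L2_torus" if g: "g \<in> L2_torus" for g
  proof (rule L2_torusI)
    show "torus_fun (R g)"
      using L2_torusD(1)[OF g] cres_torus[of p z] v_torus by (simp add: R_def torus_fun_def)
    show "R g \<in> borel_measurable borel"
      using L2_torusD(2)[OF g] unfolding R_def[abs_def] by measurable
  qed (rule R_csq[OF L2_torusD(3)[OF g]])
  have cD_eq: "(\<integral>s. of_real (v s) * (of_real (v s) * cres p z s) \<partial>\<mu>) = 1 - cD p z"
    unfolding cD_def by (simp add: par a1)
  have v_int: "(\<integral>s. of_real (v s) * R g s \<partial>\<mu>) = c g" if g: "csquare_integrable \<mu> g" for g
  proof -
    have "(\<integral>s. of_real (v s) * R g s \<partial>\<mu>) = (\<integral>s. (of_real (v s) * cres p z s) * g s +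
        c g * (of_real (v s) * (of_real (v s) * cres p z s)) \<partial>\<mu>)"
      unfolding R_def by (intro Bochner_Integration.integral_cong refl) (simp add: algebra_simps)
    also have "\<dots> = I g + c g * (\<integral>s. of_real (v s) * (of_real (v s) * cres p z s) \<partial>\<mu>)"
      using csquare_mult_integrable[OF csquare_v_cres[OF z] g, of p]
        csquare_mult_integrable[OF csquare_v csquare_v_cres[OF z], of p]
      unfolding I_def by (subst Bochner_Integration.integral_add) auto
    also have "\<dots> = c g" unfolding cD_eq c_def using D0 by (simp add: field_simps)
    finally show ?thesis .
  qed
  have cres_inv: "(of_real (w2 (p, q)) - z) * cres p z q = 1" for q
    using cres_bound(2)[OF z, of p q] by (simp add: cres_def)
  show ?thesis unfolding resolvent_set_def mem_Collect_eq
  proof (intro exI[of _ R] exI[of _ "sqrt K"] conjI ballI)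
    fix g assume "g \<in> vectors L2_torus_space"
    then have g: "g \<in> L2_torus" by (simp add: L2_torus_space_def)
    note gc = L2_torusD(3)[OF g]
    show "R g \<in> vectors L2_torus_space" using R_L2[OF g] by (simp add: L2_torus_space_def)
    define n where "n = (\<integral>q. (cmod (g q))\<^sup>2 \<partial>\<mu>)"
    have "(cmod (I g))\<^sup>2 \<le> P * n"
      unfolding I_def P_def n_def by (rule csquare_Cauchy_Schwarz[OF csquare_v_cres[OF z] gc])
    then have "(cmod (I g))\<^sup>2 / (cmod (cD p z))\<^sup>2 \<le> P * n / (cmod (cD p z))\<^sup>2"
      by (intro divide_right_mono) auto
    then have cb: "(cmod (c g))\<^sup>2 \<le> Q * n" by (simp add: c_def norm_divide power_divide Q_def)
    have "(\<integral>q. (cmod (R g q))\<^sup>2 \<partial>\<mu>) \<le> d\<^sup>2 * (\<integral>q. (cmod (g q + of_real (v q) * c g))\<^sup>2 \<partial>\<mu>)"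
      unfolding R_def d_def
      by (rule csquare_integral_mult_le[OF csquare_add[OF gc csqv]]) (use cres_bound(1)[OF z] in
          auto)
    also have "(\<integral>q. (cmod (g q + of_real (v q) * c g))\<^sup>2 \<partial>\<mu>) \<le>
        2 * n + 2 * (\<integral>q. (cmod (of_real (v q) * c g))\<^sup>2 \<partial>\<mu>)"
      unfolding n_def by (rule csquare_integral_add_le[OF gc csqv])
    also have "(\<integral>q. (cmod (of_real (v q) * c g))\<^sup>2 \<partial>\<mu>) = (cmod (c g))\<^sup>2 * V"
      unfolding norm_mult power_mult_distrib V_def by simp
    also have "2 * n + 2 * ((cmod (c g))\<^sup>2 * V) \<le> 2 * n + 2 * ((Q * n) * V)"
      using mult_right_mono[OF cb pos(2)] by simp
    also have "\<dots> = (2 + 2 * Q * V) * n" by (simp add: algebra_simps)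
    finally have "(\<integral>q. (cmod (R g q))\<^sup>2 \<partial>\<mu>) \<le> K * n" by (simp add: K_def mult_left_mono mult.assoc)
    then show "seminorm L2_torus_space (R g) \<le> sqrt K * seminorm L2_torus_space g"
      by (simp add: L2_torus_space_def n_def real_sqrt_mult[symmetric])
    have "of_real (w2 (p, q)) * R g q - of_real (v q) * c g - z * R g q - g q = 0" for q
    proof -
      have "of_real (w2 (p, q)) * R g q - of_real (v q) * c g - z * R g q - g q =
          ((of_real (w2 (p, q)) - z) * cres p z q) * (g q
              + of_real (v q) * c g) - of_real (v q) * c g - g q"
        unfolding R_def by (simp add: algebra_simps)
      then show ?thesis unfolding cres_inv by simp
    qed
    then show "seminorm L2_torus_space (h2 w2 v p (R g) - cscale L2_torus_space z (R g) - g) = 0"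
      unfolding h2_def L2_torus_space_def by (simp add: v_int[OF gc])
  next
    fix f assume "f \<in> vectors L2_torus_space"
    then have f: "f \<in> L2_torus" by (simp add: L2_torus_space_def)
    note fc = L2_torusD(3)[OF f]
    define k where "k = (\<integral>s. of_real (v s) * f s \<partial>\<mu>)"
    define g where "g q = of_real (w2 (p, q)) * f q - of_real (v q) * k - z * f q" for q
    have g: "h2 w2 v p f - cscale L2_torus_space z f = g"
      by (simp add: h2_def L2_torus_space_def g_def k_def fun_eq_iff)
    have cg: "cres p z q * g q = f q - k * (of_real (v q) * cres p z q)" for q
    proof -
      have "cres p z q * g q = ((of_real (w2 (p, q)) - z) * cres p z q) * f q - k * (of_real (v q)
          * cres p z q)"
        unfolding g_def by (simp add: algebra_simps)
      then show ?thesis unfolding cres_inv by simp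
    qed
    have "I g = (\<integral>s. of_real (v s) * f s - k * (of_real (v s) * (of_real (v s) * cres p z s)) \<partial>\<mu>)"
    proof -
      have "(of_real (v s) * cres p z s) * g s = of_real (v s) * f s - k * (of_real (v s) *
          (of_real (v s) * cres p z s))" for s
      proof -
        have "(of_real (v s) * cres p z s) * g s = of_real (v s) * (cres p z s * g s)"
            by (simp add: ac_simps)
        then show ?thesis unfolding cg by (simp add: algebra_simps)
      qed
      then show ?thesis unfolding I_def by presburger
    qed
    also have "\<dots> = k - k * (\<integral>s. of_real (v s) * (of_real (v s) * cres p z s) \<partial>\<mu>)"
      using csquare_mult_integrable[OF csquare_v csquare_v_cres[OF z], of p]
          csquare_mult_integrable[OF csquare_v fc]
      unfolding k_def by (subst Bochner_Integration.integral_diff) auto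
    also have "\<dots> = k * cD p z" unfolding cD_eq by (simp add: algebra_simps)
    finally have c: "c g = k" using D0 by (simp add: c_def)
    have "R g q = f q" for q
      unfolding R_def c distrib_left cg by (simp add: ac_simps)
    then show "seminorm L2_torus_space (R (h2 w2 v p f - cscale L2_torus_space z f) - f) = 0"
      unfolding g by (simp add: L2_torus_space_def)
  qed
qed

lemma h2_eigenvalue:
  assumes par: "\<tau> = 0" "\<kappa> = 1" and E: "E < m" and D0: "D p E = 0"
  shows "complex_of_real E \<in> discrete_spectrum L2_torus_space (h2 w2 v p)"
proof -
  let ?z = "complex_of_real E"
  have z: "Re ?z < m" using E by simp
  have a1: "a p = 1" using \<tau>_cases par by auto
  define b where "b q = of_real (v q) * cres p ?z q" for q
  have b_csq: "csquare_integrable \<mu> b" unfolding b_def[abs_def] by (rule csquare_v_cres[OF z])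
  have b_L2: "b \<in> L2_torus"
  proof (rule L2_torusI)
    show "torus_fun b" using cres_torus[of p ?z] v_torus by (simp add: b_def torus_fun_def)
    show "b \<in> borel_measurable borel" unfolding b_def[abs_def] by measurable
  qed (rule b_csq)
  have cres_inv: "(of_real (w2 (p, q)) - ?z) * cres p ?z q = 1" for q
    using cres_bound(2)[OF z, of p q] by (simp add: cres_def)
  have "cD p ?z = 1 - (\<integral>s. of_real (v s) * b s \<partial>\<mu>)" unfolding cD_def b_def by (simp add: par a1)
  moreover have "cD p ?z = 0" using cD_real[OF E] D0 by simp
  ultimately have vb: "(\<integral>s. of_real (v s) * b s \<partial>\<mu>) = 1" by simp
  have "of_real (w2 (p, q)) * b q - of_real (v q) - ?z * b q = 0" for q
  proof -
    have "of_real (w2 (p, q)) * b q - of_real (v q) - ?z * b q =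
        of_real (v q) * ((of_real (w2 (p, q)) - ?z) * cres p ?z q) - of_real (v q)"
      unfolding b_def by (simp add: algebra_simps)
    then show ?thesis unfolding cres_inv by simp
  qed
  then have eig: "h2 w2 v p b - cscale L2_torus_space ?z b = 0"
    by (simp add: h2_def L2_torus_space_def vb fun_eq_iff)
  have b_ne: "seminorm L2_torus_space b \<noteq> 0"
  proof
    assume "seminorm L2_torus_space b = 0"
    then have "AE q in \<mu>. b q = 0" using csquare_null_iff[OF b_csq]
        by (simp add: L2_torus_space_def)
    then have "AE q in \<mu>. of_real (v q) * b q = 0" by eventually_elim simp
    then have "(\<integral>s. of_real (v s) * b s \<partial>\<mu>) = 0" by (rule integral_eq_zero_AE)
    then show False using vb by simp
  qed
  have in_spec: "?z \<in> spectrum L2_torus_space (h2 w2 v p)"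
  proof (rule eigenvector_in_spectrum[where f = b])
    show "h2 w2 v p b - cscale L2_torus_space ?z b = 0" by (rule eig)
    show "b \<in> vectors L2_torus_space" using b_L2 by (simp add: L2_torus_space_def)
    show "0 \<in> vectors L2_torus_space" using zero_in_L2_torus
        by (simp add: L2_torus_space_def zero_fun_def)
    show "seminorm L2_torus_space 0 = 0" by (simp add: L2_torus_space_def)
    show "seminorm L2_torus_space r \<ge> 0" for r by (simp add: L2_torus_space_def)
    fix r assume r: "r \<in> vectors L2_torus_space" "seminorm L2_torus_space r
        = 0" "seminorm L2_torus_space (r - b) = 0"
    have rc: "csquare_integrable \<mu> r" using r(1) L2_torusD(3) by (simp add: L2_torus_space_def)
    have "AE q in \<mu>. r q = 0" "AE q in \<mu>. r q - b q = 0"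
      using r(2,3) csquare_null_iff[OF rc] csquare_null_iff[OF csquare_diff[OF rc b_csq]]
      by (auto simp: L2_torus_space_def)
    then have "AE q in \<mu>. b q = 0" by eventually_elim simp
    then show False using b_ne csquare_null_iff[OF b_csq] by (simp add: L2_torus_space_def)
  qed
  have iso: "?z isolated_in spectrum L2_torus_space (h2 w2 v p)"
    unfolding isolated_in_dist_Ex_iff
  proof (intro conjI in_spec exI[of _ "m - E"] ballI impI)
    show "m - E > 0" using E by simp
    fix y assume y: "y \<in> spectrum L2_torus_space (h2 w2 v p)" "dist ?z y < m - E"
    have "Re y - E \<le> cmod (y - ?z)" using complex_Re_le_cmod[of "y - ?z"] by simp
    then have "Re y < m" using y(2) by (simp add: dist_norm norm_minus_commute)
    then show "y = ?z"
      using cD_nonzero[OF E D0, of y] h2_resolvent[OF par, of y p] y(1) by (auto simp: spectrum_def)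
  qed
  have b_eig: "b \<in> eigenspace L2_torus_space (h2 w2 v p) ?z"
  proof -
    have "seminorm L2_torus_space (h2 w2 v p b - cscale L2_torus_space ?z b) = 0"
      unfolding eig by (simp add: L2_torus_space_def)
    moreover have "b \<in> vectors L2_torus_space" using b_L2 by (simp add: L2_torus_space_def)
    ultimately show ?thesis by (simp add: eigenspace_def)
  qed
  have "finite_dim L2_torus_space (eigenspace L2_torus_space (h2 w2 v p) ?z)"
    unfolding finite_dim_def
  proof (rule exI[of _ "1 :: nat"], rule exI[of _ "\<lambda>_. b"], intro conjI allI impI ballI)
    fix f assume "f \<in> eigenspace L2_torus_space (h2 w2 v p) ?z"
    then have f: "f \<in> L2_torus"
      and s: "seminorm L2_torus_space (h2 w2 v p f - cscale L2_torus_space ?z f) = 0"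
      by (auto simp: eigenspace_def L2_torus_space_def)
    note fc = L2_torusD(3)[OF f]
    define k where "k = (\<integral>s. of_real (v s) * f s \<partial>\<mu>)"
    let ?e = "\<lambda>q. of_real (w2 (p, q)) * f q - of_real (v q) * k - ?z * f q"
    have "(\<integral>q. (cmod (?e q))\<^sup>2 \<partial>\<mu>) = 0"
      using s by (simp add: h2_def L2_torus_space_def k_def)
    moreover have "csquare_integrable \<mu> ?e"
      using csquare_cmult[OF csquare_v, of k]
      by (intro csquare_diff csquare_cmult csquare_w2_mult fc) (simp add: ac_simps)
    ultimately have "AE q in \<mu>. ?e q = 0" using csquare_null_iff by blast
    then have ae: "AE q in \<mu>. f q - k * b q = 0"
    proof eventually_elim
      case (elim q)
      have "cres p ?z q * ?e q = ((of_real (w2 (p, q)) - ?z) * cres p ?z q) * f q - of_real (v q)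
          * k * cres p ?z q"
        by (simp add: algebra_simps)
      then show ?case unfolding cres_inv elim by (simp add: b_def algebra_simps)
    qed
    have "seminorm L2_torus_space (f - cscale L2_torus_space k b) = 0"
      using ae csquare_null_iff[OF csquare_diff[OF fc csquare_cmult[OF b_csq, of k]]]
      by (simp add: L2_torus_space_def)
    moreover have "(\<Sum>i<1 :: nat. cscale L2_torus_space k b) = cscale L2_torus_space k b"
      by (simp add: lessThan_Suc)
    ultimately show "\<exists>c. seminorm L2_torus_space (f - (\<Sum>i<1::nat. cscale L2_torus_space (c i) b))
        = 0"
      by (intro exI[of _ "\<lambda>_. k"]) (simp only:)
  qed (rule b_eig)
  then show ?thesis
    unfolding discrete_spectrum_def using iso b_eig b_ne by blast
qed

lemma h2_eigenvalue_zero: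
  assumes par: "\<tau> = 0" "\<kappa> = 1" and E: "E \<le> m"
    and ev: "complex_of_real E \<in> discrete_spectrum L2_torus_space (h2 w2 v p)"
  shows "D p E = 0"
proof -
  let ?z = "complex_of_real E"
  have a1: "a p = 1" using \<tau>_cases par by auto
  obtain f where f: "f \<in> L2_torus" and ne: "seminorm L2_torus_space f \<noteq> 0"
    and s: "seminorm L2_torus_space (h2 w2 v p f - cscale L2_torus_space ?z f) = 0"
    using ev by (auto simp: discrete_spectrum_def eigenspace_def L2_torus_space_def)
  note fc = L2_torusD(3)[OF f]
  define k where "k = (\<integral>s. of_real (v s) * f s \<partial>\<mu>)"
  let ?e = "\<lambda>q. of_real (w2 (p, q)) * f q - of_real (v q) * k - ?z * f q"
  have "(\<integral>q. (cmod (?e q))\<^sup>2 \<partial>\<mu>) = 0"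
    using s by (simp add: h2_def L2_torus_space_def k_def)
  moreover have "csquare_integrable \<mu> ?e"
    using csquare_cmult[OF csquare_v, of k]
    by (intro csquare_diff csquare_cmult csquare_w2_mult fc) (simp add: ac_simps)
  ultimately have "AE q in \<mu>. ?e q = 0" using csquare_null_iff by blast
  then have ae: "AE q in \<mu>. f q = k * (of_real (v q) * of_real (res E (p, q)))"
    using AE_res_snd[OF E, of p]
  proof eventually_elim
    case (elim q)
    have ne: "of_real (w2 (p, q)) - ?z \<noteq> 0" using elim E by (simp flip: of_real_diff)
    have "(of_real (w2 (p, q)) - ?z) * f q = k * of_real (v q)"
      using elim(1) by (simp add: algebra_simps)
    then have "f q = k * of_real (v q) / (of_real (w2 (p, q)) - ?z)"
      using ne by (simp add: eq_divide_eq mult.commute)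
    then show ?case by (simp add: res_def)
  qed
  have k0: "k \<noteq> 0"
  proof
    assume "k = 0"
    then have "AE q in \<mu>. f q = 0" using ae by simp
    then show False using ne csquare_null_iff[OF fc] by (simp add: L2_torus_space_def)
  qed
  have "k = k * (\<integral>s. of_real (v s) * (of_real (v s) * of_real (res E (p, s))) \<partial>\<mu>)"
    using integral_v_mult_cong[OF fc ae] by (simp add: k_def)
  then have "k * of_real (D p E) = 0" unfolding D_complex by (simp add: par a1 algebra_simps)
  then show ?thesis using k0 by simp
qed

end

section \<open>The operator matrix\<close>

text \<open>
  With these two operations \<open>H12 v1 f2\<close> is \<open>marginal v1 f2\<close>, \<open>H12_adj v1 f1\<close> is half of
  \<open>sym_product v1 f1\<close>, and, for symmetric \<open>f2\<close>, \<open>V_op v2 f2\<close> is \<open>sym_product v2 (marginal v2 f2)\<close>.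
\<close>

definition marginal :: "(R3 \<Rightarrow> real) \<Rightarrow> (R3 \<times> R3 \<Rightarrow> complex) \<Rightarrow> R3 \<Rightarrow> complex" where
  "marginal u F p = (\<integral>s. of_real (u s) * F (p, s) \<partial>\<mu>)"

definition sym_product :: "(R3 \<Rightarrow> real) \<Rightarrow> (R3 \<Rightarrow> complex) \<Rightarrow> R3 \<times> R3 \<Rightarrow> complex" where
  "sym_product u A x = of_real (u (snd x)) * A (fst x) + of_real (u (fst x)) * A (snd x)"

lemma csquare_tensor:
  assumes f: "csquare_integrable \<mu> f" and h: "csquare_integrable \<mu> h"
  shows "csquare_integrable (\<mu> \<Otimes>\<^sub>M \<mu>) (\<lambda>x. f (fst x) * h (snd x))"
    and "(\<integral>x. (cmod (f (fst x) * h (snd x)))\<^sup>2 \<partial>(\<mu> \<Otimes>\<^sub>M \<mu>))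
        = (\<integral>p. (cmod (f p))\<^sup>2 \<partial>\<mu>) * (\<integral>p. (cmod (h p))\<^sup>2 \<partial>\<mu>)"
proof -
  have [measurable]: "f \<in> borel_measurable \<mu>" "h \<in> borel_measurable \<mu>"
    and i: "integrable \<mu> (\<lambda>p. (cmod (f p))\<^sup>2)" "integrable \<mu> (\<lambda>p. (cmod (h p))\<^sup>2)"
    using f h by (auto simp: csquare_integrable_def)
  have eq: "(cmod (f (fst x) * h (snd x)))\<^sup>2 = (cmod (f (fst x)))\<^sup>2 * (cmod (h (snd x)))\<^sup>2" for x
    by (simp add: norm_mult power_mult_distrib)
  show "csquare_integrable (\<mu> \<Otimes>\<^sub>M \<mu>) (\<lambda>x. f (fst x) * h (snd x))"
    unfolding csquare_integrable_def eq using product_integral(1)[OF i] by simp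
  show "(\<integral>x. (cmod (f (fst x) * h (snd x)))\<^sup>2 \<partial>(\<mu> \<Otimes>\<^sub>M \<mu>))
      = (\<integral>p. (cmod (f p))\<^sup>2 \<partial>\<mu>) * (\<integral>p. (cmod (h p))\<^sup>2 \<partial>\<mu>)"
    unfolding eq by (rule product_integral(2)[OF i])
qed

lemma AE_csquare_section:
  assumes F: "csquare_integrable (\<mu> \<Otimes>\<^sub>M \<mu>) F"
  shows "AE p in \<mu>. csquare_integrable \<mu> (\<lambda>s. F (p, s))"
proof -
  have [measurable]: "F \<in> borel_measurable (\<mu> \<Otimes>\<^sub>M \<mu>)"
      and i: "integrable (\<mu> \<Otimes>\<^sub>M \<mu>) (\<lambda>x. (cmod (F x))\<^sup>2)"
    using F by (auto simp: csquare_integrable_def)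
  from torus2.AE_integrable_fst'[OF i] AE_space show ?thesis
  proof eventually_elim
    case (elim p)
    then have "(\<lambda>s. F (p, s)) \<in> borel_measurable \<mu>" by simp
    then show ?case using elim by (simp add: csquare_integrable_def)
  qed
qed

lemma marginal_csquare:
  assumes F: "csquare_integrable (\<mu> \<Otimes>\<^sub>M \<mu>) F" and u: "csquare_integrable \<mu> (\<lambda>s. of_real (u s))"
  shows "csquare_integrable \<mu> (marginal u F)"
    and "(\<integral>p. (cmod (marginal u F p))\<^sup>2 \<partial>\<mu>) \<le> (\<integral>s. (cmod (of_real (u s)))\<^sup>2 \<partial>\<mu>) * (\<integral>x. (cmod (F x))\<^sup>2
        \<partial>(\<mu> \<Otimes>\<^sub>M \<mu>))"
proof -
  let ?V = "\<integral>s. (cmod (complex_of_real (u s)))\<^sup>2 \<partial>\<mu>"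
  have [measurable]: "F \<in> borel_measurable (\<mu> \<Otimes>\<^sub>M \<mu>)" "(\<lambda>s. complex_of_real (u s)) \<in>
      borel_measurable \<mu>"
    and i: "integrable (\<mu> \<Otimes>\<^sub>M \<mu>) (\<lambda>x. (cmod (F x))\<^sup>2)"
    using F u by (auto simp: csquare_integrable_def)
  have m: "marginal u F \<in> borel_measurable \<mu>"
    unfolding marginal_def[abs_def] by (intro torus.borel_measurable_lebesgue_integral) simp
  have iV: "integrable \<mu> (\<lambda>p. ?V * (\<integral>s. (cmod (F (p, s)))\<^sup>2 \<partial>\<mu>))"
    using torus2.integrable_fst'[OF i] by simp
  have le: "AE p in \<mu>. (cmod (marginal u F p))\<^sup>2 \<le> ?V * (\<integral>s. (cmod (F (p, s)))\<^sup>2 \<partial>\<mu>)"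
    using AE_csquare_section[OF F] unfolding marginal_def
    by eventually_elim (rule csquare_Cauchy_Schwarz[OF u])
  have im: "integrable \<mu> (\<lambda>p. (cmod (marginal u F p))\<^sup>2)"
  proof (rule Bochner_Integration.integrable_bound[OF iV])
    show "(\<lambda>p. (cmod (marginal u F p))\<^sup>2) \<in> borel_measurable \<mu>" using m by measurable
    show "AE p in \<mu>. norm ((cmod (marginal u F p))\<^sup>2) \<le> norm (?V * (\<integral>s. (cmod (F (p, s)))\<^sup>2 \<partial>\<mu>))"
      using le by eventually_elim simp
  qed
  then show "csquare_integrable \<mu> (marginal u F)" using m by (simp add: csquare_integrable_def)
  have "(\<integral>p. (cmod (marginal u F p))\<^sup>2 \<partial>\<mu>) \<le> (\<integral>p. ?V * (\<integral>s. (cmod (F (p, s)))\<^sup>2 \<partial>\<mu>) \<partial>\<mu>)"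
    by (rule integral_mono_AE[OF im iV le])
  also have "\<dots> = ?V * (\<integral>x. (cmod (F x))\<^sup>2 \<partial>(\<mu> \<Otimes>\<^sub>M \<mu>))"
    using torus2.integral_fst'[OF i] by simp
  finally show "(\<integral>p. (cmod (marginal u F p))\<^sup>2 \<partial>\<mu>) \<le> ?V * (\<integral>x. (cmod (F x))\<^sup>2 \<partial>(\<mu> \<Otimes>\<^sub>M \<mu>))" .
qed

lemma L2_symD:
  assumes "F \<in> L2_sym"
  shows "torus_fun2 F" "sym_fun F" "F \<in> borel_measurable borel" "csquare_integrable (\<mu> \<Otimes>\<^sub>M \<mu>) F"
  using assms by (auto simp: L2_sym_def csquare_integrable_def intro: measurable_torus2)

lemma L2_symI:
  "torus_fun2 F \<Longrightarrow> sym_fun F \<Longrightarrow> F \<in> borel_measurable borel \<Longrightarrow> csquare_integrable (\<mu> \<Otimes>\<^sub>M \<mu>) F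
      \<Longrightarrow> F \<in> L2_sym"
  by (simp add: L2_sym_def csquare_integrable_def)

lemma marginal_L2:
  assumes F: "F \<in> L2_sym" and u: "torus_fun u" "continuous_on UNIV u"
  shows "marginal u F \<in> L2_torus"
proof (rule L2_torusI)
  show "torus_fun (marginal u F)"
    using L2_symD(1)[OF F] by (simp add: marginal_def torus_fun_def torus_fun2_def)
  have [measurable]: "u \<in> borel_measurable borel" using u(2)
      by (rule borel_measurable_continuous_onI)
  have "(\<lambda>x. (fst x, snd x)) \<in> measurable (borel \<Otimes>\<^sub>M \<mu>) (borel \<Otimes>\<^sub>M borel :: (R3 \<times> R3) measure)"
    by (intro measurable_Pair measurable_fst measurable_compose[OF measurable_snd
        measurable_ident_torus])
  then have id: "(\<lambda>x. x) \<in> measurable (borel \<Otimes>\<^sub>M \<mu>) (borel :: (R3 \<times> R3) measure)"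
    by (simp add: borel_prod)
  have [measurable]: "F \<in> borel_measurable (borel \<Otimes>\<^sub>M \<mu>)"
    by (rule measurable_compose[OF id L2_symD(3)[OF F]])
  show "marginal u F \<in> borel_measurable borel"
    unfolding marginal_def[abs_def] by (intro torus.borel_measurable_lebesgue_integral) simp
  have "csquare_integrable \<mu> (\<lambda>s. of_real (u s))"
    using square_integrable_continuous[OF u] by (auto simp: csquare_integrable_def
        square_integrable_def)
  then show "csquare_integrable \<mu> (marginal u F)" by (rule marginal_csquare(1)[OF L2_symD(4)[OF F]])
qed

lemma csquare_continuous:
  "torus_fun u \<Longrightarrow> continuous_on UNIV u \<Longrightarrow> csquare_integrable \<mu> (\<lambda>s. of_real (u s))"
  using square_integrable_continuous[of u] by (auto simp: csquare_integrable_def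
      square_integrable_def)

lemma sym_product_csquare:
  assumes A: "csquare_integrable \<mu> A" and u: "csquare_integrable \<mu> (\<lambda>s. of_real (u s))"
  shows "csquare_integrable (\<mu> \<Otimes>\<^sub>M \<mu>) (sym_product u A)"
    and "(\<integral>x. (cmod (sym_product u A x))\<^sup>2 \<partial>(\<mu> \<Otimes>\<^sub>M \<mu>)) \<le>
      4 * (\<integral>s. (cmod (of_real (u s)))\<^sup>2 \<partial>\<mu>) * (\<integral>p. (cmod (A p))\<^sup>2 \<partial>\<mu>)"
proof -
  have 1: "csquare_integrable (\<mu> \<Otimes>\<^sub>M \<mu>) (\<lambda>x. of_real (u (snd x)) * A (fst x))"
    using csquare_tensor(1)[OF A u] by (simp add: mult.commute)
  have 2: "csquare_integrable (\<mu> \<Otimes>\<^sub>M \<mu>) (\<lambda>x. of_real (u (fst x)) * A (snd x))"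
    by (rule csquare_tensor(1)[OF u A])
  show "csquare_integrable (\<mu> \<Otimes>\<^sub>M \<mu>) (sym_product u A)"
    unfolding sym_product_def[abs_def] by (rule csquare_add[OF 1 2])
  have "(\<integral>x. (cmod (of_real (u (snd x)) * A (fst x)))\<^sup>2 \<partial>(\<mu> \<Otimes>\<^sub>M \<mu>)) =
      (\<integral>s. (cmod (of_real (u s)))\<^sup>2 \<partial>\<mu>) * (\<integral>p. (cmod (A p))\<^sup>2 \<partial>\<mu>)"
    using csquare_tensor(2)[OF A u] by (simp add: mult.commute)
  then show "(\<integral>x. (cmod (sym_product u A x))\<^sup>2 \<partial>(\<mu> \<Otimes>\<^sub>M \<mu>)) \<le>
      4 * (\<integral>s. (cmod (of_real (u s)))\<^sup>2 \<partial>\<mu>) * (\<integral>p. (cmod (A p))\<^sup>2 \<partial>\<mu>)"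
    using csquare_integral_add_le[OF 1 2] csquare_tensor(2)[OF u A] unfolding sym_product_def
        by linarith
qed

lemma borel_pair_components [measurable]:
  "fst \<in> measurable (borel :: (R3 \<times> R3) measure) borel" "snd \<in> measurable (borel :: (R3 \<times> R3)
      measure) borel"
  by (simp_all flip: borel_prod)

lemma sym_product_L2:
  assumes A: "A \<in> L2_torus" and u: "torus_fun u" "continuous_on UNIV u"
  shows "sym_product u A \<in> L2_sym"
proof (rule L2_symI)
  show "torus_fun2 (sym_product u A)"
    using L2_torusD(1)[OF A] u(1) by (simp add: sym_product_def torus_fun_def torus_fun2_def)
  show "sym_fun (sym_product u A)" by (simp add: sym_product_def sym_fun_def add.commute)
  have [measurable]: "u \<in> borel_measurable borel" using u(2)
      by (rule borel_measurable_continuous_onI)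
  have [measurable]: "A \<in> borel_measurable borel" by (rule L2_torusD(2)[OF A])
  show "sym_product u A \<in> borel_measurable borel" unfolding sym_product_def[abs_def] by measurable
qed (rule sym_product_csquare(1)[OF L2_torusD(3)[OF A] csquare_continuous[OF u]])

lemma torus_fun2_bounded:
  fixes b :: "R3 \<times> R3 \<Rightarrow> real"
  assumes "torus_fun2 b" "continuous_on UNIV b"
  obtains C where "\<And>x. \<bar>b x\<bar> \<le> C"
proof -
  have "compact (b ` (torus_cube \<times> torus_cube))"
    by (intro compact_continuous_image continuous_on_subset[OF assms(2)] compact_Times
        compact_torus_cube) auto
  then have "bounded (b ` (torus_cube \<times> torus_cube))" by (rule compact_imp_bounded)
  then obtain C where C: "\<And>x. x \<in> torus_cube \<times> torus_cube \<Longrightarrow> \<bar>b x\<bar> \<le> C"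
    unfolding bounded_iff by auto
  have "\<bar>b (p, q)\<bar> \<le> C" for p q
  proof -
    have "(torus_rep p, torus_rep q) \<in> torus_cube \<times> torus_cube"
      using torus_rep_in_cell cell_subset_cube by blast
    then show ?thesis using C torus_fun2_rep[OF assms(1), of p q] by metis
  qed
  then show ?thesis using that by (metis surj_pair)
qed

lemma mult_L2_sym:
  fixes b :: "R3 \<times> R3 \<Rightarrow> real"
  assumes F: "F \<in> L2_sym" and b: "torus_fun2 b" "sym_fun b" "continuous_on UNIV b"
  shows "(\<lambda>x. of_real (b x) * F x) \<in> L2_sym"
proof (rule L2_symI)
  show "torus_fun2 (\<lambda>x. of_real (b x) * F x)" "sym_fun (\<lambda>x. of_real (b x) * F x)"
    using L2_symD(1,2)[OF F] b(1,2) by (simp_all add: torus_fun_def torus_fun2_def sym_fun_def)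
  have bm [measurable]: "b \<in> borel_measurable borel" using b(3)
      by (rule borel_measurable_continuous_onI)
  have [measurable]: "F \<in> borel_measurable borel" by (rule L2_symD(3)[OF F])
  show "(\<lambda>x. of_real (b x) * F x) \<in> borel_measurable borel" by measurable
  obtain C where "\<And>x. \<bar>b x\<bar> \<le> C" using torus_fun2_bounded[OF b(1,3)] by blast
  then show "csquare_integrable (\<mu> \<Otimes>\<^sub>M \<mu>) (\<lambda>x. of_real (b x) * F x)"
    using measurable_torus2[OF bm] by (intro csquare_bounded_mult[OF L2_symD(4)[OF F], where C
        = C]) auto
qed

lemma L2_sym_add: "F \<in> L2_sym \<Longrightarrow> G \<in> L2_sym \<Longrightarrow> (\<lambda>x. F x + G x) \<in> L2_sym"
  using L2_symD[of F] L2_symD[of G] csquare_add[of "\<mu> \<Otimes>\<^sub>M \<mu>" F G]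
  by (intro L2_symI) (auto simp: torus_fun_def torus_fun2_def sym_fun_def)

lemma L2_sym_cmult: "F \<in> L2_sym \<Longrightarrow> (\<lambda>x. c * F x) \<in> L2_sym"
  using L2_symD[of F] csquare_cmult[of "\<mu> \<Otimes>\<^sub>M \<mu>" F c]
  by (intro L2_symI) (auto simp: torus_fun_def torus_fun2_def sym_fun_def)

lemma L2_torus_add: "F \<in> L2_torus \<Longrightarrow> G \<in> L2_torus \<Longrightarrow> (\<lambda>x. F x + G x) \<in> L2_torus"
  using L2_torusD[of F] L2_torusD[of G] csquare_add[of \<mu> F G]
  by (intro L2_torusI) (auto simp: torus_fun_def)

lemma L2_torus_cmult: "F \<in> L2_torus \<Longrightarrow> (\<lambda>x. c * F x) \<in> L2_torus"
  using L2_torusD[of F] csquare_cmult[of \<mu> F c] by (intro L2_torusI) (auto simp: torus_fun_def)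

lemma L2_torus_mult:
  assumes F: "F \<in> L2_torus" and u: "torus_fun u" "continuous_on UNIV u"
  shows "(\<lambda>p. of_real (u p) * F p) \<in> L2_torus"
proof (rule L2_torusI)
  have m: "u \<in> borel_measurable borel" using u(2) by (rule borel_measurable_continuous_onI)
  show "torus_fun (\<lambda>p. of_real (u p) * F p)" using L2_torusD(1)[OF F] u(1)
      by (simp add: torus_fun_def)
  show "(\<lambda>p. of_real (u p) * F p) \<in> borel_measurable borel" using m L2_torusD(2)[OF F] by measurable
  obtain C where "\<And>p. \<bar>u p\<bar> \<le> C" using torus_fun_bounded[OF u] by blast
  then show "csquare_integrable \<mu> (\<lambda>p. of_real (u p) * F p)"
    using measurable_torus[OF m] by (intro csquare_bounded_mult[OF L2_torusD(3)[OF F], where C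
        = C]) auto
qed

lemma L2_torus_continuous:
  assumes "torus_fun u" "continuous_on UNIV u"
  shows "(\<lambda>p. complex_of_real (u p)) \<in> L2_torus"
proof (rule L2_torusI)
  show "torus_fun (\<lambda>p. complex_of_real (u p))" using assms(1) by (simp add: torus_fun_def)
  show "(\<lambda>p. complex_of_real (u p)) \<in> borel_measurable borel"
    using borel_measurable_continuous_onI[OF assms(2)] by measurable
qed (rule csquare_continuous[OF assms])

lemma fock_vectors: "(f0, f1, f2) \<in> vectors fock_space \<longleftrightarrow> f1 \<in> L2_torus \<and> f2 \<in> L2_sym"
  by (simp add: fock_space_def)

lemma fock_null_iff:
  assumes "(f0, f1, f2) \<in> vectors fock_space"
  shows "seminorm fock_space (f0, f1, f2) = 0 \<longleftrightarrow>
    f0 = 0 \<and> (AE p in \<mu>. f1 p = 0) \<and> (AE x in \<mu> \<Otimes>\<^sub>M \<mu>. f2 x = 0)"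
proof -
  have 1: "(\<integral>p. (cmod (f1 p))\<^sup>2 \<partial>\<mu>) = 0 \<longleftrightarrow> (AE p in \<mu>. f1 p = 0)"
    using assms by (intro csquare_null_iff L2_torusD) (simp add: fock_vectors)
  have 2: "(\<integral>x. (cmod (f2 x))\<^sup>2 \<partial>(\<mu> \<Otimes>\<^sub>M \<mu>)) = 0 \<longleftrightarrow> (AE x in \<mu> \<Otimes>\<^sub>M \<mu>. f2 x = 0)"
    using assms by (intro csquare_null_iff L2_symD) (simp add: fock_vectors)
  show ?thesis unfolding 1[symmetric] 2[symmetric]
    by (simp add: fock_space_def add_nonneg_eq_0_iff)
qed

lemma fock_diff_cscale:
  assumes "(f0, f1, f2) \<in> vectors fock_space" "(g0, g1, g2) \<in> vectors fock_space"
  shows "(f0, f1, f2) - cscale fock_space z (g0, g1, g2)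
      = (f0 - z * g0, \<lambda>p. f1 p - z * g1 p, \<lambda>x. f2 x - z * g2 x)"
    and "(f0 - z * g0, \<lambda>p. f1 p - z * g1 p, \<lambda>x. f2 x - z * g2 x) \<in> vectors fock_space"
proof -
  show "(f0, f1, f2) - cscale fock_space z (g0, g1, g2)
      = (f0 - z * g0, \<lambda>p. f1 p - z * g1 p, \<lambda>x. f2 x - z * g2 x)"
    by (simp add: fock_space_def fun_eq_iff)
  show "(f0 - z * g0, \<lambda>p. f1 p - z * g1 p, \<lambda>x. f2 x - z * g2 x) \<in> vectors fock_space"
    using assms L2_torus_add[OF _ L2_torus_cmult[of g1 "- z"], of f1] L2_sym_add[OF _
        L2_sym_cmult[of g2 "- z"], of f2]
    by (simp add: fock_vectors)
qed

text \<open>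
  The form in which a point of the resolvent set contradicts the existence of approximate
  eigenvectors.
\<close>

lemma resolvent_lower_bound:
  assumes "z \<in> resolvent_set fock_space A"
  obtains K where "K \<ge> 0" "\<And>f. f \<in> vectors fock_space
      \<Longrightarrow> A f - cscale fock_space z f \<in> vectors fock_space \<Longrightarrow>
    seminorm fock_space f \<le> K * seminorm fock_space (A f - cscale fock_space z f)"
proof -
  obtain R K where R: "\<And>g. g \<in> vectors fock_space \<Longrightarrow> R g \<in> vectors fock_space
      \<and> seminorm fock_space (R g) \<le> K * seminorm fock_space g"
    "\<And>f. f \<in> vectors fock_space \<Longrightarrow> seminorm fock_space (R (A f - cscale fock_space z f) - f) = 0"
    using assms unfolding resolvent_set_def by blast
  have eq: "seminorm fock_space r = seminorm fock_space f"
    if r: "r \<in> vectors fock_space" and f: "f \<in> vectors fock_space"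
        and s: "seminorm fock_space (r - f) = 0" for r f
  proof -
    obtain r0 r1 r2 f0 f1 f2 where rf: "r = (r0, r1, r2)" "f = (f0, f1, f2)" by (metis surj_pair)
    have "r - f = (r0 - 1 * f0, \<lambda>p. r1 p - 1 * f1 p, \<lambda>x. r2 x - 1 * f2 x)"
        by (simp add: rf fun_eq_iff)
    then have *: "r0 = f0" "AE p in \<mu>. r1 p = f1 p" "AE x in \<mu> \<Otimes>\<^sub>M \<mu>. r2 x = f2 x"
      using s fock_null_iff[OF fock_diff_cscale(2)[OF r[unfolded rf] f[unfolded rf], of 1]] by auto
    have [measurable]: "r1 \<in> borel_measurable \<mu>" "f1 \<in> borel_measurable \<mu>"
        "r2 \<in> borel_measurable (\<mu> \<Otimes>\<^sub>M \<mu>)" "f2 \<in> borel_measurable (\<mu> \<Otimes>\<^sub>M \<mu>)"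
      using r f L2_torusD(3) L2_symD(4) by (auto simp: rf fock_vectors csquare_integrable_def)
    have "(\<integral>p. (cmod (r1 p))\<^sup>2 \<partial>\<mu>) = (\<integral>p. (cmod (f1 p))\<^sup>2 \<partial>\<mu>)"
      using *(2) by (intro integral_cong_AE) auto
    moreover have "(\<integral>x. (cmod (r2 x))\<^sup>2 \<partial>(\<mu> \<Otimes>\<^sub>M \<mu>)) = (\<integral>x. (cmod (f2 x))\<^sup>2 \<partial>(\<mu> \<Otimes>\<^sub>M \<mu>))"
      using *(3) by (intro integral_cong_AE) auto
    ultimately show ?thesis using *(1) by (simp add: rf fock_space_def)
  qed
  have nn: "seminorm fock_space g \<ge> 0" for g by (cases g) (simp add: fock_space_def split:
      prod.split)
  show ?thesis
  proof (rule that[of "\<bar>K\<bar>"])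
    fix f assume f: "f \<in> vectors fock_space" "A f - cscale fock_space z f \<in> vectors fock_space"
    have "seminorm fock_space f \<le> K * seminorm fock_space (A f - cscale fock_space z f)"
      using eq[OF _ f(1) R(2)[OF f(1)]] R(1)[OF f(2)] by simp
    also have "\<dots> \<le> \<bar>K\<bar> * seminorm fock_space (A f - cscale fock_space z f)"
      using nn by (intro mult_right_mono) auto
    finally show "seminorm fock_space f \<le> \<bar>K\<bar> * seminorm fock_space (A f - cscale fock_space z f)" .
  qed simp
qed

locale operator_matrix = symbol +
  fixes w0 :: real and w1 v0 v1 v2 :: "R3 \<Rightarrow> real"
  assumes w1_torus: "torus_fun w1" and w1_cont: "continuous_on UNIV w1"
    and v0_torus: "torus_fun v0" and v0_cont: "continuous_on UNIV v0"
    and v1_torus: "torus_fun v1" and v1_cont: "continuous_on UNIV v1"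
    and v2_torus: "torus_fun v2" and v2_cont: "continuous_on UNIV v2"
begin

sublocale one: pencil w2 m g N w1 v1 v0 w0 1 "1 / 2"
  by unfold_locales (auto intro: w1_torus w1_cont v0_torus v0_cont v1_torus v1_cont)

sublocale two: pencil w2 m g N "\<lambda>_. 1" v2 "\<lambda>_. 0" 1 0 1
  by unfold_locales (auto intro: v2_torus v2_cont simp: torus_fun_def[of "\<lambda>_. _"])

abbreviation H :: "fock \<Rightarrow> fock" where
  "H \<equiv> H_op w0 w1 w2 v0 v1 v2"

lemma H_apply:
  assumes "f2 \<in> L2_sym"
  shows "H (f0, f1, f2) =
    (of_real w0 * f0 + (\<integral>s. of_real (v0 s) * f1 s \<partial>\<mu>),
     (\<lambda>p. of_real (v0 p) * f0 + of_real (w1 p) * f1 p + marginal v1 f2 p),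
     (\<lambda>x. 1 / 2 * sym_product v1 f1 x + of_real (w2 x) * f2 x
         + (- 1) * sym_product v2 (marginal v2 f2) x))"
proof -
  have "f2 (s, q) = f2 (q, s)" for s q using L2_symD(2)[OF assms] by (simp add: sym_fun_def)
  then show ?thesis
    by (simp add: H_op_def H00_def H01_def H01_adj_def H11_def H12_def H12_adj_def H22_def
        H22_0_def V_op_def
        marginal_def sym_product_def fun_eq_iff add.commute)
qed

lemma H_vectors:
  assumes "(f0, f1, f2) \<in> vectors fock_space"
  shows "H (f0, f1, f2) \<in> vectors fock_space"
proof -
  have f: "f1 \<in> L2_torus" "f2 \<in> L2_sym" using assms by (auto simp: fock_vectors)
  have "(\<lambda>p. of_real (v0 p) * f0) \<in> L2_torus"
    using L2_torus_cmult[OF L2_torus_continuous[OF v0_torus v0_cont], of f0]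
        by (simp add: mult.commute)
  from L2_torus_add[OF L2_torus_add[OF this L2_torus_mult[OF f(1) w1_torus w1_cont]]
      marginal_L2[OF f(2) v1_torus v1_cont]]
  show ?thesis
    unfolding H_apply[OF f(2)] fock_vectors
    by (intro conjI L2_sym_add L2_sym_cmult sym_product_L2 mult_L2_sym marginal_L2 f
        v1_torus v1_cont v2_torus v2_cont w2_torus w2_sym w2_cont)
qed

lemma eigenvector_equations:
  assumes f: "(f0, f1, f2) \<in> eigenspace fock_space H (of_real E)"
  shows "f1 \<in> L2_torus" "f2 \<in> L2_sym"
    "of_real w0 * f0 + (\<integral>s. of_real (v0 s) * f1 s \<partial>\<mu>) = of_real E * f0"
    "AE p in \<mu>. of_real (v0 p) * f0 + of_real (w1 p) * f1 p + marginal v1 f2 p = of_real E * f1 p"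
    "AE x in \<mu> \<Otimes>\<^sub>M \<mu>. 1 / 2 * sym_product v1 f1 x + of_real (w2 x) * f2 x
        = sym_product v2 (marginal v2 f2) x + of_real E * f2 x"
proof -
  have v: "(f0, f1, f2) \<in> vectors fock_space" and s: "seminorm fock_space (H (f0, f1, f2) - cscale
      fock_space (of_real E) (f0, f1, f2)) = 0"
    using f by (auto simp: eigenspace_def)
  show L: "f1 \<in> L2_torus" "f2 \<in> L2_sym" using v by (auto simp: fock_vectors)
  note Hv = H_vectors[OF v, unfolded H_apply[OF L(2)]]
  note nul = s[unfolded H_apply[OF L(2)] fock_diff_cscale(1)[OF Hv v] fock_null_iff[OF
      fock_diff_cscale(2)[OF Hv v]]]
  show "of_real w0 * f0 + (\<integral>s. of_real (v0 s) * f1 s \<partial>\<mu>) = of_real E * f0" using nul by simp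
  have "AE p in \<mu>. of_real (v0 p) * f0 + of_real (w1 p) * f1 p
      + marginal v1 f2 p - of_real E * f1 p = 0"
    using nul by blast
  then show "AE p in \<mu>. of_real (v0 p) * f0 + of_real (w1 p) * f1 p + marginal v1 f2 p
      = of_real E * f1 p"
    by eventually_elim simp
  have "AE x in \<mu> \<Otimes>\<^sub>M \<mu>. 1 / 2 * sym_product v1 f1 x + of_real (w2 x) * f2 x
      + (- 1) * sym_product v2 (marginal v2 f2) x - of_real E * f2 x = 0"
    using nul by blast
  then show "AE x in \<mu> \<Otimes>\<^sub>M \<mu>. 1 / 2 * sym_product v1 f1 x + of_real (w2 x) * f2 x
      = sym_product v2 (marginal v2 f2) x + of_real E * f2 x"
    by eventually_elim (simp add: algebra_simps)
qed

end

section \<open>From eigenvectors to the Schur complement\<close>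

lemma marginal_cong_AE:
  assumes F: "csquare_integrable (\<mu> \<Otimes>\<^sub>M \<mu>) F" and G: "csquare_integrable (\<mu> \<Otimes>\<^sub>M \<mu>) G"
    and u: "(\<lambda>s. of_real (u s) :: complex) \<in> borel_measurable \<mu>"
    and eq: "AE x in \<mu> \<Otimes>\<^sub>M \<mu>. F x = G x"
  shows "AE p in \<mu>. marginal u F p = marginal u G p"
  using torus2.AE_pair[OF eq] AE_csquare_section[OF F] AE_csquare_section[OF G]
proof eventually_elim
  case (elim p)
  show ?case unfolding marginal_def
  proof (rule integral_cong_AE)
    show "AE s in \<mu>. of_real (u s) * F (p, s) = of_real (u s) * G (p, s)"
      using elim(1) by eventually_elim simp
  qed (use elim(2,3) u in \<open>auto simp: csquare_integrable_def\<close>)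
qed

lemma csquare_imp_square:
  assumes "csquare_integrable \<mu> f"
  shows "square_integrable (\<lambda>p. Re (f p))"
  unfolding square_integrable_def
proof
  have [measurable]: "f \<in> borel_measurable \<mu>" using assms by (simp add: csquare_integrable_def)
  show m: "(\<lambda>p. Re (f p)) \<in> borel_measurable \<mu>" by measurable
  show "integrable \<mu> (\<lambda>p. (Re (f p))\<^sup>2)"
  proof (rule Bochner_Integration.integrable_bound)
    show "integrable \<mu> (\<lambda>p. (cmod (f p))\<^sup>2)" using assms by (simp add: csquare_integrable_def)
    show "(\<lambda>p. (Re (f p))\<^sup>2) \<in> borel_measurable \<mu>" using m by measurable
    show "AE p in \<mu>. norm ((Re (f p))\<^sup>2) \<le> norm ((cmod (f p))\<^sup>2)"
      by (intro AE_I2) (simp add: cmod_power2)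
  qed
qed

context symbol
begin

lemma res_continuous: "E < m \<Longrightarrow> continuous_on UNIV (res E)"
proof -
  assume "E < m"
  then have "w2 x - E \<noteq> 0" for x using m_le[of x] by simp
  then show ?thesis unfolding res_def[abs_def] by (intro continuous_intros w2_cont) auto
qed

lemma res_torus2: "torus_fun2 (res E)"
  using w2_torus by (simp add: res_def torus_fun2_def torus_fun_def)

lemma res_sym: "sym_fun (res E)"
  using res_swap by (simp add: sym_fun_def)

lemma res_inverse: "E < m \<Longrightarrow> (of_real (w2 x) - of_real E) * (of_real (res E x) * y) = (y :: complex)"
proof -
  assume "E < m"
  then have "w2 x - E \<noteq> 0" using m_le[of x] by simp
  then have "complex_of_real ((w2 x - E) * res E x) = 1" by (simp add: res_def)
  then show ?thesis by (simp only: of_real_mult of_real_diff mult.assoc[symmetric] mult_1)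
qed

end

context pencil
begin

lemma csquare_res_mult: "E < m \<Longrightarrow> csquare_integrable \<mu> f
    \<Longrightarrow> csquare_integrable \<mu> (\<lambda>s. of_real (res E (p, s)) * f s)"
  using csquare_cres_mult[of "of_real E" f p] by (simp add: cres_real)

lemma csquare_integral_exists: "csquare_integrable \<mu> f \<Longrightarrow> integrable \<mu> f"
  using csquare_mult_integrable[of \<mu> f "\<lambda>_. 1"] by (simp add: csquare_integrable_def)

text \<open>
  The identity behind both Schur complements: one part of the symmetric product contributes to the
  multiplication operator \<open>D\<close>, the other one to the integral operator.
\<close>

lemma marginal_res_sym_product:
  assumes E: "E < m" and A: "csquare_integrable \<mu> A"
  shows "marginal v (\<lambda>x. of_real (res E x) * sym_product v A x) p =
    A p * of_real (\<integral>s. res E (p, s) * (v s)\<^sup>2 \<partial>\<mu>) + of_real (v p) * (\<integral>s. of_real (res E (p, s)) *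
        (of_real (v s) * A s) \<partial>\<mu>)"
proof -
  have i1: "integrable \<mu> (\<lambda>s. of_real (v s) * (of_real (res E (p, s)) * of_real (v s)) :: complex)"
    by (rule csquare_mult_integrable[OF csquare_v csquare_res_mult[OF E csquare_v]])
  have i2: "integrable \<mu> (\<lambda>s. of_real (res E (p, s)) * (of_real (v s) * A s))"
    by (rule csquare_integral_exists[OF csquare_res_mult[OF E csquare_v_mult[OF A]]])
  have "(\<integral>s. of_real (v s) * (of_real (res E (p, s)) * of_real (v s)) \<partial>\<mu>)
      = (\<integral>s. complex_of_real (res E (p, s) * (v s)\<^sup>2) \<partial>\<mu>)"
    by (intro Bochner_Integration.integral_cong) (auto simp: power2_eq_square)
  also have "\<dots> = of_real (\<integral>s. res E (p, s) * (v s)\<^sup>2 \<partial>\<mu>)" by (rule integral_complex_of_real)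
  finally have r: "(\<integral>s. of_real (v s) * (of_real (res E (p, s)) * of_real (v s)) \<partial>\<mu>)
      = complex_of_real (\<integral>s. res E (p, s) * (v s)\<^sup>2 \<partial>\<mu>)" .
  have "marginal v (\<lambda>x. of_real (res E x) * sym_product v A x) p =
      (\<integral>s. A p * (of_real (v s) * (of_real (res E (p, s)) * of_real (v s)))
          + of_real (v p) * (of_real (res E (p, s)) * (of_real (v s) * A s)) \<partial>\<mu>)"
    unfolding marginal_def sym_product_def
    by (intro Bochner_Integration.integral_cong refl) (simp add: algebra_simps)
  also have "\<dots> = A p * of_real (\<integral>s. res E (p, s) * (v s)\<^sup>2 \<partial>\<mu>)
      + of_real (v p) * (\<integral>s. of_real (res E (p, s)) * (of_real (v s) * A s) \<partial>\<mu>)"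
    unfolding r[symmetric] using i1 i2 by (subst Bochner_Integration.integral_add) auto
  finally show ?thesis .
qed

lemma kernel_pair_Re:
  assumes E: "E < m" and f: "csquare_integrable \<mu> f"
    and eq0: "of_real (w0 - \<tau> * E) * x + (\<integral>p. of_real (v0 p) * f p \<partial>\<mu>) = 0"
    and eq1: "AE p in \<mu>. x * of_real (v0 p) + of_real (D p E) * f p =
      of_real (\<kappa> * v p) * (\<integral>s. of_real (res E (p, s)) * (of_real (v s) * f s) \<partial>\<mu>)"
    and ne: "Re x \<noteq> 0 \<or> \<not> (AE p in \<mu>. Re (f p) = 0)"
  shows "kernel_pair E (Re x) (\<lambda>p. Re (f p))"
  unfolding kernel_pair_def
proof (intro conjI ne csquare_imp_square[OF f])
  have i0: "integrable \<mu> (\<lambda>p. of_real (v0 p) * f p)"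
    by (rule csquare_mult_integrable[OF csquare_continuous[OF v0_torus v0_cont] f])
  have "Re (\<integral>p. of_real (v0 p) * f p \<partial>\<mu>) = (\<integral>p. v0 p * Re (f p) \<partial>\<mu>)"
    using integral_Re[OF i0] by simp
  then show "(w0 - \<tau> * E) * Re x + (\<integral>p. v0 p * Re (f p) \<partial>\<mu>) = 0"
    using arg_cong[OF eq0, of Re] by simp
  show "AE p in \<mu>. Re x * v0 p + D p E * Re (f p) = \<kappa> * v p * (\<integral>s. res E (p, s) * (v s * Re (f s))
      \<partial>\<mu>)"
    using eq1
  proof eventually_elim
    case (elim p)
    have i: "integrable \<mu> (\<lambda>s. of_real (res E (p, s)) * (of_real (v s) * f s))"
      by (rule csquare_integral_exists[OF csquare_res_mult[OF E csquare_v_mult[OF f]]])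
    have "Re (\<integral>s. of_real (res E (p, s)) * (of_real (v s) * f s) \<partial>\<mu>)
        = (\<integral>s. res E (p, s) * (v s * Re (f s)) \<partial>\<mu>)"
      using integral_Re[OF i] by simp
    then show ?case using arg_cong[OF elim, of Re] by simp
  qed
qed

text \<open>
  All coefficients are real, so the real and the imaginary part of a solution are solutions, and at
  least one of them does not vanish.
\<close>

lemma kernel_pair_of_complex:
  assumes E: "E < m" and f: "csquare_integrable \<mu> f"
    and eq0: "of_real (w0 - \<tau> * E) * x + (\<integral>p. of_real (v0 p) * f p \<partial>\<mu>) = 0"
    and eq1: "AE p in \<mu>. x * of_real (v0 p) + of_real (D p E) * f p =
      of_real (\<kappa> * v p) * (\<integral>s. of_real (res E (p, s)) * (of_real (v s) * f s) \<partial>\<mu>)"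
    and ne: "x \<noteq> 0 \<or> \<not> (AE p in \<mu>. f p = 0)"
  shows "\<exists>x f. kernel_pair E x f"
proof (cases "Re x \<noteq> 0 \<or> \<not> (AE p in \<mu>. Re (f p) = 0)")
  case True
  then show ?thesis using kernel_pair_Re[OF E f eq0 eq1] by blast
next
  case False
  let ?f = "\<lambda>p. - \<i> * f p"
  have "Im x \<noteq> 0 \<or> \<not> (AE p in \<mu>. Im (f p) = 0)"
  proof (rule ccontr)
    assume "\<not> ?thesis"
    then have *: "Re x = 0" "Im x = 0" "AE p in \<mu>. Re (f p) = 0" "AE p in \<mu>. Im (f p) = 0"
        using False by auto
    from *(3,4) have "AE p in \<mu>. f p = 0" by eventually_elim (simp add: complex_eq_iff)
    then show False using *(1,2) ne by (simp add: complex_eq_iff)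
  qed
  then have "Re (- \<i> * x) \<noteq> 0 \<or> \<not> (AE p in \<mu>. Re (?f p) = 0)" by simp
  moreover have "of_real (w0 - \<tau> * E) * (- \<i> * x) + (\<integral>p. of_real (v0 p) * ?f p \<partial>\<mu>) = 0"
  proof -
    have "(\<integral>p. of_real (v0 p) * ?f p \<partial>\<mu>) = (\<integral>p. - \<i> * (of_real (v0 p) * f p) \<partial>\<mu>)"
      by (intro Bochner_Integration.integral_cong) auto
    also have "\<dots> = - \<i> * (\<integral>p. of_real (v0 p) * f p \<partial>\<mu>)" by (rule integral_mult_right_zero)
    finally have "of_real (w0 - \<tau> * E) * (- \<i> * x) + (\<integral>p. of_real (v0 p) * ?f p \<partial>\<mu>) =
        - \<i> * (of_real (w0 - \<tau> * E) * x + (\<integral>p. of_real (v0 p) * f p \<partial>\<mu>))"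
      by (simp add: algebra_simps)
    then show ?thesis unfolding eq0 by simp
  qed
  moreover have "AE p in \<mu>. (- \<i> * x) * of_real (v0 p) + of_real (D p E) * ?f p =
      of_real (\<kappa> * v p) * (\<integral>s. of_real (res E (p, s)) * (of_real (v s) * ?f s) \<partial>\<mu>)"
    using eq1
  proof eventually_elim
    case (elim p)
    have "(\<integral>s. of_real (res E (p, s)) * (of_real (v s) * ?f s) \<partial>\<mu>)
        = (\<integral>s. - \<i> * (of_real (res E (p, s)) * (of_real (v s) * f s)) \<partial>\<mu>)"
      by (intro Bochner_Integration.integral_cong) auto
    also have "\<dots> = - \<i> * (\<integral>s. of_real (res E (p, s)) * (of_real (v s) * f s) \<partial>\<mu>)"
        by (rule integral_mult_right_zero)
    finally have "of_real (\<kappa> * v p) * (\<integral>s. of_real (res E (p, s)) * (of_real (v s) * ?f s) \<partial>\<mu>) =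
        - \<i> * (of_real (\<kappa> * v p) * (\<integral>s. of_real (res E (p, s)) * (of_real (v s) * f s) \<partial>\<mu>))" by simp
    also have "\<dots> = - \<i> * (x * of_real (v0 p) + of_real (D p E) * f p)" unfolding elim ..
    finally show ?case by (simp add: algebra_simps)
  qed
  ultimately show ?thesis using kernel_pair_Re[OF E csquare_cmult[OF f]] by blast
qed

end

context operator_matrix
begin

lemma res_mult_L2_sym: "E < m \<Longrightarrow> F \<in> L2_sym \<Longrightarrow> (\<lambda>x. of_real (res E x) * F x) \<in> L2_sym"
  by (rule mult_L2_sym[OF _ res_torus2 res_sym res_continuous])

text \<open>
  The two-particle line of the eigenvalue equation gives \<open>f2\<close> in terms of \<open>f1\<close>; inserted in the
  one-particle line it yields the Schur complement. If \<open>v1 = 0\<close>, the term containing \<open>f2\<close> is absent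
  from the one-particle line, and the same formula holds.
\<close>

lemma kernel_pair_one:
  assumes E: "E < m" and zero: "v1 = (\<lambda>_. 0) \<or> v2 = (\<lambda>_. 0)"
    and f: "(f0, f1, f2) \<in> eigenspace fock_space H (of_real E)"
    and ne: "f0 \<noteq> 0 \<or> \<not> (AE p in \<mu>. f1 p = 0)"
  shows "\<exists>x f. one.kernel_pair E x f"
proof -
  note eqs = eigenvector_equations[OF f]
  note f1 = L2_torusD(3)[OF eqs(1)]
  let ?R = "\<lambda>x. of_real (res E x) * sym_product v1 f1 x"
  have R: "?R \<in> L2_sym" by (rule res_mult_L2_sym[OF E sym_product_L2[OF eqs(1) v1_torus v1_cont]])
  have "AE p in \<mu>. marginal v1 f2 p = - 1 / 2 * marginal v1 ?R p"
  proof (cases "v1 = (\<lambda>_. 0)")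
    case True
    then show ?thesis by (simp add: marginal_def)
  next
    case False
    then have v2: "v2 = (\<lambda>_. 0)" using zero by simp
    have "AE x in \<mu> \<Otimes>\<^sub>M \<mu>. f2 x = - 1 / 2 * ?R x"
      using eqs(5)
    proof eventually_elim
      case (elim x)
      have "(of_real (w2 x) - of_real E) * f2 x = - 1 / 2 * sym_product v1 f1 x"
        using elim by (simp add: v2 sym_product_def[of "\<lambda>_. 0"] algebra_simps add_eq_0_iff2)
      also have "\<dots> = (of_real (w2 x) - of_real E) * (- 1 / 2 * ?R x)"
        using res_inverse[OF E, of x "sym_product v1 f1 x"] by simp
      finally have "(of_real (w2 x) - of_real E) * (f2 x - (- 1 / 2 * ?R x)) = 0"
        by (simp only: right_diff_distrib) simp
      moreover have "w2 x \<noteq> E" using m_le[of x] E by simp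
      ultimately have "f2 x - (- 1 / 2 * ?R x) = 0" by simp
      then show ?case by (simp only: right_minus_eq)
    qed
    then have "AE p in \<mu>. marginal v1 f2 p = marginal v1 (\<lambda>x. - 1 / 2 * ?R x) p"
      using one.csquare_v
      by (intro marginal_cong_AE L2_symD(4) eqs(2) L2_sym_cmult R) (auto simp:
          csquare_integrable_def)
    moreover have "marginal v1 (\<lambda>x. - 1 / 2 * ?R x) p = - 1 / 2 * marginal v1 ?R p" for p
    proof -
      have "marginal v1 (\<lambda>x. - 1 / 2 * ?R x) p = (\<integral>s. - 1 / 2 * (of_real (v1 s) * ?R (p, s)) \<partial>\<mu>)"
        unfolding marginal_def by (intro Bochner_Integration.integral_cong) auto
      then show ?thesis unfolding marginal_def by (simp only: integral_mult_right_zero)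
    qed
    ultimately show ?thesis by simp
  qed
  with eqs(4) have eq1: "AE p in \<mu>. f0 * of_real (v0 p) + of_real (one.D p E) * f1 p =
      of_real (1 / 2 * v1 p) * (\<integral>s. of_real (res E (p, s)) * (of_real (v1 s) * f1 s) \<partial>\<mu>)"
  proof eventually_elim
    case (elim p)
    have D: "one.D p E = w1 p - E - 1 / 2 * (\<integral>s. res E (p, s) * (v1 s)\<^sup>2 \<partial>\<mu>)"
        by (simp add: one.D_res)
    show ?case
      using elim unfolding one.marginal_res_sym_product[OF E f1] D by (simp add: algebra_simps)
  qed
  have eq0: "of_real (w0 - 1 * E) * f0 + (\<integral>p. of_real (v0 p) * f1 p \<partial>\<mu>) = 0"
    using eqs(3) by (simp add: algebra_simps)
  show ?thesis by (rule one.kernel_pair_of_complex[OF E f1 eq0 eq1 ne])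
qed

text \<open>
  Without \<open>v1\<close> the two-particle component is an eigenvector of \<open>w2 - V\<close>,
      and \<open>marginal v2 f2\<close> determines
  it.
\<close>

lemma kernel_pair_two:
  assumes E: "E < m" and v1: "v1 = (\<lambda>_. 0)"
    and f: "(f0, f1, f2) \<in> eigenspace fock_space H (of_real E)"
    and ne: "\<not> (AE x in \<mu> \<Otimes>\<^sub>M \<mu>. f2 x = 0)"
  shows "\<exists>x f. two.kernel_pair E x f"
proof -
  note eqs = eigenvector_equations[OF f]
  define F where "F = marginal v2 f2"
  have F_L2: "F \<in> L2_torus" unfolding F_def by (rule marginal_L2[OF eqs(2) v2_torus v2_cont])
  note F = L2_torusD(3)[OF F_L2]
  let ?R = "\<lambda>x. of_real (res E x) * sym_product v2 F x"
  have R: "?R \<in> L2_sym" by (rule res_mult_L2_sym[OF E sym_product_L2[OF F_L2 v2_torus v2_cont]])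
  have f2: "AE x in \<mu> \<Otimes>\<^sub>M \<mu>. f2 x = ?R x"
    using eqs(5)
  proof eventually_elim
    case (elim x)
    have "(of_real (w2 x) - of_real E) * f2 x = sym_product v2 F x"
      using elim by (simp add: v1 F_def sym_product_def[of "\<lambda>_. 0"] algebra_simps)
    also have "\<dots> = (of_real (w2 x) - of_real E) * ?R x"
      using res_inverse[OF E, of x "sym_product v2 F x"] by simp
    finally have "(of_real (w2 x) - of_real E) * (f2 x - ?R x) = 0"
      by (simp only: right_diff_distrib) simp
    moreover have "w2 x \<noteq> E" using m_le[of x] E by simp
    ultimately show ?case by simp
  qed
  have "AE p in \<mu>. F p = marginal v2 ?R p"
    unfolding F_def[unfolded F_def] using two.csquare_v f2
    by (subst F_def, intro marginal_cong_AE L2_symD(4) eqs(2) R) (auto simp: csquare_integrable_def)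
  then have eq1: "AE p in \<mu>. 0 * of_real 0 + of_real (two.D p E) * F p =
      of_real (1 * v2 p) * (\<integral>s. of_real (res E (p, s)) * (of_real (v2 s) * F s) \<partial>\<mu>)"
  proof eventually_elim
    case (elim p)
    have D: "two.D p E = 1 - (\<integral>s. res E (p, s) * (v2 s)\<^sup>2 \<partial>\<mu>)" by (simp add: two.D_res)
    show ?case
      using elim unfolding two.marginal_res_sym_product[OF E F] D by (simp add: algebra_simps)
  qed
  have "\<not> (AE p in \<mu>. F p = 0)"
  proof
    assume F0: "AE p in \<mu>. F p = 0"
    have "AE x in \<mu> \<Otimes>\<^sub>M \<mu>. f2 x = 0"
      using f2 AE_torus_fst[OF F0] AE_torus_snd[OF F0]
          by eventually_elim (simp add: sym_product_def)
    then show False using ne by simp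
  qed
  then show ?thesis
    by (intro two.kernel_pair_of_complex[OF E F _ eq1]) auto
qed

lemma two_particle_component_determined:
  assumes E: "E < m" and v2: "v2 = (\<lambda>_. 0)"
    and f: "(f0, f1, f2) \<in> eigenspace fock_space H (of_real E)" and f1: "AE p in \<mu>. f1 p = 0"
  shows "AE x in \<mu> \<Otimes>\<^sub>M \<mu>. f2 x = 0"
  using eigenvector_equations(5)[OF f] AE_torus_fst[OF f1] AE_torus_snd[OF f1]
proof eventually_elim
  case (elim x)
  have "w2 x \<noteq> E" using m_le[of x] E by simp
  moreover have "of_real (w2 x) * f2 x = of_real E * f2 x" using elim
      by (simp add: v2 sym_product_def)
  ultimately show ?case by simp
qed

end

section \<open>Zeros of the Fredholm determinants lie in the spectrum\<close>

text \<open>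
  The point \<open>c\<close> may lie on a face of the cell, where a small ball around it leaves the cell; a
      nearby
  interior point is used instead.
\<close>

lemma ball_in_cell:
  assumes "open S" "c \<in> S" "c \<in> torus_cell"
  obtains y r where "r > 0" "ball y r \<subseteq> S" "ball y r \<subseteq> torus_cell"
proof -
  let ?U = "box (\<chi> i. - pi) (\<chi> i. pi) :: R3 set"
  have "?U \<noteq> {}" by (simp add: interval_ne_empty_cart)
  then have "c \<in> closure ?U"
    using assms(3) cell_subset_cube by (simp add: closure_box torus_cube_def subset_iff)
  then have "S \<inter> ?U \<noteq> {}" using assms open_Int_closure_eq_empty[OF assms(1), of ?U] by auto
  moreover have "open (S \<inter> ?U)" using assms(1) open_box by blast
  ultimately obtain y r where "r > 0" "ball y r \<subseteq> S \<inter> ?U" using open_contains_ball by blast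
  moreover have "?U \<subseteq> torus_cell" by (auto simp: torus_cell_def mem_box_cart less_imp_le)
  ultimately show ?thesis using that by blast
qed

lemma continuous_null_imp_zero:
  fixes u :: "R3 \<Rightarrow> real"
  assumes "torus_fun u" "continuous_on UNIV u" "AE p in \<mu>. u p = 0"
  shows "u = (\<lambda>_. 0)"
proof (rule ccontr)
  assume "u \<noteq> (\<lambda>_. 0)"
  then obtain p where "u p \<noteq> 0" by auto
  then have "torus_rep p \<in> {p. u p \<noteq> 0}" using torus_fun_rep[OF assms(1)] by simp
  moreover have "open {p. u p \<noteq> 0}" using assms(2) by (intro open_Collect_neq) auto
  ultimately obtain y r where r: "r > 0" "ball y r \<subseteq> {p. u p \<noteq> 0}" "ball y r \<subseteq> torus_cell"
    using ball_in_cell torus_rep_in_cell by metis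
  have "AE p in \<mu>. p \<notin> ball y r" using assms(3) by eventually_elim (use r in auto)
  then have "emeasure \<mu> (ball y r) = 0"
    using r(3) by (subst (asm) AE_iff_null_sets[symmetric])
      (auto simp: null_sets_def sets_torus_measure sets_restrict_space)
  then have "ball y r \<in> null_sets lborel" using r(3) by (simp add: emeasure_torus null_sets_def)
  then show False using r(1) unit_ball_vol_pos[of 3] by (simp add: null_sets_def emeasure_ball)
qed

context pencil
begin

text \<open>
  Singular sequences are replaced by one indicator function of a small ball around a zero of
  \<open>D E\<close>: on the ball \<open>D E\<close> is small, and the integral terms are of second order in its volume.
\<close>

lemma test_function:
  assumes E: "E < m" and D0: "D p0 E = 0" and L: "L > 0"
  obtains \<phi> :: "R3 \<Rightarrow> real" where "(\<lambda>p. complex_of_real (\<phi> p)) \<in> L2_torus"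
    "square_integrable (\<lambda>p. D p E * \<phi> p - \<kappa> * v p * (\<integral>s. res E (p, s) * (v s * \<phi> s) \<partial>\<mu>))"
    "L * ((\<integral>p. v0 p * \<phi> p \<partial>\<mu>)\<^sup>2 +
      (\<integral>p. (D p E * \<phi> p - \<kappa> * v p * (\<integral>s. res E (p, s) * (v s * \<phi> s) \<partial>\<mu>))\<^sup>2 \<partial>\<mu>)) < (\<integral>p. (\<phi> p)\<^sup>2 \<partial>\<mu>)"
proof -
  obtain C where C: "C > 0" "\<And>p. \<bar>v p\<bar> \<le> C" using torus_fun_bounded[OF v_torus v_cont] by blast
  obtain C0 where C0: "C0 > 0" "\<And>p. \<bar>v0 p\<bar> \<le> C0" using torus_fun_bounded[OF v0_torus v0_cont]
      by blast
  define d where "d = 1 / (m - E)"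
  have d: "d > 0" using E by (simp add: d_def)
  have res_le: "\<bar>res E x\<bar> \<le> d" for x
    using m_le[of x] E unfolding res_def d_def by (auto simp: abs_if field_simps)
  define T where "T = measure \<mu> torus_cell"
  define C1 where "C1 = 2 * (\<kappa> * C * (d * C))\<^sup>2"
  define C2 where "C2 = C0\<^sup>2 + C1 * T"
  have T: "T \<ge> 0" by (simp add: T_def)
  have C2: "C2 \<ge> 0" using T by (simp add: C2_def C1_def)
  \<comment> \<open>The bound \<open>\<epsilon>\<close> on \<open>D\<close> contributes at most a quarter of the norm, the bound \<open>\<eta>\<close> on the volume at
    most half of it.\<close>
  define \<epsilon> where "\<epsilon> = sqrt (1 / (8 * L))"
  have \<epsilon>: "\<epsilon> > 0" "2 * L * \<epsilon>\<^sup>2 = 1 / 4" using L by (simp_all add: \<epsilon>_def)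
  define \<eta> where "\<eta> = 1 / (2 * L * (C2 + 1))"
  have \<eta>: "\<eta> > 0" using L C2 by (simp add: \<eta>_def)
  have Dc: "continuous_on UNIV (\<lambda>p. D p E)" using D_cont_fst E by simp
  have "open {p. \<bar>D p E\<bar> < \<epsilon>}" by (intro open_Collect_less continuous_intros Dc)
  moreover have "torus_rep p0 \<in> {p. \<bar>D p E\<bar> < \<epsilon>}" using torus_fun_rep[OF D_torus, of p0 E] D0 \<epsilon>
      by simp
  ultimately obtain y r where r: "r > 0" "ball y r \<subseteq> {p. \<bar>D p E\<bar> < \<epsilon>}" "ball y r \<subseteq> torus_cell"
    using ball_in_cell torus_rep_in_cell by metis
  define V3 where "V3 = unit_ball_vol (real DIM(R3))"
  have V3: "V3 > 0" by (simp add: V3_def unit_ball_vol_pos)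
  define r' where "r' = min (min r 1) (\<eta> / (2 * V3))"
  have r': "r' > 0" "r' \<le> r" "r' \<le> 1" "r' \<le> \<eta> / (2 * V3)" using r(1) \<eta> V3 by (auto simp: r'_def)
  define A where "A = ball y r'"
  have A: "A \<subseteq> torus_cell" "A \<subseteq> {p. \<bar>D p E\<bar> < \<epsilon>}" "A \<in> sets borel"
  proof -
    have "A \<subseteq> ball y r" using r'(2) by (simp add: A_def subset_ball)
    then show "A \<subseteq> torus_cell" "A \<subseteq> {p. \<bar>D p E\<bar> < \<epsilon>}" using r(2,3) by blast+
  qed (simp add: A_def)
  define a where "a = measure \<mu> A"
  have a_eq: "a = V3 * r' ^ 3"
    using A r'(1) unfolding a_def measure_def by (simp add: emeasure_torus A_def emeasure_ball
        V3_def enn2real_ennreal unit_ball_vol_nonneg)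
  have a: "a > 0" "a < \<eta>"
  proof -
    show "a > 0" using V3 r' by (simp add: a_eq)
    have "r' ^ 3 \<le> r'" using r' power_decreasing[of 1 3 r'] by simp
    then have "a \<le> V3 * r'" unfolding a_eq using V3 by (intro mult_left_mono) auto
    also have "\<dots> \<le> V3 * (\<eta> / (2 * V3))" using r' V3 by (intro mult_left_mono) auto
    also have "\<dots> < \<eta>" using V3 \<eta> by simp
    finally show "a < \<eta>" .
  qed
  define \<phi> where "\<phi> p = (indicator A (torus_rep p) :: real)" for p
  have \<phi>_torus: "torus_fun \<phi>" unfolding \<phi>_def by (rule torus_fun_comp_rep)
  have \<phi>_m: "\<phi> \<in> borel_measurable borel"
    unfolding \<phi>_def[abs_def] using A(3) by measurable
  have \<phi>01: "\<phi> p = 0 \<or> \<phi> p = 1" for p by (auto simp: \<phi>_def indicator_def)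
  have \<phi>_sq: "square_integrable \<phi>"
    by (rule square_integrable_bounded[OF measurable_torus[OF \<phi>_m], of 1]) (use \<phi>01 in \<open>metis
        abs_0 abs_1 order_refl zero_le_one\<close>)
  have \<phi>_L2: "(\<lambda>p. complex_of_real (\<phi> p)) \<in> L2_torus"
  proof (rule L2_torusI)
    show "torus_fun (\<lambda>p. complex_of_real (\<phi> p))" using \<phi>_torus by (simp add: torus_fun_def)
    show "(\<lambda>p. complex_of_real (\<phi> p)) \<in> borel_measurable borel" using \<phi>_m by measurable
    show "csquare_integrable \<mu> (\<lambda>p. complex_of_real (\<phi> p))"
      using \<phi>_sq by (auto simp: csquare_integrable_def square_integrable_def)
  qed
  have \<phi>2: "(\<phi> p)\<^sup>2 = \<phi> p" "\<bar>\<phi> p\<bar> = \<phi> p" for p using \<phi>01[of p] by auto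
  have \<phi>_i: "integrable \<mu> \<phi>" by (rule square_integrable_integrable[OF \<phi>_sq])
  have A_sets: "A \<in> sets \<mu>" using A by (auto simp: sets_torus_measure sets_restrict_space)
  have int\<phi>: "(\<integral>p. \<phi> p \<partial>\<mu>) = a"
  proof -
    have "(\<integral>p. \<phi> p \<partial>\<mu>) = (\<integral>p. indicator A p \<partial>\<mu>)"
      by (intro Bochner_Integration.integral_cong) (auto simp: \<phi>_def torus_rep_id)
    also have "\<dots> = a" using A(1) by (simp add: a_def Int_absorb2)
    finally show ?thesis .
  qed
  have small: "\<bar>\<integral>p. b p * \<phi> p \<partial>\<mu>\<bar> \<le> B * a" if b: "\<And>p. \<bar>b p\<bar> \<le> B" for b B
  proof -
    have "\<bar>\<integral>p. b p * \<phi> p \<partial>\<mu>\<bar> \<le> (\<integral>p. B * \<phi> p \<partial>\<mu>)"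
    proof (cases "integrable \<mu> (\<lambda>p. b p * \<phi> p)")
      case True
      have "\<bar>\<integral>p. b p * \<phi> p \<partial>\<mu>\<bar> \<le> (\<integral>p. \<bar>b p * \<phi> p\<bar> \<partial>\<mu>)" by (rule integral_abs_bound)
      also have "\<dots> \<le> (\<integral>p. B * \<phi> p \<partial>\<mu>)"
      proof (rule integral_mono)
        fix p
        have "0 \<le> \<phi> p" using \<phi>01[of p] by auto
        then show "\<bar>b p * \<phi> p\<bar> \<le> B * \<phi> p" unfolding abs_mult \<phi>2(2) by (intro mult_right_mono b)
      qed (use integrable_abs[OF True] \<phi>_i in auto)
      finally show ?thesis .
    next
      case False
      have "0 \<le> B" using b[of 0] by linarith
      then show ?thesis using False a(1) by (simp add: not_integrable_integral_eq int\<phi>)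
    qed
    then show ?thesis by (simp add: int\<phi>)
  qed
  define J where "J p = (\<integral>s. res E (p, s) * (v s * \<phi> s) \<partial>\<mu>)" for p
  have J: "\<bar>J p\<bar> \<le> d * C * a" for p
  proof -
    have "\<bar>res E (p, s) * v s\<bar> \<le> d * C" for s unfolding abs_mult using C res_le d
        by (intro mult_mono) auto
    from small[OF this] show ?thesis by (simp add: J_def mult.assoc)
  qed
  have [measurable]: "\<phi> \<in> borel_measurable \<mu>" by (rule measurable_torus[OF \<phi>_m])
  have J_m: "J \<in> borel_measurable \<mu>"
    unfolding J_def[abs_def] by (intro torus.borel_measurable_lebesgue_integral) (simp add:
        case_prod_unfold)
  have J_sq: "square_integrable J" by (rule square_integrable_bounded[OF J_m J])
  define G where "G p = D p E * \<phi> p - \<kappa> * v p * J p" for p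
  have G_sq: "square_integrable G"
  proof -
    have "square_integrable (\<lambda>p. D p E * \<phi> p + (- \<kappa>) * (v p * J p))"
      using E by (intro square_integrable_add square_integrable_cmult D_mult v_mult \<phi>_sq J_sq) auto
    then show ?thesis unfolding G_def[abs_def] by (simp add: mult.assoc)
  qed
  have G2: "(G p)\<^sup>2 \<le> 2 * \<epsilon>\<^sup>2 * \<phi> p + C1 * a\<^sup>2" if p: "p \<in> torus_cell" for p
  proof -
    have "(D p E * \<phi> p)\<^sup>2 \<le> \<epsilon>\<^sup>2 * \<phi> p"
    proof (cases "p \<in> A")
      case True
      then have "\<bar>D p E\<bar> \<le> \<bar>\<epsilon>\<bar>" using A(2) \<epsilon>(1) by auto
      then have "(D p E)\<^sup>2 \<le> \<epsilon>\<^sup>2" by (simp only: abs_le_square_iff)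
      then show ?thesis unfolding power_mult_distrib \<phi>2 using \<phi>01[of p] by auto
    next
      case False
      then show ?thesis using p by (simp add: \<phi>_def torus_rep_id)
    qed
    moreover have "(\<kappa> * v p * J p)\<^sup>2 \<le> (\<kappa> * C * (d * C * a))\<^sup>2"
    proof -
      have "\<bar>\<kappa> * v p * J p\<bar> \<le> \<kappa> * C * (d * C * a)"
        unfolding abs_mult using J[of p] C d a(1) \<kappa>_pos by (intro mult_mono mult_nonneg_nonneg) auto
      then have "\<bar>\<kappa> * v p * J p\<bar> \<le> \<bar>\<kappa> * C * (d * C * a)\<bar>" by (rule order_trans[OF _ abs_ge_self])
      then show ?thesis by (simp only: abs_le_square_iff)
    qed
    moreover have "(\<kappa> * C * (d * C * a))\<^sup>2 = C1 / 2 * a\<^sup>2"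
        by (simp add: C1_def power_mult_distrib ac_simps)
    moreover have "(G p)\<^sup>2 \<le> 2 * (D p E * \<phi> p)\<^sup>2 + 2 * (\<kappa> * v p * J p)\<^sup>2"
      unfolding G_def using sum_squares_bound[of "D p E * \<phi> p" "- (\<kappa> * v p * J p)"]
          by (simp add: power2_diff)
    ultimately show ?thesis by simp
  qed
  have "(\<integral>p. (G p)\<^sup>2 \<partial>\<mu>) \<le> (\<integral>p. 2 * \<epsilon>\<^sup>2 * \<phi> p + C1 * a\<^sup>2 \<partial>\<mu>)"
    using G_sq \<phi>_i G2 by (intro integral_mono) (auto simp: square_integrable_def)
  also have "\<dots> = 2 * \<epsilon>\<^sup>2 * a + C1 * a\<^sup>2 * T" using \<phi>_i by (simp add: int\<phi> T_def)
  finally have 1: "(\<integral>p. (G p)\<^sup>2 \<partial>\<mu>) \<le> 2 * \<epsilon>\<^sup>2 * a + C1 * a\<^sup>2 * T" .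
  have "\<bar>\<integral>p. v0 p * \<phi> p \<partial>\<mu>\<bar> \<le> \<bar>C0 * a\<bar>" using small[of v0, OF C0(2)]
      by (rule order_trans[OF _ abs_ge_self])
  then have 2: "(\<integral>p. v0 p * \<phi> p \<partial>\<mu>)\<^sup>2 \<le> (C0 * a)\<^sup>2" by (simp only: abs_le_square_iff)
  have "L * ((\<integral>p. v0 p * \<phi> p \<partial>\<mu>)\<^sup>2 + (\<integral>p. (G p)\<^sup>2 \<partial>\<mu>)) \<le> L * ((C0 * a)\<^sup>2 + (2 * \<epsilon>\<^sup>2 * a + C1 * a\<^sup>2 * T))"
    using 1 2 L by (intro mult_left_mono add_mono) auto
  also have "\<dots> = (2 * L * \<epsilon>\<^sup>2) * a + (L * C2 * a) * a"
    by (simp add: C2_def power2_eq_square algebra_simps)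
  also have "\<dots> < a"
  proof -
    have "L * C2 * a \<le> L * C2 * \<eta>" using a L C2 by (intro mult_left_mono) auto
    also have "\<dots> = 1 / 2 * (C2 / (C2 + 1))" using L C2 by (simp add: \<eta>_def)
    also have "\<dots> \<le> 1 / 2 * 1" using C2 by (intro mult_left_mono) auto
    finally have "(L * C2 * a) * a \<le> 1 / 2 * a" using a(1) by (intro mult_right_mono) auto
    then show ?thesis using a(1) unfolding \<epsilon>(2) by linarith
  qed
  also have "a = (\<integral>p. (\<phi> p)\<^sup>2 \<partial>\<mu>)" unfolding \<phi>2 int\<phi> ..
  finally show ?thesis
    using that[OF \<phi>_L2] G_sq unfolding G_def J_def by blast
qed

end

context operator_matrix
begin

text \<open>
  The approximate eigenvector has the test function as one-particle component; its two-particle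
  component is chosen to solve the two-particle line exactly.
\<close>

lemma spectrum_one:
  assumes E: "E < m" and zero: "v1 = (\<lambda>_. 0) \<or> v2 = (\<lambda>_. 0)" and D0: "one.D p0 E = 0"
  shows "complex_of_real E \<in> spectrum fock_space H"
proof (rule ccontr)
  assume "complex_of_real E \<notin> spectrum fock_space H"
  then obtain K where K: "K \<ge> 0" "\<And>f. f \<in> vectors fock_space
      \<Longrightarrow> H f - cscale fock_space (of_real E) f \<in> vectors fock_space \<Longrightarrow>
      seminorm fock_space f \<le> K * seminorm fock_space (H f - cscale fock_space (of_real E) f)"
    using resolvent_lower_bound unfolding spectrum_def by blast
  have L: "K\<^sup>2 + 1 > 0" by (simp add: add_nonneg_pos)
  obtain \<phi> where \<phi>_L2: "(\<lambda>p. complex_of_real (\<phi> p)) \<in> L2_torus"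
    and est: "(K\<^sup>2 + 1) * ((\<integral>p. v0 p * \<phi> p \<partial>\<mu>)\<^sup>2 +
      (\<integral>p. (one.D p E * \<phi> p - 1 / 2 * v1 p * (\<integral>s. res E (p, s) * (v1 s * \<phi> s) \<partial>\<mu>))\<^sup>2 \<partial>\<mu>))
          < (\<integral>p. (\<phi> p)\<^sup>2 \<partial>\<mu>)"
    by (rule one.test_function[OF E D0 L], rule that)
  let ?\<phi> = "\<lambda>p. complex_of_real (\<phi> p)"
  let ?R = "\<lambda>x. of_real (res E x) * sym_product v1 ?\<phi> x"
  define f2 where "f2 x = - 1 / 2 * ?R x" for x
  have R_L2: "?R \<in> L2_sym" by (rule res_mult_L2_sym[OF E sym_product_L2[OF \<phi>_L2 v1_torus v1_cont]])
  have f2_L2: "f2 \<in> L2_sym" unfolding f2_def[abs_def] by (rule L2_sym_cmult[OF R_L2])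
  have fv: "(0, ?\<phi>, f2) \<in> vectors fock_space" using \<phi>_L2 f2_L2 by (simp add: fock_vectors)
  define G where "G p = one.D p E * \<phi> p - 1 / 2 * v1 p * (\<integral>s. res E (p, s) * (v1 s * \<phi> s) \<partial>\<mu>)" for p
  have m: "marginal v1 f2 p = - 1 / 2 * marginal v1 ?R p" for p
  proof -
    have "marginal v1 f2 p = (\<integral>s. - 1 / 2 * (of_real (v1 s) * ?R (p, s)) \<partial>\<mu>)"
      unfolding marginal_def f2_def by (intro Bochner_Integration.integral_cong) auto
    then show ?thesis unfolding marginal_def by (simp only: integral_mult_right_zero)
  qed
  have c1: "of_real (w1 p) * ?\<phi> p + marginal v1 f2 p - of_real E * ?\<phi> p = of_real (G p)" for p
  proof -
    have "(\<integral>s. of_real (res E (p, s)) * (of_real (v1 s) * ?\<phi> s) \<partial>\<mu>)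
        = (\<integral>s. complex_of_real (res E (p, s) * (v1 s * \<phi> s)) \<partial>\<mu>)"
      by simp
    also have "\<dots> = of_real (\<integral>s. res E (p, s) * (v1 s * \<phi> s) \<partial>\<mu>)" by (rule integral_complex_of_real)
    finally have J: "(\<integral>s. of_real (res E (p, s)) * (of_real (v1 s) * ?\<phi> s) \<partial>\<mu>)
        = complex_of_real (\<integral>s. res E (p, s) * (v1 s * \<phi> s) \<partial>\<mu>)" .
    have D: "one.D p E = w1 p - E - 1 / 2 * (\<integral>s. res E (p, s) * (v1 s)\<^sup>2 \<partial>\<mu>)"
        by (simp add: one.D_res)
    show ?thesis
      unfolding m one.marginal_res_sym_product[OF E L2_torusD(3)[OF \<phi>_L2]] J G_def D
          by (simp add: algebra_simps)
  qed
  have c2: "1 / 2 * sym_product v1 ?\<phi> x + of_real (w2 x) * f2 x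
      + (- 1) * sym_product v2 (marginal v2 f2) x - of_real E * f2 x = 0" for x
  proof -
    have 1: "sym_product v2 (marginal v2 f2) x = 0"
      using zero by (auto simp: sym_product_def f2_def[abs_def] marginal_def)
    have "of_real (w2 x) * f2 x - of_real E * f2 x = - 1 / 2 * ((of_real (w2 x) - of_real E) * ?R
        x)"
      by (simp add: f2_def algebra_simps)
    also have "\<dots> = - 1 / 2 * sym_product v1 ?\<phi> x" unfolding res_inverse[OF E] ..
    finally have 2: "of_real (w2 x) * f2 x - of_real E * f2 x = - 1 / 2 * sym_product v1 ?\<phi> x" .
    have "1 / 2 * sym_product v1 ?\<phi> x + of_real (w2 x) * f2 x
        + (- 1) * sym_product v2 (marginal v2 f2) x - of_real E * f2 x =
        1 / 2 * sym_product v1 ?\<phi> x + (of_real (w2 x) * f2 x - of_real E * f2 x)"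
      unfolding 1 by simp
    then show ?thesis unfolding 2 by simp
  qed
  have c0: "(\<integral>s. of_real (v0 s) * ?\<phi> s \<partial>\<mu>) = of_real (\<integral>p. v0 p * \<phi> p \<partial>\<mu>)"
    using integral_complex_of_real[of \<mu> "\<lambda>p. v0 p * \<phi> p"] by simp
  note Hv = H_vectors[OF fv, unfolded H_apply[OF f2_L2]]
  have Hf: "H (0, ?\<phi>, f2) - cscale fock_space (of_real E) (0, ?\<phi>, f2) =
      (of_real (\<integral>p. v0 p * \<phi> p \<partial>\<mu>), \<lambda>p. of_real (G p), \<lambda>x. 0)"
    unfolding H_apply[OF f2_L2] fock_diff_cscale(1)[OF Hv fv] using c0 c1 c2
        by (simp add: fun_eq_iff)
  have "H (0, ?\<phi>, f2) - cscale fock_space (of_real E) (0, ?\<phi>, f2) \<in> vectors fock_space"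
    unfolding H_apply[OF f2_L2] fock_diff_cscale(1)[OF Hv fv]
        by (rule fock_diff_cscale(2)[OF Hv fv])
  from K(2)[OF fv this]
  have le: "seminorm fock_space (0, ?\<phi>, f2) \<le> K * seminorm fock_space (of_real (\<integral>p. v0 p * \<phi> p
      \<partial>\<mu>), \<lambda>p. complex_of_real (G p), \<lambda>x. 0)"
    unfolding Hf .
  have "(seminorm fock_space (0, ?\<phi>, f2))\<^sup>2 \<le> (K * seminorm fock_space (of_real (\<integral>p. v0 p * \<phi> p
      \<partial>\<mu>), \<lambda>p. complex_of_real (G p), \<lambda>x. 0))\<^sup>2"
    by (rule power_mono[OF le]) (simp add: fock_space_def)
  then have "(\<integral>p. (\<phi> p)\<^sup>2 \<partial>\<mu>) + (\<integral>x. (cmod (f2 x))\<^sup>2 \<partial>(\<mu> \<Otimes>\<^sub>M \<mu>)) \<le> K\<^sup>2 * ((\<integral>p. v0 p * \<phi> p \<partial>\<mu>)\<^sup>2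
      + (\<integral>p. (G p)\<^sup>2 \<partial>\<mu>))"
    by (simp add: fock_space_def power_mult_distrib)
  moreover have "0 \<le> (\<integral>x. (cmod (f2 x))\<^sup>2 \<partial>(\<mu> \<Otimes>\<^sub>M \<mu>))" by simp
  moreover have "K\<^sup>2 * ((\<integral>p. v0 p * \<phi> p \<partial>\<mu>)\<^sup>2 + (\<integral>p. (G p)\<^sup>2 \<partial>\<mu>)) \<le> (K\<^sup>2 + 1) * ((\<integral>p. v0 p * \<phi> p \<partial>\<mu>)\<^sup>2
      + (\<integral>p. (G p)\<^sup>2 \<partial>\<mu>))"
    by (intro mult_right_mono add_nonneg_nonneg) auto
  ultimately show False using est unfolding G_def by linarith
qed

text \<open>
  Here the approximate eigenvector has only a two-particle component. Its norm is bounded below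
  through its marginal \<open>F\<close>, which differs from the test function by the small function \<open>G\<close>.
\<close>

lemma spectrum_two:
  assumes E: "E < m" and v1: "v1 = (\<lambda>_. 0)" and D0: "two.D p0 E = 0"
  shows "complex_of_real E \<in> spectrum fock_space H"
proof (rule ccontr)
  assume "complex_of_real E \<notin> spectrum fock_space H"
  then obtain K where K: "K \<ge> 0" "\<And>f. f \<in> vectors fock_space
      \<Longrightarrow> H f - cscale fock_space (of_real E) f \<in> vectors fock_space \<Longrightarrow>
      seminorm fock_space f \<le> K * seminorm fock_space (H f - cscale fock_space (of_real E) f)"
    using resolvent_lower_bound unfolding spectrum_def by blast
  define V where "V = (\<integral>s. (cmod (complex_of_real (v2 s)))\<^sup>2 \<partial>\<mu>)"
  define L where "L = 2 + 8 * V\<^sup>2 * K\<^sup>2"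
  have V: "V \<ge> 0" by (simp add: V_def)
  have L: "L > 0" by (simp add: L_def add_pos_nonneg)
  obtain \<phi> where \<phi>_L2: "(\<lambda>p. complex_of_real (\<phi> p)) \<in> L2_torus"
    and G_sq: "square_integrable (\<lambda>p. two.D p E * \<phi> p - 1 * v2 p * (\<integral>s. res E (p, s) * (v2 s * \<phi>
        s) \<partial>\<mu>))"
    and est: "L * ((\<integral>p. 0 * \<phi> p \<partial>\<mu>)\<^sup>2 +
      (\<integral>p. (two.D p E * \<phi> p - 1 * v2 p * (\<integral>s. res E (p, s) * (v2 s * \<phi> s) \<partial>\<mu>))\<^sup>2 \<partial>\<mu>))
          < (\<integral>p. (\<phi> p)\<^sup>2 \<partial>\<mu>)"
    by (rule two.test_function[OF E D0 L], rule that)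
  define G where "G p = two.D p E * \<phi> p - 1 * v2 p * (\<integral>s. res E (p, s) * (v2 s * \<phi> s) \<partial>\<mu>)" for p
  let ?\<phi> = "\<lambda>p. complex_of_real (\<phi> p)"
  define f2 where "f2 x = of_real (res E x) * sym_product v2 ?\<phi> x" for x
  have f2_L2: "f2 \<in> L2_sym"
    unfolding f2_def[abs_def] by (rule res_mult_L2_sym[OF E sym_product_L2[OF \<phi>_L2 v2_torus
        v2_cont]])
  have zero_L2: "(\<lambda>_. 0) \<in> L2_torus" by (rule zero_in_L2_torus)
  have fv: "(0, \<lambda>_. 0, f2) \<in> vectors fock_space" using zero_L2 f2_L2 by (simp add: fock_vectors)
  define F where "F = marginal v2 f2"
  have F_csq: "csquare_integrable \<mu> F"
    and F_le: "(\<integral>p. (cmod (F p))\<^sup>2 \<partial>\<mu>) \<le> V * (\<integral>x. (cmod (f2 x))\<^sup>2 \<partial>(\<mu> \<Otimes>\<^sub>M \<mu>))"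
    unfolding F_def V_def by (rule marginal_csquare[OF L2_symD(4)[OF f2_L2] two.csquare_v])+
  have FG: "?\<phi> p = F p + of_real (G p)" for p
  proof -
    have "(\<integral>s. of_real (res E (p, s)) * (of_real (v2 s) * ?\<phi> s) \<partial>\<mu>)
        = (\<integral>s. complex_of_real (res E (p, s) * (v2 s * \<phi> s)) \<partial>\<mu>)"
      by simp
    also have "\<dots> = of_real (\<integral>s. res E (p, s) * (v2 s * \<phi> s) \<partial>\<mu>)" by (rule integral_complex_of_real)
    finally have J: "(\<integral>s. of_real (res E (p, s)) * (of_real (v2 s) * ?\<phi> s) \<partial>\<mu>)
        = complex_of_real (\<integral>s. res E (p, s) * (v2 s * \<phi> s) \<partial>\<mu>)" .
    have D: "two.D p E = 1 - (\<integral>s. res E (p, s) * (v2 s)\<^sup>2 \<partial>\<mu>)" by (simp add: two.D_res)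
    show ?thesis
      unfolding F_def f2_def[abs_def] two.marginal_res_sym_product[OF E L2_torusD(3)[OF \<phi>_L2]] J
          G_def D by (simp add: algebra_simps)
  qed
  have c2: "1 / 2 * sym_product v1 (\<lambda>_. 0) x + of_real (w2 x) * f2 x
      + (- 1) * sym_product v2 (marginal v2 f2) x - of_real E * f2 x =
      sym_product v2 (\<lambda>p. of_real (G p)) x" for x
  proof -
    have "of_real (w2 x) * f2 x - of_real E * f2 x = sym_product v2 ?\<phi> x"
      using res_inverse[OF E, of x "sym_product v2 ?\<phi> x"] by (simp add: f2_def algebra_simps)
    also have "\<dots> = sym_product v2 F x + sym_product v2 (\<lambda>p. of_real (G p)) x"
      unfolding sym_product_def FG by (simp add: algebra_simps)
    finally have *: "of_real (w2 x) * f2 x - of_real E * f2 x = sym_product v2 F x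
        + sym_product v2 (\<lambda>p. of_real (G p)) x" .
    have "1 / 2 * sym_product v1 (\<lambda>_. 0) x + of_real (w2 x) * f2 x
        + (- 1) * sym_product v2 F x - of_real E * f2 x =
        (of_real (w2 x) * f2 x - of_real E * f2 x) - sym_product v2 F x"
      by (simp add: sym_product_def[of v1])
    then show ?thesis unfolding * F_def[symmetric] by simp
  qed
  have c1: "marginal v1 f2 p = 0" for p by (simp add: marginal_def v1)
  note Hv = H_vectors[OF fv, unfolded H_apply[OF f2_L2]]
  have Hf: "H (0, \<lambda>_. 0, f2) - cscale fock_space (of_real E) (0, \<lambda>_. 0, f2) =
      (0, \<lambda>p. 0, sym_product v2 (\<lambda>p. of_real (G p)))"
    unfolding H_apply[OF f2_L2] fock_diff_cscale(1)[OF Hv fv] using c1 c2 by (simp add: fun_eq_iff)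
  have "H (0, \<lambda>_. 0, f2) - cscale fock_space (of_real E) (0, \<lambda>_. 0, f2) \<in> vectors fock_space"
    unfolding H_apply[OF f2_L2] fock_diff_cscale(1)[OF Hv fv]
        by (rule fock_diff_cscale(2)[OF Hv fv])
  from K(2)[OF fv this]
  have le: "seminorm fock_space (0, \<lambda>_. 0, f2) \<le> K * seminorm fock_space (0, \<lambda>p. 0, sym_product v2
      (\<lambda>p. complex_of_real (G p)))"
    unfolding Hf .
  have "(seminorm fock_space (0, \<lambda>_. 0, f2))\<^sup>2 \<le> (K * seminorm fock_space (0, \<lambda>p. 0, sym_product v2
      (\<lambda>p. complex_of_real (G p))))\<^sup>2"
    by (rule power_mono[OF le]) (simp add: fock_space_def)
  then have n2: "(\<integral>x. (cmod (f2 x))\<^sup>2 \<partial>(\<mu> \<Otimes>\<^sub>M \<mu>)) \<le> K\<^sup>2 * (\<integral>x. (cmod (sym_product v2 (\<lambda>p.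
      complex_of_real (G p)) x))\<^sup>2 \<partial>(\<mu> \<Otimes>\<^sub>M \<mu>))"
    by (simp add: fock_space_def power_mult_distrib)
  define g where "g = (\<integral>p. (G p)\<^sup>2 \<partial>\<mu>)"
  have g: "g \<ge> 0" by (simp add: g_def)
  have G_csq: "csquare_integrable \<mu> (\<lambda>p. complex_of_real (G p))"
    using G_sq[folded G_def] by (auto simp: csquare_integrable_def square_integrable_def)
  have "(\<integral>x. (cmod (sym_product v2 (\<lambda>p. complex_of_real (G p)) x))\<^sup>2 \<partial>(\<mu> \<Otimes>\<^sub>M \<mu>)) \<le> 4 * V * g"
    using sym_product_csquare(2)[OF G_csq two.csquare_v] by (simp add: V_def g_def)
  then have "K\<^sup>2 * (\<integral>x. (cmod (sym_product v2 (\<lambda>p. complex_of_real (G p)) x))\<^sup>2 \<partial>(\<mu> \<Otimes>\<^sub>M \<mu>))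
      \<le> K\<^sup>2 * (4 * V * g)"
    by (intro mult_left_mono) auto
  then have "V * (\<integral>x. (cmod (f2 x))\<^sup>2 \<partial>(\<mu> \<Otimes>\<^sub>M \<mu>)) \<le> V * (K\<^sup>2 * (4 * V * g))"
    using n2 V by (intro mult_left_mono) auto
  then have F: "(\<integral>p. (cmod (F p))\<^sup>2 \<partial>\<mu>) \<le> V * (K\<^sup>2 * (4 * V * g))" using F_le by linarith
  have "(\<integral>p. (\<phi> p)\<^sup>2 \<partial>\<mu>) = (\<integral>p. (cmod (?\<phi> p))\<^sup>2 \<partial>\<mu>)" by simp
  also have "\<dots> \<le> 2 * (\<integral>p. (cmod (F p))\<^sup>2 \<partial>\<mu>) + 2 * (\<integral>p. (cmod (complex_of_real (G p)))\<^sup>2 \<partial>\<mu>)"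
    unfolding FG by (rule csquare_integral_add_le[OF F_csq G_csq])
  also have "(\<integral>p. (cmod (complex_of_real (G p)))\<^sup>2 \<partial>\<mu>) = g" by (simp add: g_def)
  also have "2 * (\<integral>p. (cmod (F p))\<^sup>2 \<partial>\<mu>) + 2 * g \<le> 2 * (V * (K\<^sup>2 * (4 * V * g))) + 2 * g" using F
      by linarith
  also have "\<dots> = L * g" by (simp add: L_def power2_eq_square algebra_simps)
  finally have "(\<integral>p. (\<phi> p)\<^sup>2 \<partial>\<mu>) \<le> L * g" .
  moreover have "L * g < (\<integral>p. (\<phi> p)\<^sup>2 \<partial>\<mu>)" using est by (simp add: g_def G_def)
  ultimately show False by simp
qed

section \<open>Finiteness of the discrete spectrum below the threshold\<close>

lemma isolated_energy:
  assumes iso: "complex_of_real E isolated_in spectrum fock_space H"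
    and spec: "\<And>e p. e < m \<Longrightarrow> D p e = 0 \<Longrightarrow> complex_of_real e \<in> spectrum fock_space H"
  shows "\<exists>d>0. \<forall>e p. e \<noteq> E \<longrightarrow> \<bar>e - E\<bar> < d \<longrightarrow> e < m \<longrightarrow> D p e \<noteq> (0 :: real)"
proof -
  obtain d where d: "d > 0" "\<And>y. y \<in> spectrum fock_space H \<Longrightarrow> dist (complex_of_real E) y < d \<Longrightarrow> y
      = complex_of_real E"
    using iso unfolding isolated_in_dist_Ex_iff by blast
  have "D p e \<noteq> 0" if "e \<noteq> E" "\<bar>e - E\<bar> < d" "e < m" for e p
  proof
    assume "D p e = 0"
    then have "complex_of_real e \<in> spectrum fock_space H" using spec that(3) by blast
    moreover have "dist (complex_of_real E) (complex_of_real e) < d"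
      using that(2) by (simp add: dist_real_def abs_minus_commute)
    ultimately have "complex_of_real e = complex_of_real E" by (rule d(2))
    then show False using that(1) by simp
  qed
  then show ?thesis using d(1) by blast
qed

lemma Delta1_eq: "Delta1 w1 w2 v1 = one.D"
  by (simp add: fun_eq_iff Delta1_def one.D_def)

lemma Delta2_eq: "Delta2 w2 v2 = two.D"
  by (simp add: fun_eq_iff Delta2_def two.D_def)

text \<open>
  An eigenvector has nonzero components of order at most one, or its two-particle component is
  nonzero; the first case is counted by \<open>Delta1\<close>, the second one by \<open>Delta2\<close>.
\<close>

lemma finite_discrete_spectrum:
  assumes zero: "v1 = (\<lambda>_. 0) \<or> v2 = (\<lambda>_. 0)"
    and c1: "threshold_condition (Delta1 w1 w2 v1) (sigma1 w1 w2 v1) m"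
    and c2: "threshold_condition (Delta2 w2 v2) (sigma2 w2 v2) m"
  shows "finite {E :: real. E < m \<and> complex_of_real E \<in> discrete_spectrum fock_space H}" (is
      "finite ?T")
proof -
  define T1 where "T1 = {E \<in> ?T. \<exists>x f. one.kernel_pair E x f}"
  define T2 where "T2 = {E \<in> ?T. v1 = (\<lambda>_. 0) \<and> (\<exists>x f. two.kernel_pair E x f)}"
  have iso: "complex_of_real E isolated_in spectrum fock_space H" if "E \<in> ?T" for E
    using that by (simp add: discrete_spectrum_def)
  have "finite T1"
  proof (rule one.finite_of_threshold_condition[OF c1[unfolded Delta1_eq]])
    fix E assume "E \<in> sigma1 w1 w2 v1" "E \<le> m"
    then show "\<exists>p. one.D p E = 0" using one.h1_eigenvalue_zero by (auto simp: sigma1_def)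
  next
    fix E p assume E: "E < m" "one.D p E = 0"
    then have "one.D (torus_rep p) E = 0" using torus_fun_rep[OF one.D_torus] by simp
    then show "E \<in> sigma1 w1 w2 v1"
      using one.h1_eigenvalue[OF refl refl E(1)] torus_rep_in_cell by (auto simp: sigma1_def)
  next
    fix E assume "E \<in> T1"
    then show "E < m \<and> (\<exists>x f. one.kernel_pair E x f)" by (simp add: T1_def)
    show "\<exists>d>0. \<forall>e p. e \<noteq> E \<longrightarrow> \<bar>e - E\<bar> < d \<longrightarrow> e < m \<longrightarrow> one.D p e \<noteq> 0"
    proof (rule isolated_energy)
      show "complex_of_real E isolated_in spectrum fock_space H" using \<open>E \<in> T1\<close>
          by (intro iso) (simp add: T1_def)
    qed (rule spectrum_one[OF _ zero])
  qed
  moreover have "finite T2"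
  proof (cases "v1 = (\<lambda>_. 0)")
    case True
    show ?thesis
    proof (rule two.finite_of_threshold_condition[OF c2[unfolded Delta2_eq]])
      fix E assume "E \<in> sigma2 w2 v2" "E \<le> m"
      then show "\<exists>p. two.D p E = 0" using two.h2_eigenvalue_zero by (auto simp: sigma2_def)
    next
      fix E p assume E: "E < m" "two.D p E = 0"
      then have "two.D (torus_rep p) E = 0" using torus_fun_rep[OF two.D_torus] by simp
      then show "E \<in> sigma2 w2 v2"
        using two.h2_eigenvalue[OF refl refl E(1)] torus_rep_in_cell by (auto simp: sigma2_def)
    next
      fix E assume "E \<in> T2"
      then show "E < m \<and> (\<exists>x f. two.kernel_pair E x f)" by (simp add: T2_def)
      show "\<exists>d>0. \<forall>e p. e \<noteq> E \<longrightarrow> \<bar>e - E\<bar> < d \<longrightarrow> e < m \<longrightarrow> two.D p e \<noteq> 0"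
      proof (rule isolated_energy)
        show "complex_of_real E isolated_in spectrum fock_space H" using \<open>E \<in> T2\<close> unfolding T2_def
            by (intro iso) blast
      qed (rule spectrum_two[OF _ True])
    qed
  qed (simp add: T2_def)
  moreover have "?T \<subseteq> T1 \<union> T2"
  proof
    fix E assume E: "E \<in> ?T"
    then obtain f where f: "f \<in> eigenspace fock_space H (of_real E)" "seminorm fock_space f \<noteq> 0"
      by (auto simp: discrete_spectrum_def)
    obtain f0 f1 f2 where f012: "f = (f0, f1, f2)" by (metis surj_pair)
    have fv: "(f0, f1, f2) \<in> vectors fock_space" using f(1) by (simp add: eigenspace_def f012)
    have Em: "E < m" using E by simp
    show "E \<in> T1 \<union> T2"
    proof (cases "f0 \<noteq> 0 \<or> \<not> (AE p in \<mu>. f1 p = 0)")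
      case True
      then show ?thesis using kernel_pair_one[OF Em zero f(1)[unfolded f012]] E
          by (simp add: T1_def)
    next
      case False
      then have f2: "\<not> (AE x in \<mu> \<Otimes>\<^sub>M \<mu>. f2 x = 0)"
        using f(2) fock_null_iff[OF fv] by (simp add: f012)
      then have "v2 \<noteq> (\<lambda>_. 0)"
        using two_particle_component_determined[OF Em _ f(1)[unfolded f012]] False by auto
      then have v1: "v1 = (\<lambda>_. 0)" using zero by blast
      then show ?thesis using kernel_pair_two[OF Em v1 f(1)[unfolded f012] f2] E
          by (simp add: T2_def)
    qed
  qed
  ultimately show ?thesis using finite_subset by blast
qed

end

lemma torus_fun_imp_two_pi_bar_periodic:
  assumes "torus_fun f"
  shows "two_pi_bar_periodic f"
proof -
  have "2 *\<^sub>R pi_bar = (\<chi> i. 2 * pi * of_int 1)" by (simp add: vec_eq_iff pi_bar_def)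
  then show ?thesis
    using torus_fun_shift_lattice[OF assms, of _ "\<lambda>_. 1"] unfolding two_pi_bar_periodic_def by simp
qed

text \<open>
  A function on the torus is itself \<open>2 * pi_bar\<close> periodic, so \<open>v\<close> is orthogonal to itself.
\<close>

lemma annihilates_periodic_imp_zero:
  assumes v: "torus_fun v" "continuous_on UNIV v" and ann: "annihilates_periodic v"
  shows "v = (\<lambda>_. 0)"
proof (rule continuous_null_imp_zero[OF v])
  let ?v = "\<lambda>p. complex_of_real (v p)"
  have L2: "?v \<in> L2_torus" by (rule L2_torus_continuous[OF v])
  then have "(\<integral>s. of_real (v s) * ?v s \<partial>\<mu>) = 0"
    using ann torus_fun_imp_two_pi_bar_periodic[OF L2_torusD(1)[OF L2]]
        unfolding annihilates_periodic_def by blast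
  then have "complex_of_real (\<integral>s. (v s)\<^sup>2 \<partial>\<mu>) = 0"
    unfolding integral_complex_of_real[symmetric] by (simp add: power2_eq_square)
  then have "(\<integral>s. (v s)\<^sup>2 \<partial>\<mu>) = 0" by simp
  moreover have "integrable \<mu> (\<lambda>s. (v s)\<^sup>2)"
    using square_integrable_continuous[OF v] by (simp add: square_integrable_def)
  ultimately have "AE s in \<mu>. (v s)\<^sup>2 = 0"
    using integral_nonneg_eq_0_iff_AE[of \<mu> "\<lambda>s. (v s)\<^sup>2"] by simp
  then show "AE p in \<mu>. v p = 0" by simp
qed

theorem theorem2p8:
  fixes w0 :: real
    and w1 v0 v1 v2 :: "R3 \<Rightarrow> real"
    and w2 :: "R3 \<times> R3 \<Rightarrow> real"
    and p0 :: "R3"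
    and m :: real
  assumes w1: "torus_fun w1" "continuous_on UNIV w1"
    and v0: "torus_fun v0" "continuous_on UNIV v0"
    and v1: "torus_fun v1" "continuous_on UNIV v1"
    and v2: "torus_fun v2" "continuous_on UNIV v2"
    and w2: "torus_fun2 w2" "sym_fun w2" "continuous_on UNIV w2"
    and m: "m = minimum (w2 ` (torus_cell \<times> torus_cell))"
    and a: "(two_pi_bar_periodic v1 \<and> annihilates_periodic v2) \<or>
            (two_pi_bar_periodic v2 \<and> annihilates_periodic v1)"
    and b_periodic: "\<And>p q. w2 (p + 2 *\<^sub>R pi_bar, q) = w2 (p, q)"
                    "\<And>p q. w2 (p, q + 2 *\<^sub>R pi_bar) = w2 (p, q)"
    and b_min: "unique_nondegenerate_min w2 (p0, p0)"
    and b_smooth: "continuous_third_partials w1" "continuous_third_partials w2"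
    and c1: "threshold_condition (Delta1 w1 w2 v1) (sigma1 w1 w2 v1) m"
    and c2: "threshold_condition (Delta2 w2 v2) (sigma2 w2 v2) m"
  shows "finite {E :: real. E < m \<and>
           complex_of_real E \<in> discrete_spectrum fock_space (H_op w0 w1 w2 v0 v1 v2)}"
proof -
  obtain g N where gN: "integrable \<mu> g" "finite N" "\<And>x. m \<le> w2 x"
    "\<And>p s. s \<in> torus_cell - N \<Longrightarrow> w2 (p, s) > m \<and> 1 / (w2 (p, s) - m) \<le> g s"
    by (rule symbol_minimum_bound[OF w2(1,3) m b_min b_smooth(2)], rule that)
  interpret operator_matrix w2 m g N w0 w1 v0 v1 v2
    by unfold_locales (fact w1 v0 v1 v2 w2 gN)+
  have "v1 = (\<lambda>_. 0) \<or> v2 = (\<lambda>_. 0)"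
    using a annihilates_periodic_imp_zero v1 v2 by blast
  then show ?thesis by (rule finite_discrete_spectrum[OF _ c1 c2])
qed

end
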